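(* Let $2\le r<m\le n$ and $k\ge2$. Then the variety $\mathcal Z^{m,n}_{r,k}$ is not normal, and, unless possibly $(m,n)=(r+1,r+2)$, it is not Cohen–Macaulay (its coordinate ring is not Cohen–Macaulay).
   Context: Let $F$ be an algebraically closed field. For integers $1\le r\le m\le n$ and $k\ge 1$, let $S=F[x^{(l)}_{i,j}:1\le i\le m,\ 1\le j\le n,\ 0\le l\le k-1]$, the coordinate ring of $\mathbf A^{mnk}_F$, and let $X(t)$ be the $m\times n$ matrix over $S[t]/(t^k)$ with $(i,j)$ entry $x_{i,j}(t)=\sum_{l=0}^{k-1}x^{(l)}_{i,j}t^l$. $\mathcal I^{m,n}_{r,k}\subseteq S$ is the ideal generated by the coefficients of $t^l$, $0\le l\le k-1$, of all $r\times r$ minors of $X(t)$, and $\mathcal Z^{m,n}_{r,k}\subseteq\mathbf A^{mnk}_F$ is its zero set. *)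

theory Defs
  imports "HOL-Computational_Algebra.Polynomial" "HOL-Library.Extended_Nat" "Jordan_Normal_Form.Determinant"
begin

definition alg_closed_field :: "'a::field itself \<Rightarrow> bool" where
  "alg_closed_field _ \<longleftrightarrow> (\<forall>q::'a poly. degree q \<ge> 1 \<longrightarrow> (\<exists>x. poly q x = 0))"

inductive_set polyfun :: "'v set \<Rightarrow> (('v \<Rightarrow> 'a::comm_ring_1) \<Rightarrow> 'a) set" for X where
  const: "(\<lambda>p. c) \<in> polyfun X"
| var: "v \<in> X \<Longrightarrow> (\<lambda>p. p v) \<in> polyfun X"
| add: "f \<in> polyfun X \<Longrightarrow> g \<in> polyfun X \<Longrightarrow> (\<lambda>p. f p + g p) \<in> polyfun X"
| mult: "f \<in> polyfun X \<Longrightarrow> g \<in> polyfun X \<Longrightarrow> (\<lambda>p. f p * g p) \<in> polyfun X"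

text \<open>Variables x^(l)_(i,j) are indexed by triples (i,j,l).  Points of A^(mnk) are functions
  on triples vanishing outside the index set.\<close>

definition jet_vars :: "nat \<Rightarrow> nat \<Rightarrow> nat \<Rightarrow> (nat \<times> nat \<times> nat) set" where
  "jet_vars m n k = {(i,j,l). 1 \<le> i \<and> i \<le> m \<and> 1 \<le> j \<and> j \<le> n \<and> l < k}"

definition affine_space :: "nat \<Rightarrow> nat \<Rightarrow> nat \<Rightarrow> ((nat \<times> nat \<times> nat) \<Rightarrow> 'a::zero) set" where
  "affine_space m n k = {p. \<forall>v. v \<notin> jet_vars m n k \<longrightarrow> p v = 0}"

definition jet_entry :: "nat \<Rightarrow> ((nat \<times> nat \<times> nat) \<Rightarrow> 'a::zero) \<Rightarrow> nat \<Rightarrow> nat \<Rightarrow> 'a poly" where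
  "jet_entry k p i j = Poly (map (\<lambda>l. p (i,j,l)) [0..<k])"

text \<open>The minor of X(t) with row set I and column set J (rows/columns in increasing order).
  Coefficients of t^l for l<k are the same over F[t] and F[t]/(t^k).\<close>
definition jet_minor :: "nat \<Rightarrow> ((nat \<times> nat \<times> nat) \<Rightarrow> 'a::comm_ring_1) \<Rightarrow> nat set \<Rightarrow> nat set \<Rightarrow> 'a poly" where
  "jet_minor k p I J = det (mat (card I) (card J)
      (\<lambda>(a,b). jet_entry k p (sorted_list_of_set I ! a) (sorted_list_of_set J ! b)))"

definition jet_det_zero_set :: "nat \<Rightarrow> nat \<Rightarrow> nat \<Rightarrow> nat \<Rightarrow> ((nat \<times> nat \<times> nat) \<Rightarrow> 'a::comm_ring_1) set" where
  "jet_det_zero_set m n r k = {p \<in> affine_space m n k.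
     \<forall>I J. I \<subseteq> {1..m} \<and> J \<subseteq> {1..n} \<and> card I = r \<and> card J = r \<longrightarrow>
       (\<forall>l<k. coeff (jet_minor k p I J) l = 0)}"

text \<open>Pf is the ring of polynomial functions on the ambient space, Z the variety and z \<in> Z.
  An element of O_(Z,z) is represented by a pair (a,s) = a/s with a,s \<in> Pf and s(z) \<noteq> 0;
  two representatives are equal iff u(at - bs) vanishes on Z for some u \<in> Pf with u(z) \<noteq> 0
  (localisation of the coordinate ring Pf/I(Z) at the maximal ideal of z).\<close>

type_synonym ('v,'a) frac = "(('v \<Rightarrow> 'a) \<Rightarrow> 'a) \<times> (('v \<Rightarrow> 'a) \<Rightarrow> 'a)"

definition loc_carrier :: "(('v \<Rightarrow> 'a::comm_ring_1) \<Rightarrow> 'a) set \<Rightarrow> ('v \<Rightarrow> 'a) \<Rightarrow> ('v,'a) frac set" where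
  "loc_carrier Pf z = {(a,s). a \<in> Pf \<and> s \<in> Pf \<and> s z \<noteq> 0}"

definition loc_eq :: "(('v \<Rightarrow> 'a::comm_ring_1) \<Rightarrow> 'a) set \<Rightarrow> ('v \<Rightarrow> 'a) set \<Rightarrow> ('v \<Rightarrow> 'a)
    \<Rightarrow> ('v,'a) frac \<Rightarrow> ('v,'a) frac \<Rightarrow> bool" where
  "loc_eq Pf Z z x y \<longleftrightarrow> (\<exists>u\<in>Pf. u z \<noteq> 0 \<and>
      (\<forall>q\<in>Z. u q * (fst x q * snd y q - fst y q * snd x q) = 0))"

definition loc_add :: "('v,'a::comm_ring_1) frac \<Rightarrow> ('v,'a) frac \<Rightarrow> ('v,'a) frac" where
  "loc_add x y = ((\<lambda>q. fst x q * snd y q + fst y q * snd x q), (\<lambda>q. snd x q * snd y q))"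

definition loc_mul :: "('v,'a::comm_ring_1) frac \<Rightarrow> ('v,'a) frac \<Rightarrow> ('v,'a) frac" where
  "loc_mul x y = ((\<lambda>q. fst x q * fst y q), (\<lambda>q. snd x q * snd y q))"

definition loc_neg :: "('v,'a::comm_ring_1) frac \<Rightarrow> ('v,'a) frac" where
  "loc_neg x = ((\<lambda>q. - fst x q), snd x)"

definition loc_zero :: "('v,'a::comm_ring_1) frac" where
  "loc_zero = ((\<lambda>_. 0), (\<lambda>_. 1))"

definition loc_one :: "('v,'a::comm_ring_1) frac" where
  "loc_one = ((\<lambda>_. 1), (\<lambda>_. 1))"

definition loc_pow :: "('v,'a::comm_ring_1) frac \<Rightarrow> nat \<Rightarrow> ('v,'a) frac" where
  "loc_pow x d = ((\<lambda>q. fst x q ^ d), (\<lambda>q. snd x q ^ d))"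

definition loc_sum :: "('v,'a::comm_ring_1) frac list \<Rightarrow> ('v,'a) frac" where
  "loc_sum xs = foldr loc_add xs loc_zero"

definition loc_in_ideal :: "(('v \<Rightarrow> 'a::comm_ring_1) \<Rightarrow> 'a) set \<Rightarrow> ('v \<Rightarrow> 'a) set \<Rightarrow> ('v \<Rightarrow> 'a)
    \<Rightarrow> ('v,'a) frac list \<Rightarrow> ('v,'a) frac \<Rightarrow> bool" where
  "loc_in_ideal Pf Z z xs y \<longleftrightarrow> (\<exists>cs. length cs = length xs \<and> set cs \<subseteq> loc_carrier Pf z \<and>
      loc_eq Pf Z z y (loc_sum (map2 loc_mul cs xs)))"

definition loc_is_domain :: "(('v \<Rightarrow> 'a::comm_ring_1) \<Rightarrow> 'a) set \<Rightarrow> ('v \<Rightarrow> 'a) set \<Rightarrow> ('v \<Rightarrow> 'a) \<Rightarrow> bool" where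
  "loc_is_domain Pf Z z \<longleftrightarrow> \<not> loc_eq Pf Z z loc_one loc_zero \<and>
     (\<forall>x\<in>loc_carrier Pf z. \<forall>y\<in>loc_carrier Pf z.
        loc_eq Pf Z z (loc_mul x y) loc_zero \<longrightarrow> loc_eq Pf Z z x loc_zero \<or> loc_eq Pf Z z y loc_zero)"

text \<open>Integrally closed in its fraction field: if a/b (a,b in the ring, b \<noteq> 0) satisfies a monic
  equation (a/b)^d + sum_(i<d) c_i (a/b)^i = 0 with c_i in the ring (cleared of denominators:
  a^d + sum c_i a^i b^(d-i) = 0), then a/b lies in the ring, i.e. a = q b for some q.\<close>
definition loc_integrally_closed :: "(('v \<Rightarrow> 'a::comm_ring_1) \<Rightarrow> 'a) set \<Rightarrow> ('v \<Rightarrow> 'a) set \<Rightarrow> ('v \<Rightarrow> 'a) \<Rightarrow> bool" where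
  "loc_integrally_closed Pf Z z \<longleftrightarrow>
    (\<forall>a\<in>loc_carrier Pf z. \<forall>b\<in>loc_carrier Pf z. \<not> loc_eq Pf Z z b loc_zero \<longrightarrow>
       (\<exists>d>0. \<exists>cs. length cs = d \<and> set cs \<subseteq> loc_carrier Pf z \<and>
          loc_eq Pf Z z (loc_add (loc_pow a d)
             (loc_sum (map (\<lambda>i. loc_mul (cs ! i) (loc_mul (loc_pow a i) (loc_pow b (d - i)))) [0..<d])))
             loc_zero)
       \<longrightarrow> (\<exists>q\<in>loc_carrier Pf z. loc_eq Pf Z z a (loc_mul q b)))"

definition normal_variety :: "(('v \<Rightarrow> 'a::comm_ring_1) \<Rightarrow> 'a) set \<Rightarrow> ('v \<Rightarrow> 'a) set \<Rightarrow> bool" where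
  "normal_variety Pf Z \<longleftrightarrow> (\<forall>z\<in>Z. loc_is_domain Pf Z z \<and> loc_integrally_closed Pf Z z)"

definition loc_max_ideal :: "(('v \<Rightarrow> 'a::comm_ring_1) \<Rightarrow> 'a) set \<Rightarrow> ('v \<Rightarrow> 'a) \<Rightarrow> ('v,'a) frac set" where
  "loc_max_ideal Pf z = {x \<in> loc_carrier Pf z. fst x z = 0}"

definition loc_regular_seq :: "(('v \<Rightarrow> 'a::comm_ring_1) \<Rightarrow> 'a) set \<Rightarrow> ('v \<Rightarrow> 'a) set \<Rightarrow> ('v \<Rightarrow> 'a)
    \<Rightarrow> ('v,'a) frac list \<Rightarrow> bool" where
  "loc_regular_seq Pf Z z xs \<longleftrightarrow> set xs \<subseteq> loc_max_ideal Pf z \<and>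
     \<not> loc_in_ideal Pf Z z xs loc_one \<and>
     (\<forall>i<length xs. \<forall>y\<in>loc_carrier Pf z.
        loc_in_ideal Pf Z z (take i xs) (loc_mul (xs ! i) y) \<longrightarrow> loc_in_ideal Pf Z z (take i xs) y)"

definition loc_depth :: "(('v \<Rightarrow> 'a::comm_ring_1) \<Rightarrow> 'a) set \<Rightarrow> ('v \<Rightarrow> 'a) set \<Rightarrow> ('v \<Rightarrow> 'a) \<Rightarrow> enat" where
  "loc_depth Pf Z z = Sup {enat (length xs) | xs. loc_regular_seq Pf Z z xs}"

definition loc_prime_ideal :: "(('v \<Rightarrow> 'a::comm_ring_1) \<Rightarrow> 'a) set \<Rightarrow> ('v \<Rightarrow> 'a) set \<Rightarrow> ('v \<Rightarrow> 'a)
    \<Rightarrow> ('v,'a) frac set \<Rightarrow> bool" where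
  "loc_prime_ideal Pf Z z Q \<longleftrightarrow> Q \<subseteq> loc_carrier Pf z \<and>
     (\<forall>x\<in>Q. \<forall>y\<in>loc_carrier Pf z. loc_eq Pf Z z x y \<longrightarrow> y \<in> Q) \<and>
     loc_zero \<in> Q \<and>
     (\<forall>x\<in>Q. \<forall>y\<in>Q. loc_add x y \<in> Q) \<and> (\<forall>x\<in>Q. loc_neg x \<in> Q) \<and>
     (\<forall>x\<in>Q. \<forall>y\<in>loc_carrier Pf z. loc_mul y x \<in> Q) \<and>
     loc_one \<notin> Q \<and>
     (\<forall>x\<in>loc_carrier Pf z. \<forall>y\<in>loc_carrier Pf z. loc_mul x y \<in> Q \<longrightarrow> x \<in> Q \<or> y \<in> Q)"

definition loc_dim :: "(('v \<Rightarrow> 'a::comm_ring_1) \<Rightarrow> 'a) set \<Rightarrow> ('v \<Rightarrow> 'a) set \<Rightarrow> ('v \<Rightarrow> 'a) \<Rightarrow> enat" where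
  "loc_dim Pf Z z = Sup {enat (length qs - 1) | qs. qs \<noteq> [] \<and>
      (\<forall>Q\<in>set qs. loc_prime_ideal Pf Z z Q) \<and>
      (\<forall>i. Suc i < length qs \<longrightarrow> qs ! i \<subset> qs ! Suc i)}"

definition CM_variety :: "(('v \<Rightarrow> 'a::comm_ring_1) \<Rightarrow> 'a) set \<Rightarrow> ('v \<Rightarrow> 'a) set \<Rightarrow> bool" where
  "CM_variety Pf Z \<longleftrightarrow> (\<forall>z\<in>Z. loc_depth Pf Z z = loc_dim Pf Z z)"

end

theory Submission
  imports Defs "HOL-Library.Function_Algebras"
begin

text \<open>Everything happens at the point \<open>z = diag(1, \<dots>, 1, t, 0, \<dots>, 0)\<close> with \<open>r - 2\<close> ones. Two families of
  matrices pass through it: those of generic rank \<open>r - 1\<close>, and those all of whose \<open>(r - 1)\<close>-minors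
  vanish at \<open>t = 0\<close>. If some \<open>(r - 1)\<close>-minor is a unit, then Schur complements show that
  \<open>t^(2k)\<close> divides every \<open>(r + 1)\<close>-minor; hence the constant coefficient of a leading \<open>(r - 1)\<close>-minor
  times the coefficient of \<open>t^(2k-1)\<close> of a leading \<open>(r + 1)\<close>-minor vanishes on the variety, although
  neither factor is zero in the local ring at \<open>z\<close>. So this ring is not a domain.

  With \<open>p = m - r + 1\<close> and \<open>q = n - r + 1\<close>, the second family has codimension
  \<open>(p + 1)(q + 1) + pq(k - 2)\<close> and the first one \<open>pqk\<close>. These differ unless \<open>(p - 1)(q - 1) = 2\<close>, and
  two components of different dimension through a point contradict Cohen--Macaulayness. The dimension
  of the local ring is bounded from below by a chain of coordinate subspaces in a parametrisation of the larger
  family. The depth is bounded from above by the number of coordinates on which the smaller family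
  depends rationally: if \<open>a\<^sub>1, \<dots>, a\<^sub>d\<close> is a regular sequence and \<open>f\<close> a nonzero element that vanishes
  off the smaller family, the products of \<open>f\<close> with the monomials in the \<open>a\<^sub>i\<close> are linearly independent.\<close>

text \<open>The two codimensions differ by
  \<open>pqk - ((p+1)(q+1) + pq(k-2)) = (p-1)(q-1) - 2\<close>. This is -1 for
  \<open>p = q = 2\<close>, zero for \<open>(p,q) = (2,3)\<close> and positive otherwise, so the
  families swap roles when \<open>m = n = r + 1\<close>. That case is the harder one: the element
  bounding the depth must live on the second family, and a nonzero coefficient of
  \<open>t^(2k-1)\<close> in the leading \<open>(r+1)\<close>-minor controls
  \<open>(r-1)\<close>-minors only inside the leading block of size \<open>r + 1\<close>, which is
  then the whole matrix. The exponent \<open>2k - 1\<close> is that of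
  \<open>t * t^(k-1) * t^(k-1)\<close>: near \<open>z\<close> the second family contains diagonal
  matrices which continue the entries \<open>1, ..., 1, t\<close> with two entries
  \<open>s * t^(k-1)\<close>. Only one-sided bounds enter, an upper bound for the depth and a lower
  bound for the dimension, so the variety is never decomposed into components.\<close>

section \<open>Rings of functions and the Hilbert basis theorem\<close>

definition is_subring :: "'b::comm_ring_1 set \<Rightarrow> bool" where
  "is_subring A \<longleftrightarrow> 0 \<in> A \<and> 1 \<in> A \<and> (\<forall>x\<in>A. \<forall>y\<in>A. x + y \<in> A \<and> x * y \<in> A) \<and> (\<forall>x\<in>A. - x \<in> A)"

definition ideal_in :: "'b::comm_ring_1 set \<Rightarrow> 'b set \<Rightarrow> bool" where
  "ideal_in A I \<longleftrightarrow> I \<subseteq> A \<and> 0 \<in> I \<and> (\<forall>x\<in>I. \<forall>y\<in>I. x + y \<in> I) \<and> (\<forall>a\<in>A. \<forall>x\<in>I. a * x \<in> I)"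

text \<open>Rings are carrier sets because polynomial functions form a subset of a function type.
  The ascending chain condition is the form of the Noetherian property that the later intersection
  argument consumes.\<close>

definition noetherian_subring :: "'b::comm_ring_1 set \<Rightarrow> bool" where
  "noetherian_subring A \<longleftrightarrow> is_subring A \<and>
     (\<forall>I. (\<forall>j. ideal_in A (I j)) \<and> (\<forall>j. I j \<subseteq> I (Suc j)) \<longrightarrow> (\<exists>N. \<forall>j\<ge>N. I j = I N))"

text \<open>The element \<open>x\<close> is a function, not a formal variable, and may satisfy
  relations over \<open>A\<close>; representations are not unique and no degree is
  available.\<close>

definition adjoin :: "'b::comm_ring_1 set \<Rightarrow> 'b \<Rightarrow> 'b set" where
  "adjoin A x = {\<Sum>i<n. b i * x ^ i | b n. \<forall>i. b i \<in> A}"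

lemma is_subringD:
  assumes "is_subring A"
  shows "0 \<in> A" "1 \<in> A" "x \<in> A \<Longrightarrow> y \<in> A \<Longrightarrow> x + y \<in> A" "x \<in> A \<Longrightarrow> y \<in> A \<Longrightarrow> x * y \<in> A"
    "x \<in> A \<Longrightarrow> - x \<in> A" "x \<in> A \<Longrightarrow> y \<in> A \<Longrightarrow> x - y \<in> A" "x \<in> A \<Longrightarrow> x ^ n \<in> A"
proof -
  show *: "0 \<in> A" "1 \<in> A" "x \<in> A \<Longrightarrow> y \<in> A \<Longrightarrow> x + y \<in> A" "x \<in> A \<Longrightarrow> y \<in> A \<Longrightarrow> x * y \<in> A"
    "x \<in> A \<Longrightarrow> - x \<in> A" for x y
    using assms by (auto simp: is_subring_def)
  show "x \<in> A \<Longrightarrow> y \<in> A \<Longrightarrow> x - y \<in> A"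
    using *(3)[of x "- y"] *(5)[of y] by simp
  show "x \<in> A \<Longrightarrow> x ^ n \<in> A"
    by (induction n) (auto intro: *)
qed

lemma is_subring_sum:
  assumes "is_subring A" "\<And>i. i \<in> S \<Longrightarrow> f i \<in> A"
  shows "sum f S \<in> A"
  using assms(2) by (induction S rule: infinite_finite_induct) (auto intro: is_subringD[OF assms(1)])

lemma ideal_inD:
  assumes "ideal_in A I"
  shows "x \<in> I \<Longrightarrow> x \<in> A" "0 \<in> I" "x \<in> I \<Longrightarrow> y \<in> I \<Longrightarrow> x + y \<in> I" "a \<in> A \<Longrightarrow> x \<in> I \<Longrightarrow> a * x \<in> I"
  using assms by (auto simp: ideal_in_def)

lemma ideal_in_diff:
  assumes "is_subring A" "ideal_in A I" "x \<in> I" "y \<in> I"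
  shows "x - y \<in> I"
proof -
  have "(- 1) * y \<in> I" using assms by (intro ideal_inD(4)[OF assms(2)]) (auto intro: is_subringD)
  then show ?thesis using ideal_inD(3)[OF assms(2,3), of "- y"] by simp
qed

lemma ideal_in_sum:
  assumes "ideal_in A I" "\<And>i. i \<in> S \<Longrightarrow> f i \<in> I"
  shows "sum f S \<in> I"
  using assms(2) by (induction S rule: infinite_finite_induct) (auto intro: ideal_inD[OF assms(1)])

lemma chain_mono:
  assumes "\<And>j. (I j :: 'c set) \<subseteq> I (Suc j)" "i \<le> j"
  shows "I i \<subseteq> I j"
  using lift_Suc_mono_le[of I, OF assms(1) assms(2)] by blast

text \<open>The diagonal stabilises at some \<open>N\<close>. For \<open>a \<ge> N\<close> and large
  \<open>b\<close> the set \<open>f a b\<close> is squeezed between \<open>f N N\<close> and a later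
  diagonal set; only the finitely many rows below \<open>N\<close> need indices of their
  own.\<close>

lemma double_chain_stable:
  fixes f :: "nat \<Rightarrow> nat \<Rightarrow> 'c set"
  assumes n: "\<And>n j. f n j \<subseteq> f (Suc n) j" and j: "\<And>n j. f n j \<subseteq> f n (Suc j)"
    and acc: "\<And>g. (\<And>i. g i \<in> range (case_prod f)) \<Longrightarrow> (\<And>i. g i \<subseteq> g (Suc i)) \<Longrightarrow> \<exists>N. \<forall>i\<ge>N. g i = g N"
  shows "\<exists>J. \<forall>i\<ge>J. \<forall>n. f n i = f n J"
proof -
  have mono: "f a b \<subseteq> f a' b'" if "a \<le> a'" "b \<le> b'" for a a' b b'
    using chain_mono[of "\<lambda>a. f a b", OF n that(1)] chain_mono[of "f a'", OF j that(2)] by blast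
  have "\<exists>N. \<forall>i\<ge>N. f i i = f N N"
    using mono by (intro acc[of "\<lambda>i. f i i"]) auto
  then obtain N where N: "\<And>i. i \<ge> N \<Longrightarrow> f i i = f N N" by blast
  have "\<exists>M. \<forall>i\<ge>M. f a i = f a M" for a
    by (rule acc[of "f a"]) (use j in auto)
  then obtain M where M: "\<And>a i. i \<ge> M a \<Longrightarrow> f a i = f a (M a)" by metis
  define J where "J = Max (insert N (M ` {..<N}))"
  have JN: "N \<le> J" and JM: "a < N \<Longrightarrow> M a \<le> J" for a by (auto simp: J_def)
  have "f a i = f a J" if "i \<ge> J" for a i
  proof (cases "a < N")
    case True
    then show ?thesis using M[of a i] M[of a J] JM[of a] that by auto
  next
    case False
    have *: "f a b = f N N" if "b \<ge> J" for b
    proof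
      show "f N N \<subseteq> f a b" using mono[of N a N b] False that JN by auto
      show "f a b \<subseteq> f N N" using mono[of a "max a b" b "max a b"] N[of "max a b"] False by auto
    qed
    show ?thesis using *[of i] *[of J] that by simp
  qed
  then show ?thesis by blast
qed

lemma adjoinI: "(\<And>i. b i \<in> A) \<Longrightarrow> (\<Sum>i<n. b i * x ^ i) \<in> adjoin A x"
  by (auto simp: adjoin_def)

lemma adjoin_gen:
  fixes x :: "'b::comm_ring_1"
  assumes "is_subring A"
  shows "a \<in> A \<Longrightarrow> a \<in> adjoin A x" "x \<in> adjoin A x"
proof -
  show "a \<in> adjoin A x" if "a \<in> A"
    using adjoinI[of "\<lambda>_. a" A x 1] that by simp
  show "x \<in> adjoin A x"
    using adjoinI[of "\<lambda>i. if i = 1 then 1 else 0" A x 2] is_subringD[OF assms]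
    by (simp add: numeral_2_eq_2)
qed

text \<open>Hilbert's argument: nested ideals with the same leading coefficients in every degree are
  equal, and the ideals of leading coefficients form a doubly increasing family in
  \<open>A\<close>.\<close>

lemma noetherian_adjoin:
  fixes x :: "'b::comm_ring_1"
  assumes A: "noetherian_subring A" and B: "is_subring (adjoin A x)"
  shows "noetherian_subring (adjoin A x)"
proof -
  let ?B = "adjoin A x"
  have sA: "is_subring A" using A by (simp add: noetherian_subring_def)
  note sAD = is_subringD[OF sA]
  \<comment> \<open>As \<open>x\<close> may satisfy relations, the coefficients of
    \<open>x ^ n\<close> are collected over all representations of length \<open>n + 1\<close> of
    elements of \<open>I\<close>.\<close>
  define L where "L n I = {a\<in>A. \<exists>b. (\<forall>i. b i \<in> A) \<and> a * x ^ n + (\<Sum>i<n. b i * x ^ i) \<in> I}" for n I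
  have LI: "ideal_in A (L n I)" if I: "ideal_in ?B I" for n I
    unfolding ideal_in_def
  proof (intro conjI ballI)
    show "L n I \<subseteq> A" by (auto simp: L_def)
    have "0 * x ^ n + (\<Sum>i<n. 0 * x ^ i) \<in> I" using ideal_inD(2)[OF I] by simp
    then show "0 \<in> L n I" unfolding L_def mem_Collect_eq
      using sAD(1) by (intro conjI exI[of _ "\<lambda>i. 0"]) simp_all
  next
    fix u v assume "u \<in> L n I" "v \<in> L n I"
    then obtain b c where b: "u \<in> A" "\<forall>i. b i \<in> A" "u * x ^ n + (\<Sum>i<n. b i * x ^ i) \<in> I"
      and c: "v \<in> A" "\<forall>i. c i \<in> A" "v * x ^ n + (\<Sum>i<n. c i * x ^ i) \<in> I" by (auto simp: L_def)
    have "(u + v) * x ^ n + (\<Sum>i<n. (b i + c i) * x ^ i) \<in> I"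
      using ideal_inD(3)[OF I b(3) c(3)] by (simp add: algebra_simps sum.distrib)
    then show "u + v \<in> L n I" unfolding L_def mem_Collect_eq
      using b(1,2) c(1,2) sAD(3) by (intro conjI exI[of _ "\<lambda>i. b i + c i"]) simp_all
  next
    fix u a assume "u \<in> L n I" and a: "a \<in> A"
    then obtain b where b: "u \<in> A" "\<forall>i. b i \<in> A" "u * x ^ n + (\<Sum>i<n. b i * x ^ i) \<in> I"
      by (auto simp: L_def)
    have "(a * u) * x ^ n + (\<Sum>i<n. (a * b i) * x ^ i) \<in> I"
      using ideal_inD(4)[OF I adjoin_gen(1)[OF sA a] b(3)] by (simp add: algebra_simps sum_distrib_left)
    then show "a * u \<in> L n I" unfolding L_def mem_Collect_eq
      using b(1,2) a sAD(4) by (intro conjI exI[of _ "\<lambda>i. a * b i"]) simp_all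
  qed
  have Ln: "L n I \<subseteq> L (Suc n) I" if I: "ideal_in ?B I" for n I
  proof
    fix u assume "u \<in> L n I"
    then obtain b where b: "u \<in> A" "\<forall>i. b i \<in> A" "u * x ^ n + (\<Sum>i<n. b i * x ^ i) \<in> I"
      by (auto simp: L_def)
    define c where "c i = (if i = 0 then 0 else b (i - 1))" for i
    have "u * x ^ Suc n + (\<Sum>i<Suc n. c i * x ^ i) \<in> I"
      using ideal_inD(4)[OF I adjoin_gen(2)[OF sA] b(3)]
      unfolding sum.lessThan_Suc_shift by (simp add: c_def algebra_simps sum_distrib_left)
    then show "u \<in> L (Suc n) I" unfolding L_def mem_Collect_eq
      using b(1,2) sAD(1) by (intro conjI exI[of _ c]) (simp_all add: c_def)
  qed
  have Lj: "L n I \<subseteq> L n I'" if "I \<subseteq> I'" for n I I' using that by (auto simp: L_def)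
  have eq: "I' \<subseteq> I" if I: "ideal_in ?B I" "ideal_in ?B I'" "I \<subseteq> I'" "\<And>n. L n I' = L n I" for I I'
  proof -
    \<comment> \<open>Induction on the length: some element of the smaller ideal has the same top
      coefficient, and subtracting it shortens the representation.\<close>
    have "(\<Sum>i<n. b i * x ^ i) \<in> I' \<Longrightarrow> (\<Sum>i<n. b i * x ^ i) \<in> I" if "\<forall>i. b i \<in> A" for n b
      using that
    proof (induction n arbitrary: b)
      case 0
      then show ?case using ideal_inD(2)[OF I(1)] by simp
    next
      case (Suc n)
      have "b n \<in> L n I'" unfolding L_def mem_Collect_eq
        using Suc.prems by (intro conjI exI[of _ b]) (simp_all add: add.commute)
      then have "b n \<in> L n I" using I(4) by simp
      then obtain c where c: "\<forall>i. c i \<in> A" "b n * x ^ n + (\<Sum>i<n. c i * x ^ i) \<in> I" by (auto simp: L_def)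
      have d: "(\<Sum>i<Suc n. b i * x ^ i) = (\<Sum>i<n. (b i - c i) * x ^ i) + (b n * x ^ n + (\<Sum>i<n. c i * x ^ i))"
        by (simp add: algebra_simps sum_subtractf)
      have "(\<Sum>i<n. (b i - c i) * x ^ i) \<in> I'"
        using ideal_in_diff[OF B I(2) Suc.prems(1), of "b n * x ^ n + (\<Sum>i<n. c i * x ^ i)"] c I(3) d by auto
      then have "(\<Sum>i<n. (b i - c i) * x ^ i) \<in> I" using Suc.IH[of "\<lambda>i. b i - c i"] Suc.prems c sAD by auto
      then show ?case unfolding d using c ideal_inD(3)[OF I(1)] by blast
    qed
    then show ?thesis using ideal_inD(1)[OF I(2)] unfolding adjoin_def by blast
  qed
  show ?thesis unfolding noetherian_subring_def
  proof (intro conjI B allI impI)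
    fix I assume "(\<forall>j. ideal_in ?B (I j)) \<and> (\<forall>j. I j \<subseteq> I (Suc j))"
    then have I: "\<And>j. ideal_in ?B (I j)" "\<And>j. I j \<subseteq> I (Suc j)" by auto
    have "\<exists>J. \<forall>i\<ge>J. \<forall>n. L n (I i) = L n (I J)"
    proof (rule double_chain_stable)
      fix g assume g: "\<And>i. g i \<in> range (\<lambda>(n, j). L n (I j))" "\<And>i. g i \<subseteq> g (Suc i)"
      have "ideal_in A (g i)" for i using g(1)[of i] LI I by auto
      then show "\<exists>N. \<forall>i\<ge>N. g i = g N" using A g(2) unfolding noetherian_subring_def by blast
    qed (use Ln I Lj in auto)
    then obtain J where J: "\<And>i n. i \<ge> J \<Longrightarrow> L n (I i) = L n (I J)" by blast
    have "I i = I J" if "i \<ge> J" for i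
      using eq[OF I(1)[of J] I(1)[of i]] J[OF that] chain_mono[of I, OF I(2) that] chain_mono[of I, OF I(2) that] by blast
    then show "\<exists>N. \<forall>j\<ge>N. I j = I N" by blast
  qed
qed

lemma is_subring_polyfun: "is_subring (polyfun X :: (('a \<Rightarrow> 'b::comm_ring_1) \<Rightarrow> 'b) set)"
  unfolding is_subring_def
proof (intro conjI ballI)
  show "0 \<in> polyfun X" "1 \<in> polyfun X"
    using polyfun.const[of 0 X] polyfun.const[of 1 X] by (simp_all add: zero_fun_def one_fun_def)
  fix f g :: "('a \<Rightarrow> 'b) \<Rightarrow> 'b" assume f: "f \<in> polyfun X"
  show "- f \<in> polyfun X"
    using polyfun.mult[OF polyfun.const[of "- 1"] f] by (simp add: fun_Compl_def)
  assume g: "g \<in> polyfun X"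
  show "f + g \<in> polyfun X" "f * g \<in> polyfun X"
    using polyfun.add[OF f g] polyfun.mult[OF f g] by (simp_all add: plus_fun_def times_fun_def)
qed

lemma polyfun_mono: "f \<in> polyfun X \<Longrightarrow> X \<subseteq> Y \<Longrightarrow> f \<in> polyfun Y"
  by (induction rule: polyfun.induct) (auto intro: polyfun.intros)

lemma polyfun_empty: "f \<in> polyfun {} \<Longrightarrow> \<exists>c. f = (\<lambda>p. c)"
proof -
  have "f \<in> polyfun X \<Longrightarrow> X = {} \<Longrightarrow> \<exists>c. f = (\<lambda>p. c)" for X
    by (induction rule: polyfun.induct) auto
  then show "f \<in> polyfun {} \<Longrightarrow> \<exists>c. f = (\<lambda>p. c)" by blast
qed

lemma is_subring_adjoin:
  fixes x :: "'b::comm_ring_1"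
  assumes A: "is_subring A"
  shows "is_subring (adjoin A x)"
proof -
  note sAD = is_subringD[OF A]
  have ext: "\<exists>c. (\<forall>i. c i \<in> A) \<and> (\<forall>i\<ge>n. c i = 0) \<and> y = (\<Sum>i<N. c i * x ^ i)"
    if "\<forall>i. b i \<in> A" "y = (\<Sum>i<n. b i * x ^ i)" "n \<le> N" for b y n N
  proof (intro exI conjI)
    let ?c = "\<lambda>i. if i < n then b i else 0"
    show "\<forall>i. ?c i \<in> A" using that sAD by auto
    show "\<forall>i\<ge>n. ?c i = 0" by simp
    have "(\<Sum>i<N. ?c i * x ^ i) = (\<Sum>i<n. ?c i * x ^ i)"
      by (rule sum.mono_neutral_right) (use that in auto)
    then show "y = (\<Sum>i<N. ?c i * x ^ i)" using that by simp
  qed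
  have add: "u + v \<in> adjoin A x" if uv: "u \<in> adjoin A x" "v \<in> adjoin A x" for u v
  proof -
    obtain b n c m where b: "\<forall>i. b i \<in> A" "u = (\<Sum>i<n. b i * x ^ i)"
      and c: "\<forall>i. c i \<in> A" "v = (\<Sum>i<m. c i * x ^ i)" using uv unfolding adjoin_def by blast
    obtain b' where b': "\<forall>i. b' i \<in> A" "u = (\<Sum>i<n+m. b' i * x ^ i)" using ext[OF b, of "n+m"] by auto
    obtain c' where c': "\<forall>i. c' i \<in> A" "v = (\<Sum>i<n+m. c' i * x ^ i)" using ext[OF c, of "n+m"] by auto
    have "u + v = (\<Sum>i<n+m. (b' i + c' i) * x ^ i)" by (simp add: b' c' algebra_simps sum.distrib)
    then show ?thesis using adjoinI[of "\<lambda>i. b' i + c' i" A x "n+m"] b' c' sAD by auto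
  qed
  have smult: "a * v \<in> adjoin A x" if av: "a \<in> A" "v \<in> adjoin A x" for a v
  proof -
    obtain c m where c: "\<forall>i. c i \<in> A" "v = (\<Sum>i<m. c i * x ^ i)"
      using av by (auto simp: adjoin_def)
    show ?thesis using adjoinI[of "\<lambda>i. a * c i" A x m] c that sAD by (simp add: sum_distrib_left algebra_simps)
  qed
  have xmult: "x * v \<in> adjoin A x" if av: "v \<in> adjoin A x" for v
  proof -
    obtain c m where c: "\<forall>i. c i \<in> A" "v = (\<Sum>i<m. c i * x ^ i)"
      using av by (auto simp: adjoin_def)
    have "(\<Sum>i<Suc m. (if i = 0 then 0 else c (i - 1)) * x ^ i) \<in> adjoin A x"
      by (rule adjoinI) (use c sAD in auto)
    then show ?thesis unfolding sum.lessThan_Suc_shift using c by (simp add: sum_distrib_left algebra_simps)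
  qed
  have pmult: "x ^ i * v \<in> adjoin A x" if "v \<in> adjoin A x" for v i
    using that by (induction i) (auto simp: mult.assoc intro: xmult)
  have zero: "0 \<in> adjoin A x" using adjoin_gen(1)[OF A] sAD by blast
  have mult: "u * v \<in> adjoin A x" if uv: "u \<in> adjoin A x" "v \<in> adjoin A x" for u v
  proof -
    obtain b n where b: "\<forall>i. b i \<in> A" "u = (\<Sum>i<n. b i * x ^ i)" using uv unfolding adjoin_def by blast
    have "(\<Sum>i<n. b i * (x ^ i * v)) \<in> adjoin A x" for n
      by (induction n) (auto intro!: zero add smult pmult uv b(1)[rule_format])
    moreover have "u * v = (\<Sum>i<n. b i * (x ^ i * v))" by (simp add: b sum_distrib_right mult.assoc)
    ultimately show ?thesis by simp
  qed
  show ?thesis unfolding is_subring_def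
    using zero adjoin_gen(1)[OF A] sAD add mult smult[of "- 1"] by auto
qed

text \<open>Makes the addition of one variable an instance of \<open>adjoin\<close>, so that the
  basis theorem applies by induction on the set of variables.\<close>

lemma polyfun_insert:
  "(polyfun (insert v X) :: (('v \<Rightarrow> 'a::comm_ring_1) \<Rightarrow> 'a) set) = adjoin (polyfun X) (\<lambda>p. p v)"
proof
  let ?A = "polyfun X :: (('v \<Rightarrow> 'a) \<Rightarrow> 'a) set"
  have A: "is_subring ?A" by (rule is_subring_polyfun)
  note B = is_subringD[OF is_subring_adjoin[OF A]]
  show "polyfun (insert v X) \<subseteq> adjoin ?A (\<lambda>p. p v)"
  proof
    fix f :: "('v \<Rightarrow> 'a) \<Rightarrow> 'a" assume "f \<in> polyfun (insert v X)"
    then show "f \<in> adjoin ?A (\<lambda>p. p v)"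
    proof (induction rule: polyfun.induct)
      case (const c) then show ?case using adjoin_gen(1)[OF A polyfun.const] by blast
    next
      case (var w) then show ?case using adjoin_gen[OF A] polyfun.var[of w X] by auto
    next
      case (add f g) then show ?case using B(3)[of f _ g] by (simp add: plus_fun_def)
    next
      case (mult f g) then show ?case using B(4)[of f _ g] by (simp add: times_fun_def)
    qed
  qed
  show "adjoin ?A (\<lambda>p. p v) \<subseteq> polyfun (insert v X)"
  proof
    fix f assume "f \<in> adjoin ?A (\<lambda>p. p v)"
    then obtain b n where b: "\<forall>i. b i \<in> ?A" "f = (\<Sum>i<n. b i * (\<lambda>p. p v) ^ i)" unfolding adjoin_def by blast
    note C = is_subringD[OF is_subring_polyfun[of "insert v X"]]
    show "f \<in> polyfun (insert v X)" unfolding b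
      by (intro is_subring_sum[OF is_subring_polyfun] C(4) C(7))
        (use b polyfun_mono[of _ X "insert v X"] polyfun.var[of v "insert v X"] in auto)
  qed
qed

lemma noetherian_polyfun:
  assumes "finite X"
  shows "noetherian_subring (polyfun X :: (('v \<Rightarrow> 'a::field) \<Rightarrow> 'a) set)"
  using assms
proof (induction X rule: finite_induct)
  case empty
  let ?A = "polyfun {} :: (('v \<Rightarrow> 'a) \<Rightarrow> 'a) set"
  have A: "is_subring ?A" by (rule is_subring_polyfun)
  have triv: "I = {0} \<or> I = ?A" if I: "ideal_in ?A I" for I
  proof (cases "I = {0}")
    case False
    then obtain f where f: "f \<in> I" "f \<noteq> 0" using ideal_inD(2)[OF I] by blast
    then obtain c where c: "f = (\<lambda>p. c)" using polyfun_empty ideal_inD(1)[OF I] by blast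
    then have c0: "c \<noteq> 0" using f by (auto simp: zero_fun_def)
    have "g \<in> I" if "g \<in> ?A" for g
    proof -
      have "(\<lambda>p. inverse c) \<in> ?A" by (rule polyfun.const)
      then have "(\<lambda>p. inverse c) * f \<in> I" using ideal_inD(4)[OF I] f by blast
      then have "g * ((\<lambda>p. inverse c) * f) \<in> I" using ideal_inD(4)[OF I] that by blast
      moreover have "g * ((\<lambda>p. inverse c) * f) = g" using c c0 by (auto simp: fun_eq_iff)
      ultimately show ?thesis by simp
    qed
    then show ?thesis using ideal_inD(1)[OF I] by blast
  qed simp
  show ?case unfolding noetherian_subring_def
  proof (intro conjI A allI impI)
    fix I :: "nat \<Rightarrow> _" assume "(\<forall>j. ideal_in ?A (I j)) \<and> (\<forall>j. I j \<subseteq> I (Suc j))"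
    then have I: "\<And>j. ideal_in ?A (I j)" "\<And>j. I j \<subseteq> I (Suc j)" by auto
    show "\<exists>N. \<forall>j\<ge>N. I j = I N"
    proof (cases "\<exists>N. I N \<noteq> {0}")
      case True
      then obtain N where N: "I N = ?A" "I N \<noteq> {0}" using triv I by blast
      have "I j = I N" if "j \<ge> N" for j
        using triv[OF I(1)[of j]] chain_mono[of I, OF I(2) that] N by (metis ideal_inD(2)[OF I(1)] subset_singletonD empty_iff)
      then show ?thesis by blast
    next
      case False
      then show ?thesis by auto
    qed
  qed
next
  case (insert v X)
  then show ?case unfolding polyfun_insert
    by (intro noetherian_adjoin is_subring_adjoin is_subring_polyfun)
qed

section \<open>Localised Noetherian rings and regular sequences\<close>

fun mon :: "'b::comm_ring_1 list \<Rightarrow> nat list \<Rightarrow> 'b" where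
  "mon [] es = 1"
| "mon (a # as) es = a ^ hd es * mon as (tl es)"

text \<open>\<open>U\<close> plays the complement of a maximal ideal and \<open>K\<close> a
  coefficient field. The condition \<open>diff_U\<close> expresses locality: subtracting a multiple
  of a nonunit from a unit leaves a unit, as Nakayama's argument needs. No fractions are formed;
  ideals of the localisation are represented by subsets of \<open>A\<close>.\<close>

locale localised_noetherian =
  fixes A U K :: "'b::comm_ring_1 set"
  assumes noeth: "noetherian_subring A"
    and U_sub: "U \<subseteq> A" and one_U: "1 \<in> U" and mult_U: "\<And>u v. u \<in> U \<Longrightarrow> v \<in> U \<Longrightarrow> u * v \<in> U"
    and diff_U: "\<And>u a b. u \<in> U \<Longrightarrow> a \<in> A - U \<Longrightarrow> b \<in> A \<Longrightarrow> u - b * a \<in> U"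
    and K_sub: "K \<subseteq> A" and K_units: "K - {0} \<subseteq> U"
begin

lemma subring_A: "is_subring A"
  using noeth by (simp add: noetherian_subring_def)

lemmas A_rules = is_subringD[OF subring_A]

lemma U_A: "u \<in> U \<Longrightarrow> u \<in> A" using U_sub by blast

text \<open>These are the contractions to \<open>A\<close> of ideals of the localisation at
  \<open>U\<close>.\<close>

definition saturated :: "'b set \<Rightarrow> bool" where
  "saturated J \<longleftrightarrow> ideal_in A J \<and> (\<forall>u\<in>U. \<forall>y\<in>A. u * y \<in> J \<longrightarrow> y \<in> J)"

text \<open>The contraction to \<open>A\<close> of the ideal generated by \<open>J\<close> and \<open>a\<close> in the localisation.\<close>
definition sat_insert :: "'b \<Rightarrow> 'b set \<Rightarrow> 'b set" where
  "sat_insert a J = {y\<in>A. \<exists>u\<in>U. \<exists>j\<in>J. \<exists>b\<in>A. u * y = j + b * a}"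

lemma saturatedD:
  assumes "saturated J"
  shows "ideal_in A J" "u \<in> U \<Longrightarrow> y \<in> A \<Longrightarrow> u * y \<in> J \<Longrightarrow> y \<in> J"
  using assms by (auto simp: saturated_def)

lemma sat_insertI: "y \<in> A \<Longrightarrow> u \<in> U \<Longrightarrow> j \<in> J \<Longrightarrow> b \<in> A \<Longrightarrow> u * y = j + b * a \<Longrightarrow> y \<in> sat_insert a J"
  by (auto simp: sat_insert_def)

lemma sat_insertE:
  assumes "y \<in> sat_insert a J"
  obtains u j b where "y \<in> A" "u \<in> U" "j \<in> J" "b \<in> A" "u * y = j + b * a"
  using assms by (auto simp: sat_insert_def)

lemma saturated_sat_insert:
  assumes J: "ideal_in A J" and a: "a \<in> A"
  shows "saturated (sat_insert a J)"
  unfolding saturated_def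
proof
  note JD = ideal_inD[OF J]
  show "ideal_in A (sat_insert a J)" unfolding ideal_in_def
  proof (intro conjI ballI)
    show "sat_insert a J \<subseteq> A" by (auto simp: sat_insert_def)
    show "0 \<in> sat_insert a J" by (rule sat_insertI[of _ 1 0 _ 0]) (use JD one_U A_rules in auto)
  next
    fix x y assume "x \<in> sat_insert a J" "y \<in> sat_insert a J"
    then obtain u j b v i c where h: "x \<in> A" "u \<in> U" "j \<in> J" "b \<in> A" "u * x = j + b * a"
      "y \<in> A" "v \<in> U" "i \<in> J" "c \<in> A" "v * y = i + c * a" by (auto elim!: sat_insertE)
    show "x + y \<in> sat_insert a J"
    proof (rule sat_insertI)
      show "x + y \<in> A" "u * v \<in> U" "v * j + u * i \<in> J" "v * b + u * c \<in> A"
        using h h(2,7)[THEN U_A] by (auto intro!: A_rules(3,4) JD(3,4) mult_U)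
      have "u * v * (x + y) = v * (u * x) + u * (v * y)" by (simp add: algebra_simps)
      then show "u * v * (x + y) = v * j + u * i + (v * b + u * c) * a"
        unfolding h(5) h(10) by (simp add: algebra_simps)
    qed
  next
    fix r x assume r: "r \<in> A" and "x \<in> sat_insert a J"
    then obtain u j b where h: "x \<in> A" "u \<in> U" "j \<in> J" "b \<in> A" "u * x = j + b * a"
      by (auto elim!: sat_insertE)
    show "r * x \<in> sat_insert a J"
    proof (rule sat_insertI)
      show "r * x \<in> A" "u \<in> U" "r * j \<in> J" "r * b \<in> A" using h r by (auto intro!: A_rules(4) JD(4))
      have "u * (r * x) = r * (u * x)" by (simp add: algebra_simps)
      then show "u * (r * x) = r * j + r * b * a" unfolding h(5) by (simp add: algebra_simps)
    qed
  qed
  show "\<forall>u\<in>U. \<forall>y\<in>A. u * y \<in> sat_insert a J \<longrightarrow> y \<in> sat_insert a J"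
  proof (intro ballI impI)
    fix u y assume u: "u \<in> U" and y: "y \<in> A" and "u * y \<in> sat_insert a J"
    then obtain v j b where h: "v \<in> U" "j \<in> J" "b \<in> A" "v * (u * y) = j + b * a"
      by (auto elim!: sat_insertE)
    show "y \<in> sat_insert a J"
      by (rule sat_insertI[OF y mult_U[OF h(1) u] h(2,3)]) (use h(4) in \<open>simp add: mult.assoc\<close>)
  qed
qed

lemma sat_insert_superset:
  assumes J: "ideal_in A J" "x \<in> J"
  shows "x \<in> sat_insert a J"
  by (rule sat_insertI[of _ 1 x _ 0]) (use one_U A_rules(1) ideal_inD(1)[OF J] J in auto)

lemma sat_insert_multiple:
  assumes J: "ideal_in A J" "a \<in> A" "b \<in> A"
  shows "b * a \<in> sat_insert a J"
  by (rule sat_insertI[of _ 1 0 _ b]) (use one_U A_rules ideal_inD(2)[OF J(1)] J in auto)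

text \<open>A form of the Krull intersection theorem modulo \<open>J\<close>: a nonzero element is
  not infinitely divisible by a nonunit \<open>a\<close>, so dividing by \<open>a\<close> stops at a
  quotient outside the ideal generated by \<open>J\<close> and \<open>a\<close>.\<close>

lemma divide_out_power:
  assumes J: "saturated J" and a: "a \<in> A - U" and f: "f \<in> A" "f \<notin> J"
  shows "\<exists>s u f'. u \<in> U \<and> f' \<in> A \<and> u * f - a ^ s * f' \<in> J \<and> f' \<notin> sat_insert a J"
proof (rule ccontr)
  assume "\<not> ?thesis"
  then have neg: "f' \<in> sat_insert a J" if "u \<in> U" "f' \<in> A" "u * f - a ^ s * f' \<in> J" for s u f'
    using that by blast
  have JI: "ideal_in A J" using saturatedD[OF J] by blast
  note JD = ideal_inD[OF JI]
  have aA: "a \<in> A" using a by blast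
  let ?P = "\<lambda>s g. g \<in> A \<and> (\<exists>u\<in>U. u * f - a ^ s * g \<in> J)"
  let ?Q = "\<lambda>g h. \<exists>u\<in>U. u * g - a * h \<in> J"
  \<comment> \<open>If division never stops, dependent choice gives \<open>f = a ^ n * F n\<close>
    and \<open>F n = a * F (Suc n)\<close>, up to units and modulo \<open>J\<close>.\<close>
  have "\<exists>F. \<forall>n. ?P n (F n) \<and> ?Q (F n) (F (Suc n))"
  proof (rule dependent_nat_choice)
    show "\<exists>x. ?P 0 x" using f one_U JD(2) by (auto intro!: exI[of _ f] bexI[of _ 1])
  next
    fix g n assume "?P n g"
    then obtain u where u: "g \<in> A" "u \<in> U" "u * f - a ^ n * g \<in> J" by blast
    from neg[OF u(2,1,3)] obtain v j b where h: "v \<in> U" "j \<in> J" "b \<in> A" "v * g = j + b * a"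
      by (auto elim!: sat_insertE)
    have "v * g - a * b = j" using h(4) by (simp add: algebra_simps)
    moreover have "(v * u) * f - a ^ Suc n * b \<in> J"
    proof -
      have "(v * u) * f - a ^ Suc n * b = v * (u * f - a ^ n * g) + a ^ n * (v * g - a * b)"
        by (simp add: algebra_simps)
      also have "\<dots> \<in> J" using \<open>v * g - a * b = j\<close> h u aA U_A[OF h(1)] by (auto intro!: JD(3) JD(4) A_rules)
      finally show ?thesis .
    qed
    ultimately show "\<exists>y. ?P (Suc n) y \<and> ?Q g y" using h u mult_U by blast
  qed
  then obtain F where F: "\<And>n. F n \<in> A" "\<And>n. \<exists>u\<in>U. u * f - a ^ n * F n \<in> J" "\<And>n. ?Q (F n) (F (Suc n))"
    by blast
  have FJ: "F n \<notin> J" for n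
  proof
    assume *: "F n \<in> J"
    obtain u where u: "u \<in> U" "u * f - a ^ n * F n \<in> J" using F(2) by blast
    have "(u * f - a ^ n * F n) + a ^ n * F n \<in> J" using u * aA by (intro JD(3) JD(4)) (auto intro: A_rules)
    then show False using saturatedD(2)[OF J u(1) f(1)] f by simp
  qed
  \<comment> \<open>Up to a unit, \<open>F j\<close> is a multiple of \<open>F (Suc j)\<close>
    modulo \<open>J\<close>, so these ideals ascend.\<close>
  have "\<exists>N. \<forall>j\<ge>N. sat_insert (F j) J = sat_insert (F N) J"
  proof -
    have "sat_insert (F j) J \<subseteq> sat_insert (F (Suc j)) J" for j
    proof
      fix x assume "x \<in> sat_insert (F j) J"
      then obtain u i b where h: "x \<in> A" "u \<in> U" "i \<in> J" "b \<in> A" "u * x = i + b * F j" by (auto elim!: sat_insertE)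
      obtain v where v: "v \<in> U" "v * F j - a * F (Suc j) \<in> J" using F(3) by blast
      show "x \<in> sat_insert (F (Suc j)) J"
      proof (rule sat_insertI)
        show "x \<in> A" "v * u \<in> U" "v * i + b * (v * F j - a * F (Suc j)) \<in> J" "b * a \<in> A"
          using h v aA U_A[OF v(1)] by (auto intro!: mult_U JD(3,4) A_rules(4))
        have "v * u * x = v * (u * x)" by (simp add: algebra_simps)
        then show "v * u * x = v * i + b * (v * F j - a * F (Suc j)) + b * a * F (Suc j)"
          unfolding h(5) by (simp add: algebra_simps)
      qed
    qed
    then show ?thesis
      using noeth saturatedD(1)[OF saturated_sat_insert[OF JI F(1)]] unfolding noetherian_subring_def
      by (elim conjE allE[of _ "\<lambda>j. sat_insert (F j) J"]) blast
  qed
  then obtain N where "sat_insert (F (Suc N)) J = sat_insert (F N) J" using le_SucI by blast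
  moreover have "1 * F (Suc N) \<in> sat_insert (F (Suc N)) J" by (rule sat_insert_multiple[OF JI F(1)]) (rule A_rules)
  ultimately obtain v i b where h: "v \<in> U" "i \<in> J" "b \<in> A" "v * F (Suc N) = i + b * F N"
    by (auto elim!: sat_insertE)
  obtain u where u: "u \<in> U" "u * F N - a * F (Suc N) \<in> J" using F(3) by blast
  \<comment> \<open>Stability makes \<open>F (Suc N)\<close> a multiple of \<open>F N\<close>, hence
    of \<open>a * F (Suc N)\<close>. The factor \<open>u * v - b * a\<close> is a unit and sends
    \<open>F (Suc N)\<close> into \<open>J\<close>.\<close>
  have "(u * v - b * a) * F (Suc N) = u * (v * F (Suc N)) - b * a * F (Suc N)" by (simp add: algebra_simps)
  also have "\<dots> = u * i + b * (u * F N - a * F (Suc N))" unfolding h(4) by (simp add: algebra_simps)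
  also have "\<dots> \<in> J" using h u by (auto intro!: JD(3,4) U_A)
  finally have "F (Suc N) \<in> J"
    using saturatedD(2)[OF J diff_U[OF mult_U[OF u(1) h(1)] a h(3)] F(1)] by blast
  with FJ show False by blast
qed

fun regular_seq :: "'b set \<Rightarrow> 'b list \<Rightarrow> bool" where
  "regular_seq J [] \<longleftrightarrow> True"
| "regular_seq J (a # as) \<longleftrightarrow> (\<forall>y\<in>A. a * y \<in> J \<longrightarrow> y \<in> J) \<and> regular_seq (sat_insert a J) as"

lemma regular_power:
  assumes "\<forall>y\<in>A. a * y \<in> J \<longrightarrow> y \<in> J" "a \<in> A" "y \<in> A" "a ^ n * y \<in> J"
  shows "y \<in> J"
  using assms(3,4)
proof (induction n)
  case (Suc n)
  have "a ^ n * y \<in> J" using assms(1)[rule_format, of "a ^ n * y"] Suc.prems assms(2)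
    by (auto intro: A_rules simp: mult.assoc)
  then show ?case using Suc by blast
qed simp

lemma mon_A: "set as \<subseteq> A \<Longrightarrow> mon as es \<in> A"
  by (induction as arbitrary: es) (auto intro: A_rules)

text \<open>The lowest power of the first element \<open>a\<close> cancels because \<open>a\<close>
  is regular, and reduction modulo \<open>a\<close> kills all higher powers, leaving a relation for
  the remaining sequence. The multiplier \<open>f\<close> could die in this reduction, so it is
  traded for a quotient \<open>f'\<close> that survives; the induction therefore runs over all
  multipliers outside \<open>J\<close>.\<close>

lemma regular_seq_independent:
  assumes "saturated J" "regular_seq J as" "set as \<subseteq> A - U" "f \<in> A" "f \<notin> J" "finite E"
    and "\<And>es. es \<in> E \<Longrightarrow> length es = length as \<and> c es \<in> K" "(\<Sum>es\<in>E. c es * mon as es * f) \<in> J"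
  shows "\<forall>es\<in>E. c es = 0"
  using assms
proof (induction as arbitrary: J f E c)
  case Nil
  show ?case
  proof
    fix es assume es: "es \<in> E"
    then have "E = {es}" using Nil.prems(7) by auto
    then have "c es * f \<in> J" using Nil.prems(8) by simp
    then show "c es = 0" using saturatedD(2)[OF Nil.prems(1), of "c es" f] Nil.prems(4,5) Nil.prems(7)[OF es] K_units
      by blast
  qed
next
  case (Cons a as)
  have JI: "ideal_in A J" using saturatedD[OF Cons.prems(1)] by blast
  note JD = ideal_inD[OF JI]
  have aA: "a \<in> A" and aU: "a \<in> A - U" and as: "set as \<subseteq> A - U" "set as \<subseteq> A" using Cons.prems(3) by auto
  have reg: "\<forall>y\<in>A. a * y \<in> J \<longrightarrow> y \<in> J" using Cons.prems(2) by simp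
  have cA: "c es \<in> A" if "es \<in> E" for es using Cons.prems(7)[OF that] K_sub by blast
  \<comment> \<open>Zero coefficients are dropped so that the minimal exponent is attained by a
    genuine term.\<close>
  define E' where "E' = {es\<in>E. c es \<noteq> 0}"
  have fE': "finite E'" using Cons.prems(6) by (simp add: E'_def)
  show ?case
  proof (rule ccontr)
    assume "\<not> ?case"
    then have ne: "E' \<noteq> {}" by (auto simp: E'_def)
    define e0 where "e0 = Min (hd ` E')"
    have e0: "e0 \<le> hd es" if "es \<in> E'" for es using that fE' by (simp add: e0_def)
    have "e0 \<in> hd ` E'" unfolding e0_def using fE' ne by (intro Min_in) auto
    \<comment> \<open>The relation divided by \<open>a ^ e0\<close>, with \<open>g\<close> in place
      of the multiplier \<open>f\<close>.\<close>
    define S where "S g = (\<Sum>es\<in>E'. c es * (a ^ (hd es - e0) * mon as (tl es)) * g)" for g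
    have SA: "S g \<in> A" if "g \<in> A" for g unfolding S_def
      using that aA cA by (intro is_subring_sum[OF subring_A] A_rules mon_A as) (auto simp: E'_def)
    have S_lin: "S (r * g - s * h) = r * S g - s * S h" for r g s h
      by (simp add: S_def sum_distrib_left sum_subtractf[symmetric] algebra_simps)
    have Smult: "S g = (\<Sum>es\<in>E'. c es * (a ^ (hd es - e0) * mon as (tl es))) * g" for g
      by (simp add: S_def sum_distrib_right)
    have S1: "(\<Sum>es\<in>E'. c es * (a ^ (hd es - e0) * mon as (tl es))) \<in> A"
      using aA cA by (intro is_subring_sum[OF subring_A] A_rules mon_A as) (auto simp: E'_def)
    have "(\<Sum>es\<in>E. c es * mon (a # as) es * f) = (\<Sum>es\<in>E'. c es * mon (a # as) es * f)"
      by (rule sum.mono_neutral_right) (use Cons.prems(6) in \<open>auto simp: E'_def\<close>)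
    also have "\<dots> = a ^ e0 * S f" unfolding S_def sum_distrib_left
    proof (rule sum.cong[OF refl])
      fix es assume "es \<in> E'"
      then have "a ^ hd es = a ^ e0 * a ^ (hd es - e0)" using e0 by (simp add: power_add[symmetric])
      then show "c es * mon (a # as) es * f = a ^ e0 * (c es * (a ^ (hd es - e0) * mon as (tl es)) * f)"
        by (simp add: algebra_simps)
    qed
    finally have "S f \<in> J" using regular_power[OF reg aA SA[OF Cons.prems(4)]] Cons.prems(8) by simp
    obtain s u f' where f': "u \<in> U" "f' \<in> A" "u * f - a ^ s * f' \<in> J" "f' \<notin> sat_insert a J"
      using divide_out_power[OF Cons.prems(1) aU Cons.prems(4,5)] by blast
    \<comment> \<open>Passing from \<open>f\<close> to \<open>f'\<close>: linearity of
      \<open>S\<close> puts \<open>a ^ s * S f'\<close> into \<open>J\<close>, and the regular power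
      \<open>a ^ s\<close> cancels.\<close>
    have "S (u * f - a ^ s * f') \<in> J" unfolding Smult by (rule JD(4)[OF S1 f'(3)])
    moreover have "u * S f \<in> J" using \<open>S f \<in> J\<close> f' by (intro JD(4) U_A)
    ultimately have "u * S f - S (u * f - a ^ s * f') \<in> J" using ideal_in_diff[OF subring_A JI] by blast
    then have "a ^ s * S f' \<in> J" by (simp add: S_lin)
    then have "S f' \<in> J" using regular_power[OF reg aA SA[OF f'(2)]] by blast
    let ?J = "sat_insert a J"
    have satJ: "saturated ?J" by (rule saturated_sat_insert[OF JI aA])
    note satJI = saturatedD(1)[OF satJ]
    \<comment> \<open>Modulo \<open>a\<close> only the terms with first exponent exactly
      \<open>e0\<close> survive; their tails form the relation for the shorter sequence.\<close>
    define E0 where "E0 = {es\<in>E'. hd es = e0}"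
    have Ssplit: "S f' = (\<Sum>es\<in>E0. c es * (a ^ (hd es - e0) * mon as (tl es)) * f')
        + (\<Sum>es\<in>E'-E0. c es * (a ^ (hd es - e0) * mon as (tl es)) * f')"
      unfolding S_def by (subst sum.subset_diff[of E0 E']) (use fE' in \<open>auto simp: E0_def add.commute\<close>)
    have Srest: "(\<Sum>es\<in>E'-E0. c es * (a ^ (hd es - e0) * mon as (tl es)) * f') \<in> ?J"
    proof (rule ideal_in_sum[OF satJI])
      fix es assume es: "es \<in> E' - E0"
      then have "e0 < hd es" using e0[of es] by (auto simp: E0_def)
      then have "a ^ (hd es - e0) = a ^ (hd es - e0 - 1) * a" by (metis Suc_diff_1 power_Suc2 zero_less_diff diff_Suc_1)
      then have "c es * (a ^ (hd es - e0) * mon as (tl es)) * f' = (c es * a ^ (hd es - e0 - 1) * mon as (tl es) * f') * a"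
        by (simp add: algebra_simps)
      also have "\<dots> \<in> ?J" using es cA aA f' by (intro sat_insert_multiple[OF JI] A_rules mon_A as) (auto simp: E'_def)
      finally show "c es * (a ^ (hd es - e0) * mon as (tl es)) * f' \<in> ?J" .
    qed
    have "S f' \<in> ?J" using sat_insert_superset[OF JI \<open>S f' \<in> J\<close>] .
    from ideal_in_diff[OF subring_A satJI this Srest]
    have "(\<Sum>es\<in>E0. c es * (a ^ (hd es - e0) * mon as (tl es)) * f') \<in> ?J"
      unfolding Ssplit by simp
    also have "(\<Sum>es\<in>E0. c es * (a ^ (hd es - e0) * mon as (tl es)) * f') =
        (\<Sum>es\<in>E0. c (e0 # tl es) * mon as (tl es) * f')"
    proof (rule sum.cong[OF refl])
      fix es assume es: "es \<in> E0"
      then have "e0 # tl es = es" using Cons.prems(7)[of es] by (cases es) (auto simp: E0_def E'_def)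
      then show "c es * (a ^ (hd es - e0) * mon as (tl es)) * f' = c (e0 # tl es) * mon as (tl es) * f'"
        using es by (simp add: E0_def)
    qed
    also have "\<dots> = (\<Sum>es\<in>tl ` E0. c (e0 # es) * mon as es * f')"
    proof (rule sum.reindex_cong[symmetric, of "tl" E0])
      show "inj_on tl E0"
      proof (rule inj_onI)
        fix x y assume "x \<in> E0" "y \<in> E0" "tl x = tl y"
        then show "x = y" using Cons.prems(7)[of x] Cons.prems(7)[of y]
          by (cases x; cases y) (auto simp: E0_def E'_def)
      qed
    qed auto
    finally have "\<forall>es\<in>tl ` E0. c (e0 # es) = 0"
    proof (intro Cons.IH[OF satJ])
      show "length es = length as \<and> c (e0 # es) \<in> K" if "es \<in> tl ` E0" for es
        using that Cons.prems(7) by (force simp: E0_def E'_def length_Suc_conv)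
    qed (use Cons.prems(2) as f' fE' in \<open>auto simp: E0_def\<close>)
    moreover obtain es where "es \<in> E'" "hd es = e0" using \<open>e0 \<in> hd ` E'\<close> by auto
    moreover have "es = e0 # tl es" using Cons.prems(7)[of es] calculation by (cases es) (auto simp: E'_def)
    ultimately show False by (auto simp: E0_def E'_def)
  qed
qed

end

section \<open>Rational dependence and the growth of monomials\<close>

lemma power_fun_apply: "((f :: 'c \<Rightarrow> 'b::comm_ring_1) ^ n) q = f q ^ n"
  by (induction n) auto

lemma sum_fun_apply: "(sum f S :: 'c \<Rightarrow> 'b::comm_ring_1) q = (\<Sum>i\<in>S. f i q)"
  by (induction S rule: infinite_finite_induct) auto

text \<open>Gaussian elimination: an unknown \<open>e1\<close> with nonzero coefficient in the
  equation \<open>t\<close> is solved for, which lowers both counts by one.\<close>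

lemma homogeneous_system_solution:
  fixes M :: "'e \<Rightarrow> 't \<Rightarrow> 'a::field"
  assumes "finite T" "finite E" "card T < card E"
  shows "\<exists>c. (\<exists>e\<in>E. c e \<noteq> 0) \<and> (\<forall>t\<in>T. (\<Sum>e\<in>E. c e * M e t) = 0)"
  using assms
proof (induction T arbitrary: E M rule: finite_induct)
  case empty
  then have "E \<noteq> {}" by auto
  then show ?case by (auto intro!: exI[of _ "\<lambda>_. 1"])
next
  case (insert t T)
  show ?case
  proof (cases "\<forall>e\<in>E. M e t = 0")
    case True
    obtain c where "\<exists>e\<in>E. c e \<noteq> 0" "\<forall>t\<in>T. (\<Sum>e\<in>E. c e * M e t) = 0"
      using insert.IH[OF insert.prems(1), of M] insert.prems(2) insert.hyps by auto
    then show ?thesis using True by (auto intro!: exI[of _ c])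
  next
    case False
    then obtain e1 where e1: "e1 \<in> E" "M e1 t \<noteq> 0" by blast
    define E1 where "E1 = E - {e1}"
    define M' where "M' e s = M e s - M e t / M e1 t * M e1 s" for e s
    have fin: "finite E1" using insert.prems(1) by (simp add: E1_def)
    have E: "E = insert e1 E1" "e1 \<notin> E1" using e1 by (auto simp: E1_def)
    have "card T < card E1" using insert.prems insert.hyps fin E by simp
    from insert.IH[OF fin this, of M'] obtain c where c: "\<exists>e\<in>E1. c e \<noteq> 0"
      "\<And>s. s \<in> T \<Longrightarrow> (\<Sum>e\<in>E1. c e * M' e s) = 0" by blast
    define d where "d = c(e1 := - (\<Sum>e\<in>E1. c e * M e t) / M e1 t)"
    have sum_d: "(\<Sum>e\<in>E. d e * M e s) = (\<Sum>e\<in>E1. c e * M e s) - (\<Sum>e\<in>E1. c e * M e t) / M e1 t * M e1 s" for s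
    proof -
      have "(\<Sum>e\<in>E1. d e * M e s) = (\<Sum>e\<in>E1. c e * M e s)"
        by (rule sum.cong) (use E in \<open>auto simp: d_def\<close>)
      then show ?thesis using E fin by (simp add: d_def)
    qed
    have sum_M': "(\<Sum>e\<in>E1. c e * M' e s) = (\<Sum>e\<in>E1. c e * M e s) - (\<Sum>e\<in>E1. c e * M e t) / M e1 t * M e1 s" for s
      by (simp add: M'_def right_diff_distrib sum_subtractf sum_distrib_right sum_divide_distrib mult.assoc)
    have "(\<Sum>e\<in>E. d e * M e s) = 0" if "s \<in> insert t T" for s
    proof (cases "s = t")
      case True
      then show ?thesis using e1 by (simp add: sum_d)
    next
      case False
      then show ?thesis using c(2)[of s] that by (simp add: sum_d sum_M')
    qed
    moreover have "\<exists>e\<in>E. d e \<noteq> 0" using c(1) E by (auto simp: d_def)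
    ultimately show ?thesis by blast
  qed
qed

text \<open>The bound applies to each variable separately, so the admissible exponents fill a box
  with \<open>(C + 1) ^ card Y\<close> points.\<close>

inductive_set bounded_degree :: "'v set \<Rightarrow> nat \<Rightarrow> (('v \<Rightarrow> 'a::comm_ring_1) \<Rightarrow> 'a) set" for Y C where
  monomial: "(\<And>v. v \<in> Y \<Longrightarrow> \<alpha> v \<le> C) \<Longrightarrow> (\<lambda>p. c * (\<Prod>v\<in>Y. p v ^ \<alpha> v)) \<in> bounded_degree Y C"
| add: "f \<in> bounded_degree Y C \<Longrightarrow> g \<in> bounded_degree Y C \<Longrightarrow> (\<lambda>p. f p + g p) \<in> bounded_degree Y C"

lemma bounded_degree_mono: "f \<in> bounded_degree Y C \<Longrightarrow> C \<le> C' \<Longrightarrow> f \<in> bounded_degree Y C'"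
proof (induction rule: bounded_degree.induct)
  case (monomial \<alpha> c)
  then show ?case by (intro bounded_degree.monomial) (meson le_trans)
qed (auto intro: bounded_degree.add)

lemma bounded_degree_mult:
  assumes "f \<in> bounded_degree Y C" "g \<in> bounded_degree Y D"
  shows "(\<lambda>p. f p * g p) \<in> bounded_degree Y (C + D)"
  using assms(1)
proof (induction rule: bounded_degree.induct)
  case (monomial \<alpha> c)
  from assms(2) show ?case
  proof (induction rule: bounded_degree.induct)
    case (monomial \<beta> d)
    have "(\<lambda>p. c * d * (\<Prod>v\<in>Y. p v ^ (\<alpha> v + \<beta> v))) \<in> bounded_degree Y (C + D)"
      using monomial \<open>\<And>v. v \<in> Y \<Longrightarrow> \<alpha> v \<le> C\<close> by (intro bounded_degree.monomial add_mono) auto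
    then show ?case by (simp add: power_add prod.distrib mult_ac)
  next
    case (add f g)
    then show ?case using bounded_degree.add[OF add.IH] by (simp add: distrib_left)
  qed
next
  case (add f g)
  then show ?case using bounded_degree.add[OF add.IH] by (simp add: distrib_right)
qed

lemma bounded_degree_const: "(\<lambda>p. c) \<in> bounded_degree Y C"
  using bounded_degree.monomial[of Y "\<lambda>_. 0" C c] by simp

lemma bounded_degree_power:
  assumes "f \<in> bounded_degree Y C"
  shows "(\<lambda>p. f p ^ n) \<in> bounded_degree Y (n * C)"
proof (induction n)
  case (Suc n)
  then show ?case using bounded_degree_mult[OF assms Suc] by simp
qed (simp add: bounded_degree_const)

lemma polyfun_bounded_degree:
  fixes f :: "('v \<Rightarrow> 'a::comm_ring_1) \<Rightarrow> 'a"
  assumes "finite Y" "f \<in> polyfun Y"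
  shows "\<exists>C. f \<in> bounded_degree Y C"
  using assms(2)
proof (induction rule: polyfun.induct)
  case (const c)
  then show ?case using bounded_degree_const by blast
next
  case (var v)
  have "(\<Prod>w\<in>Y. p w ^ (if w = v then 1 else 0)) = p v" for p :: "'v \<Rightarrow> 'a"
    using var assms(1) by (simp add: if_distrib[of "\<lambda>n. _ ^ n"] prod.delta cong: if_cong)
  moreover have "(\<lambda>p :: 'v \<Rightarrow> 'a. 1 * (\<Prod>w\<in>Y. p w ^ (if w = v then 1 else 0))) \<in> bounded_degree Y 1"
    by (rule bounded_degree.monomial) simp
  ultimately show ?case by (auto simp del: One_nat_def)
next
  case (add f g)
  then obtain C D where "f \<in> bounded_degree Y C" "g \<in> bounded_degree Y D" by blast
  then have "f \<in> bounded_degree Y (C + D)" "g \<in> bounded_degree Y (C + D)"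
    by (auto intro: bounded_degree_mono)
  then show ?case using bounded_degree.add by blast
next
  case (mult f g)
  then show ?case using bounded_degree_mult by blast
qed

lemma bounded_degree_expansion:
  assumes "finite Y" "f \<in> bounded_degree Y C"
  shows "\<exists>M. \<forall>p. f p = (\<Sum>\<beta>\<in>PiE Y (\<lambda>_. {..C}). M \<beta> * (\<Prod>v\<in>Y. p v ^ \<beta> v))"
  using assms(2)
proof (induction rule: bounded_degree.induct)
  case (monomial \<alpha> c)
  let ?M = "\<lambda>\<beta>. if \<beta> = restrict \<alpha> Y then c else 0"
  have fin: "finite (PiE Y (\<lambda>_. {..C}))" using assms(1) by (intro finite_PiE) auto
  have "restrict \<alpha> Y \<in> PiE Y (\<lambda>_. {..C})" using monomial by auto
  then have "(\<Sum>\<beta>\<in>PiE Y (\<lambda>_. {..C}). ?M \<beta> * (\<Prod>v\<in>Y. p v ^ \<beta> v)) = c * (\<Prod>v\<in>Y. p v ^ \<alpha> v)" for p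
    using fin by (simp add: if_distrib[of "\<lambda>x. x * _"] sum.delta cong: if_cong)
  then show ?case by (intro exI[of _ ?M]) simp
next
  case (add f g)
  then obtain M N where "\<forall>p. f p = (\<Sum>\<beta>\<in>PiE Y (\<lambda>_. {..C}). M \<beta> * (\<Prod>v\<in>Y. p v ^ \<beta> v))"
    "\<forall>p. g p = (\<Sum>\<beta>\<in>PiE Y (\<lambda>_. {..C}). N \<beta> * (\<Prod>v\<in>Y. p v ^ \<beta> v))" by blast
  then show ?case by (intro exI[of _ "\<lambda>\<beta>. M \<beta> + N \<beta>"]) (simp add: distrib_right sum.distrib)
qed

text \<open>Values outside \<open>W\<close> are unconstrained, so coordinates outside
  \<open>Y\<close> can be members once equations valid on \<open>W\<close> determine them.\<close>

definition rational_on :: "'v set \<Rightarrow> ('v \<Rightarrow> 'a::field) set \<Rightarrow> (('v \<Rightarrow> 'a) \<Rightarrow> 'a) set" where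
  "rational_on Y W = {b. \<exists>D\<in>polyfun Y. \<exists>G\<in>polyfun Y. \<forall>q\<in>W. D q \<noteq> 0 \<and> D q * b q = G q}"

lemma rational_onI:
  "D \<in> polyfun Y \<Longrightarrow> G \<in> polyfun Y \<Longrightarrow> (\<And>q. q \<in> W \<Longrightarrow> D q \<noteq> 0) \<Longrightarrow>
    (\<And>q. q \<in> W \<Longrightarrow> D q * b q = G q) \<Longrightarrow> b \<in> rational_on Y W"
  by (auto simp: rational_on_def)

lemma rational_on_polyfun: "b \<in> polyfun Y \<Longrightarrow> b \<in> rational_on Y W"
  by (rule rational_onI[of "\<lambda>_. 1" _ b]) (auto intro: polyfun.const)

lemma rational_on_add:
  assumes "b \<in> rational_on Y W" "c \<in> rational_on Y W"
  shows "(\<lambda>q. b q + c q) \<in> rational_on Y W"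
proof -
  obtain D G D' G' where h: "D \<in> polyfun Y" "G \<in> polyfun Y" "D' \<in> polyfun Y" "G' \<in> polyfun Y"
    "\<forall>q\<in>W. D q \<noteq> 0 \<and> D q * b q = G q" "\<forall>q\<in>W. D' q \<noteq> 0 \<and> D' q * c q = G' q"
    using assms unfolding rational_on_def by blast
  show ?thesis
  proof (rule rational_onI)
    show "(\<lambda>q. D q * D' q) \<in> polyfun Y" "(\<lambda>q. G q * D' q + D q * G' q) \<in> polyfun Y"
      using h by (auto intro!: polyfun.intros)
    fix q assume "q \<in> W"
    then show "D q * D' q \<noteq> 0" "D q * D' q * (b q + c q) = G q * D' q + D q * G' q"
      using h(5,6)[rule_format, of q] by (auto simp: algebra_simps)
  qed
qed

lemma rational_on_mult:
  assumes "b \<in> rational_on Y W" "c \<in> rational_on Y W"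
  shows "(\<lambda>q. b q * c q) \<in> rational_on Y W"
proof -
  obtain D G D' G' where h: "D \<in> polyfun Y" "G \<in> polyfun Y" "D' \<in> polyfun Y" "G' \<in> polyfun Y"
    "\<forall>q\<in>W. D q \<noteq> 0 \<and> D q * b q = G q" "\<forall>q\<in>W. D' q \<noteq> 0 \<and> D' q * c q = G' q"
    using assms unfolding rational_on_def by blast
  show ?thesis
  proof (rule rational_onI)
    show "(\<lambda>q. D q * D' q) \<in> polyfun Y" "(\<lambda>q. G q * G' q) \<in> polyfun Y"
      using h by (auto intro!: polyfun.intros)
    fix q assume "q \<in> W"
    then have e: "D q * b q = G q" "D' q * c q = G' q" "D q \<noteq> 0" "D' q \<noteq> 0" using h(5,6) by auto
    show "D q * D' q \<noteq> 0" using e by simp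
    show "D q * D' q * (b q * c q) = G q * G' q" unfolding e(1,2)[symmetric] by (simp add: mult_ac)
  qed
qed

lemma rational_on_const: "(\<lambda>q. c) \<in> rational_on Y W"
  by (intro rational_on_polyfun polyfun.const)

lemma rational_on_minus:
  assumes "b \<in> rational_on Y W"
  shows "(\<lambda>q. - b q) \<in> rational_on Y W"
  using rational_on_mult[OF rational_on_const[of "- 1"] assms] by simp

lemma rational_on_sum:
  assumes "\<And>i. i \<in> S \<Longrightarrow> b i \<in> rational_on Y W"
  shows "(\<lambda>q. \<Sum>i\<in>S. b i q) \<in> rational_on Y W"
  using assms by (induction S rule: infinite_finite_induct) (auto intro: rational_on_const rational_on_add)

lemma rational_on_divide:
  assumes "b \<in> rational_on Y W" "c \<in> rational_on Y W" "\<And>q. q \<in> W \<Longrightarrow> b q \<noteq> 0"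
    and x: "\<And>q. q \<in> W \<Longrightarrow> b q * x q = c q"
  shows "x \<in> rational_on Y W"
proof -
  obtain D G D' G' where h: "D \<in> polyfun Y" "G \<in> polyfun Y" "D' \<in> polyfun Y" "G' \<in> polyfun Y"
    "\<forall>q\<in>W. D q \<noteq> 0 \<and> D q * b q = G q" "\<forall>q\<in>W. D' q \<noteq> 0 \<and> D' q * c q = G' q"
    using assms(1,2) unfolding rational_on_def by blast
  show ?thesis
  proof (rule rational_onI)
    show "(\<lambda>q. G q * D' q) \<in> polyfun Y" "(\<lambda>q. D q * G' q) \<in> polyfun Y"
      using h by (auto intro!: polyfun.intros)
    fix q assume q: "q \<in> W"
    have e: "D q * b q = G q" "D' q * c q = G' q" "D q \<noteq> 0" "D' q \<noteq> 0" using h(5,6) q by auto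
    show "G q * D' q \<noteq> 0" using e assms(3)[OF q] by (simp flip: e(1))
    show "G q * D' q * x q = D q * G' q"
      unfolding e(1,2)[symmetric] x[OF q, symmetric] by (simp add: algebra_simps)
  qed
qed

lemma polyfun_rational_on:
  assumes "\<And>v. v \<in> X \<Longrightarrow> (\<lambda>p. p v) \<in> rational_on Y W" "f \<in> polyfun X"
  shows "f \<in> rational_on Y W"
  using assms(2)
  by (induction rule: polyfun.induct) (auto intro: rational_on_const assms(1) rational_on_add rational_on_mult)

text \<open>Denominators are cleared uniformly: the \<open>N\<close>-th power of one product
  \<open>D\<close> serves all exponents below \<open>N\<close>, and the resulting degree bound is
  linear in \<open>N\<close> with a slope \<open>C\<close> independent of the monomial.\<close>

lemma mon_rational:
  assumes Y: "finite Y" and as: "set as \<subseteq> rational_on Y W"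
  shows "\<exists>C D. (\<forall>q\<in>W. D q \<noteq> 0) \<and> (\<forall>N es. length es = length as \<and> set es \<subseteq> {..<N} \<longrightarrow>
           (\<exists>G\<in>bounded_degree Y (N * C). \<forall>q\<in>W. D q ^ N * mon as es q = G q))"
  using as
proof (induction as)
  case Nil
  show ?case
    by (intro exI[of _ 0] exI[of _ "\<lambda>_. 1"]) (auto intro: bexI[OF _ bounded_degree_const[of 1]])
next
  case (Cons a as)
  then obtain C D where D: "\<forall>q\<in>W. D q \<noteq> 0" and CD: "\<And>N es. length es = length as \<Longrightarrow> set es \<subseteq> {..<N} \<Longrightarrow>
           \<exists>G\<in>bounded_degree Y (N * C). \<forall>q\<in>W. D q ^ N * mon as es q = G q" by auto blast
  from Cons.prems obtain D' G' where h: "D' \<in> polyfun Y" "G' \<in> polyfun Y"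
    "\<forall>q\<in>W. D' q \<noteq> 0 \<and> D' q * a q = G' q" by (auto simp: rational_on_def)
  obtain C1 C2 where "D' \<in> bounded_degree Y C1" "G' \<in> bounded_degree Y C2"
    using polyfun_bounded_degree[OF Y] h by metis
  then have C': "D' \<in> bounded_degree Y (C1 + C2)" "G' \<in> bounded_degree Y (C1 + C2)"
    by (auto intro: bounded_degree_mono)
  let ?C = "C1 + C2"
  show ?case
  proof (intro exI[of _ "?C + C"] exI[of _ "\<lambda>q. D' q * D q"] conjI allI impI ballI)
    show "q \<in> W \<Longrightarrow> D' q * D q \<noteq> 0" for q using h D by auto
  next
    fix N and es :: "nat list" assume es: "length es = length (a # as) \<and> set es \<subseteq> {..<N}"
    then obtain e es' where e: "es = e # es'" "e < N" "length es' = length as" "set es' \<subseteq> {..<N}"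
      by (cases es) auto
    from CD[OF e(3,4)] obtain G where G: "G \<in> bounded_degree Y (N * C)" "\<forall>q\<in>W. D q ^ N * mon as es' q = G q" by blast
    have N: "N = (N - e) + e" using e by simp
    have "(\<lambda>q. D' q ^ (N - e) * G' q ^ e * G q) \<in> bounded_degree Y ((N - e) * ?C + e * ?C + N * C)"
      by (intro bounded_degree_mult bounded_degree_power C' G)
    also have "(N - e) * ?C + e * ?C + N * C = N * (?C + C)"
      using N by (metis add_mult_distrib add_mult_distrib2)
    finally have B: "(\<lambda>q. D' q ^ (N - e) * G' q ^ e * G q) \<in> bounded_degree Y (N * (?C + C))" .
    show "\<exists>G\<in>bounded_degree Y (N * (?C + C)). \<forall>q\<in>W. (D' q * D q) ^ N * mon (a # as) es q = G q"
    proof (intro bexI[OF _ B] ballI)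
      fix q assume q: "q \<in> W"
      have "(D' q * D q) ^ N * mon (a # as) es q = D' q ^ N * a q ^ e * (D q ^ N * mon as es' q)"
        by (simp add: e power_fun_apply algebra_simps)
      also have "D' q ^ N = D' q ^ (N - e) * D' q ^ e" using N by (metis power_add)
      also have "D' q ^ (N - e) * D' q ^ e * a q ^ e = D' q ^ (N - e) * (D' q * a q) ^ e"
        by (simp add: power_mult_distrib)
      finally show "(D' q * D q) ^ N * mon (a # as) es q = D' q ^ (N - e) * G' q ^ e * G q"
        using h(3) G(2) q by simp
    qed
  qed
qed

text \<open>Transcendence degree by counting: there are \<open>N ^ length as\<close> monomials with
  exponents below \<open>N\<close>, but after clearing denominators they lie in the span of
  \<open>(N * C + 1) ^ card Y\<close> monomials in the coordinates, a number of lower order in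
  \<open>N\<close>.\<close>

lemma monomials_dependent:
  fixes as :: "(('v \<Rightarrow> 'a::field) \<Rightarrow> 'a) list"
  assumes Y: "finite Y" and as: "set as \<subseteq> rational_on Y W" and len: "card Y < length as"
  shows "\<exists>E c. finite E \<and> (\<forall>es\<in>E. length es = length as) \<and> (\<exists>es\<in>E. c es \<noteq> 0) \<and>
           (\<forall>q\<in>W. (\<Sum>es\<in>E. c es * mon as es q) = 0)"
proof -
  obtain C D where D: "\<forall>q\<in>W. D q \<noteq> 0" and CD: "\<And>N es. length es = length as \<Longrightarrow> set es \<subseteq> {..<N} \<Longrightarrow>
           \<exists>G\<in>bounded_degree Y (N * C). \<forall>q\<in>W. D q ^ N * mon as es q = G q"
    using mon_rational[OF Y as] by auto blast
  \<comment> \<open>Chosen larger than \<open>(C + 1) ^ card Y\<close>, so that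
    \<open>(N * (C + 1)) ^ card Y < N ^ Suc (card Y)\<close>.\<close>
  define N where "N = (C + 1) ^ card Y + 1"
  define E where "E = {es. set es \<subseteq> {..<N} \<and> length es = length as}"
  define T where "T = PiE Y (\<lambda>_. {..N * C})"
  have fE: "finite E" unfolding E_def by (rule finite_lists_length_eq) simp
  have cE: "card E = N ^ length as" unfolding E_def by (subst card_lists_length_eq) auto
  have fT: "finite T" unfolding T_def using Y by (intro finite_PiE) auto
  have "card T = (N * C + 1) ^ card Y" unfolding T_def using Y by (simp add: card_PiE)
  also have "\<dots> \<le> (N * (C + 1)) ^ card Y" by (intro power_mono) (auto simp: N_def)
  also have "\<dots> = N ^ card Y * (C + 1) ^ card Y" by (rule power_mult_distrib)
  also have "\<dots> < N ^ card Y * N" by (auto simp: N_def)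
  also have "\<dots> = N ^ Suc (card Y)" by simp
  also have "\<dots> \<le> N ^ length as" using len by (intro power_increasing) (auto simp: N_def)
  finally have "card T < card E" by (simp add: cE)
  have "\<forall>es\<in>E. \<exists>M. \<forall>q\<in>W. D q ^ N * mon as es q = (\<Sum>\<beta>\<in>T. M \<beta> * (\<Prod>v\<in>Y. q v ^ \<beta> v))"
  proof
    fix es assume "es \<in> E"
    then obtain G where G: "G \<in> bounded_degree Y (N * C)" "\<forall>q\<in>W. D q ^ N * mon as es q = G q"
      using CD[of es N] by (auto simp: E_def)
    then show "\<exists>M. \<forall>q\<in>W. D q ^ N * mon as es q = (\<Sum>\<beta>\<in>T. M \<beta> * (\<Prod>v\<in>Y. q v ^ \<beta> v))"
      using bounded_degree_expansion[OF Y G(1)] unfolding T_def by auto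
  qed
  from bchoice[OF this] obtain M where M: "\<And>es q. es \<in> E \<Longrightarrow> q \<in> W \<Longrightarrow>
      D q ^ N * mon as es q = (\<Sum>\<beta>\<in>T. M es \<beta> * (\<Prod>v\<in>Y. q v ^ \<beta> v))" by blast
  obtain c where c: "\<exists>e\<in>E. c e \<noteq> 0" "\<And>t. t \<in> T \<Longrightarrow> (\<Sum>e\<in>E. c e * M e t) = 0"
    using homogeneous_system_solution[OF fT fE \<open>card T < card E\<close>, of M] by blast
  have "(\<Sum>es\<in>E. c es * mon as es q) = 0" if q: "q \<in> W" for q
  proof -
    have "D q ^ N * (\<Sum>es\<in>E. c es * mon as es q) = (\<Sum>es\<in>E. c es * (D q ^ N * mon as es q))"
      by (simp add: sum_distrib_left mult_ac)
    also have "\<dots> = (\<Sum>es\<in>E. \<Sum>\<beta>\<in>T. c es * M es \<beta> * (\<Prod>v\<in>Y. q v ^ \<beta> v))"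
      using M q by (simp add: sum_distrib_left mult.assoc)
    also have "\<dots> = (\<Sum>\<beta>\<in>T. (\<Sum>es\<in>E. c es * M es \<beta>) * (\<Prod>v\<in>Y. q v ^ \<beta> v))"
      by (subst sum.swap) (simp add: sum_distrib_right)
    also have "\<dots> = 0" using c(2) by simp
    finally show ?thesis using D q by simp
  qed
  then show ?thesis using fE c(1) by (intro exI[of _ E] exI[of _ c]) (auto simp: E_def)
qed

section \<open>The local ring at a point and its depth\<close>

locale variety_point =
  fixes X :: "'v set" and Z :: "('v \<Rightarrow> 'a::field) set" and z :: "'v \<Rightarrow> 'a"
  assumes finite_X: "finite X"
begin

abbreviation "Pf \<equiv> polyfun X :: (('v \<Rightarrow> 'a) \<Rightarrow> 'a) set"
abbreviation "nonzero_at_z \<equiv> {u \<in> Pf. u z \<noteq> 0}"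

sublocale localised_noetherian Pf nonzero_at_z "range (\<lambda>c p. c)"
proof
  note P = is_subringD[OF is_subring_polyfun[of X, where ?'b = 'a]]
  show "noetherian_subring Pf" by (rule noetherian_polyfun[OF finite_X])
  show "1 \<in> nonzero_at_z" using P(2) by simp
  show "u * v \<in> nonzero_at_z" if "u \<in> nonzero_at_z" "v \<in> nonzero_at_z" for u v using that P(4) by auto
  show "u - b * a \<in> nonzero_at_z" if "u \<in> nonzero_at_z" "a \<in> Pf - nonzero_at_z" "b \<in> Pf" for u a b
    using that P(4,6) by auto
  show "range (\<lambda>c p. c) \<subseteq> Pf" by (auto intro: polyfun.const)
  show "range (\<lambda>c p. c) - {0} \<subseteq> nonzero_at_z" by (auto intro: polyfun.const simp: fun_eq_iff)
qed auto

text \<open>The kernel of the map from polynomial functions to the local ring at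
  \<open>z\<close>.\<close>

definition vanishing :: "(('v \<Rightarrow> 'a) \<Rightarrow> 'a) set" where
  "vanishing = {y \<in> Pf. \<exists>u \<in> nonzero_at_z. \<forall>q\<in>Z. u q * y q = 0}"

text \<open>For fractions \<open>xs\<close> of the local ring this is the contraction to
  \<open>Pf\<close> of the ideal they generate; denominators are units, so only numerators
  occur.\<close>

definition gen_ideal :: "('v, 'a) frac list \<Rightarrow> (('v \<Rightarrow> 'a) \<Rightarrow> 'a) set" where
  "gen_ideal xs = foldl (\<lambda>J x. sat_insert (fst x) J) vanishing xs"

lemma vanishingI: "y \<in> Pf \<Longrightarrow> u \<in> Pf \<Longrightarrow> u z \<noteq> 0 \<Longrightarrow> (\<And>q. q \<in> Z \<Longrightarrow> u q * y q = 0) \<Longrightarrow> y \<in> vanishing"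
  by (auto simp: vanishing_def)

lemma saturated_vanishing: "saturated vanishing"
  unfolding saturated_def
proof
  show "ideal_in Pf vanishing" unfolding ideal_in_def
  proof (intro conjI ballI)
    show "vanishing \<subseteq> Pf" by (auto simp: vanishing_def)
    show "0 \<in> vanishing" by (rule vanishingI[of _ 1]) (auto intro: A_rules)
  next
    fix x y assume "x \<in> vanishing" "y \<in> vanishing"
    then obtain u v where h: "x \<in> Pf" "y \<in> Pf" "u \<in> Pf" "v \<in> Pf" "u z \<noteq> 0" "v z \<noteq> 0"
      "\<forall>q\<in>Z. u q * x q = 0" "\<forall>q\<in>Z. v q * y q = 0" by (auto simp: vanishing_def)
    show "x + y \<in> vanishing"
    proof (rule vanishingI[of _ "u * v"])
      fix q assume "q \<in> Z"
      moreover have "(u * v) q * (x + y) q = v q * (u q * x q) + u q * (v q * y q)" by (simp add: algebra_simps)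
      ultimately show "(u * v) q * (x + y) q = 0" using h by simp
    qed (use h in \<open>auto intro: A_rules\<close>)
  next
    fix a x assume "a \<in> Pf" "x \<in> vanishing"
    then obtain u where h: "a \<in> Pf" "x \<in> Pf" "u \<in> Pf" "u z \<noteq> 0" "\<forall>q\<in>Z. u q * x q = 0"
      by (auto simp: vanishing_def)
    show "a * x \<in> vanishing"
      by (rule vanishingI[of _ u]) (use h in \<open>auto intro: A_rules\<close>)
  qed
  show "\<forall>u\<in>nonzero_at_z. \<forall>y\<in>Pf. u * y \<in> vanishing \<longrightarrow> y \<in> vanishing"
  proof (intro ballI impI)
    fix u y assume u: "u \<in> nonzero_at_z" and y: "y \<in> Pf" and "u * y \<in> vanishing"
    then obtain v where v: "v \<in> Pf" "v z \<noteq> 0" "\<forall>q\<in>Z. v q * (u q * y q) = 0" by (auto simp: vanishing_def)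
    show "y \<in> vanishing"
      by (rule vanishingI[of _ "v * u"]) (use u v y in \<open>auto intro: A_rules simp: mult.assoc\<close>)
  qed
qed

lemma gen_ideal_snoc: "gen_ideal (xs @ [x]) = sat_insert (fst x) (gen_ideal xs)"
  by (simp add: gen_ideal_def)

lemma loc_carrierD: "x \<in> loc_carrier Pf z \<Longrightarrow> fst x \<in> Pf \<and> snd x \<in> nonzero_at_z"
  by (auto simp: loc_carrier_def)

lemma saturated_gen_ideal: "set xs \<subseteq> loc_carrier Pf z \<Longrightarrow> saturated (gen_ideal xs)"
proof (induction xs rule: rev_induct)
  case Nil
  then show ?case by (simp add: gen_ideal_def saturated_vanishing)
next
  case (snoc x xs)
  then show ?case unfolding gen_ideal_snoc
    by (intro saturated_sat_insert) (auto intro: saturatedD dest: loc_carrierD)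
qed

lemma vanishing_gen_ideal: "set xs \<subseteq> loc_carrier Pf z \<Longrightarrow> vanishing \<subseteq> gen_ideal xs"
proof (induction xs rule: rev_induct)
  case Nil
  then show ?case by (simp add: gen_ideal_def)
next
  case (snoc x xs)
  then show ?case unfolding gen_ideal_snoc
    using sat_insert_superset[OF saturatedD(1)[OF saturated_gen_ideal]] by auto
qed

lemma gen_in_gen_ideal: "set xs \<subseteq> loc_carrier Pf z \<Longrightarrow> x \<in> set xs \<Longrightarrow> fst x \<in> gen_ideal xs"
proof (induction xs rule: rev_induct)
  case (snoc y xs)
  have I: "ideal_in Pf (gen_ideal xs)" using snoc.prems saturated_gen_ideal saturatedD(1) by auto
  show ?case
  proof (cases "x \<in> set xs")
    case True
    then show ?thesis using snoc sat_insert_superset[OF I] by (auto simp: gen_ideal_snoc)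
  next
    case False
    then have "x = y" "y \<in> loc_carrier Pf z" using snoc by auto
    then show ?thesis using sat_insert_multiple[OF I _ A_rules(2), of "fst y"] loc_carrierD[of y]
      by (simp add: gen_ideal_snoc)
  qed
qed simp

lemma loc_sum_in_ideal:
  assumes "ideal_in Pf I" "length cs = length xs" "set cs \<subseteq> loc_carrier Pf z" "set xs \<subseteq> loc_carrier Pf z"
    "fst ` set xs \<subseteq> I"
  shows "fst (loc_sum (map2 loc_mul cs xs)) \<in> I \<and> snd (loc_sum (map2 loc_mul cs xs)) \<in> nonzero_at_z"
  using assms(2-)
proof (induction cs xs rule: list_induct2)
  case Nil
  have "(\<lambda>_. 0) \<in> I" using ideal_inD(2)[OF assms(1)] by (simp add: zero_fun_def)
  moreover have "(\<lambda>_. 1) \<in> Pf" by (rule polyfun.const)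
  ultimately show ?case by (simp add: loc_sum_def loc_zero_def)
next
  case (Cons c cs x xs)
  define s where "s = loc_sum (map2 loc_mul cs xs)"
  have s: "fst s \<in> I" "snd s \<in> Pf" "snd s z \<noteq> 0" using Cons by (auto simp: s_def)
  have c: "fst c \<in> Pf" "snd c \<in> Pf" "snd c z \<noteq> 0" using Cons.prems(1) loc_carrierD[of c] by auto
  have x: "fst x \<in> I" "snd x \<in> Pf" "snd x z \<noteq> 0" using Cons.prems(2,3) loc_carrierD[of x] by auto
  have "loc_sum (map2 loc_mul (c # cs) (x # xs)) = loc_add (loc_mul c x) s" by (simp add: loc_sum_def s_def)
  also have "\<dots> = (snd s * fst c * fst x + snd c * snd x * fst s, snd c * snd x * snd s)"
    by (simp add: loc_add_def loc_mul_def fun_eq_iff algebra_simps)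
  finally have e: "loc_sum (map2 loc_mul (c # cs) (x # xs)) = \<dots>" .
  have "snd s * fst c * fst x + snd c * snd x * fst s \<in> I"
    using s c x by (intro ideal_inD(3,4)[OF assms(1)] A_rules(4))
  moreover have "snd c * snd x * snd s \<in> Pf"
    using s c x by (intro A_rules(4))
  ultimately show ?case unfolding e using s c x by (simp add: plus_fun_def times_fun_def)
qed

lemma gen_ideal_combination:
  assumes "set xs \<subseteq> loc_carrier Pf z" "y \<in> gen_ideal xs"
  shows "\<exists>u\<in>nonzero_at_z. \<exists>bs. length bs = length xs \<and> set bs \<subseteq> Pf \<and>
    (\<forall>q\<in>Z. u q * y q = sum_list (map2 (\<lambda>b x. b q * fst x q) bs xs))"
  using assms
proof (induction xs arbitrary: y rule: rev_induct)
  case Nil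
  then show ?case by (auto simp: gen_ideal_def vanishing_def)
next
  case (snoc x xs)
  then obtain u j b where h: "y \<in> Pf" "u \<in> nonzero_at_z" "j \<in> gen_ideal xs" "b \<in> Pf" "u * y = j + b * fst x"
    by (auto simp: gen_ideal_snoc elim!: sat_insertE)
  obtain v bs where v: "v \<in> nonzero_at_z" "length bs = length xs" "set bs \<subseteq> Pf"
    "\<forall>q\<in>Z. v q * j q = sum_list (map2 (\<lambda>b x. b q * fst x q) bs xs)"
    using snoc.IH[OF _ h(3)] snoc.prems by auto
  show ?case
  proof (intro bexI[of _ "v * u"] exI[of _ "bs @ [v * b]"] conjI ballI)
    show "length (bs @ [v * b]) = length (xs @ [x])" "set (bs @ [v * b]) \<subseteq> Pf"
      using v h by (auto intro: A_rules)
    fix q assume q: "q \<in> Z"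
    have "(v * u) q * y q = v q * (u * y) q" by (simp add: mult.assoc)
    also have "\<dots> = v q * j q + v q * b q * fst x q" unfolding h(5) by (simp add: algebra_simps)
    finally show "(v * u) q * y q = sum_list (map2 (\<lambda>b x. b q * fst x q) (bs @ [v * b]) (xs @ [x]))"
      using v q by simp
  next
    show "v * u \<in> nonzero_at_z" using v h mult_U by blast
  qed
qed

text \<open>Multiplying \<open>fst x / snd x\<close> by \<open>(b * snd x) / w\<close> gives
  \<open>b * fst x / w\<close>. With these coefficients the formal sum represents the combination of
  numerators over \<open>w\<close>; the identity is stated cross-multiplied.\<close>

lemma loc_sum_combination:
  assumes "length bs = length xs"
  shows "fst (loc_sum (map2 loc_mul (map2 (\<lambda>b x. (\<lambda>q. b q * snd x q, w)) bs xs) xs)) q * w q =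
         snd (loc_sum (map2 loc_mul (map2 (\<lambda>b x. (\<lambda>q. b q * snd x q, w)) bs xs) xs)) q *
           sum_list (map2 (\<lambda>b x. b q * fst x q) bs xs)"
  using assms
proof (induction bs xs rule: list_induct2)
  case Nil
  then show ?case by (simp add: loc_sum_def loc_zero_def)
next
  case (Cons b bs x xs)
  define s where "s = loc_sum (map2 loc_mul (map2 (\<lambda>b x. (\<lambda>q. b q * snd x q, w)) bs xs) xs)"
  define S where "S = sum_list (map2 (\<lambda>b x. b q * fst x q) bs xs)"
  have IH: "fst s q * w q = snd s q * S" using Cons.IH by (simp add: s_def S_def)
  have "loc_sum (map2 loc_mul (map2 (\<lambda>b x. (\<lambda>q. b q * snd x q, w)) (b # bs) (x # xs)) (x # xs))
      = loc_add (loc_mul (\<lambda>q. b q * snd x q, w) x) s" by (simp add: loc_sum_def s_def)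
  moreover have "(b q * snd x q * fst x q * snd s q + fst s q * (w q * snd x q)) * w q
      = b q * snd x q * fst x q * snd s q * w q + (fst s q * w q) * (w q * snd x q)"
    by (simp add: algebra_simps)
  ultimately show ?case unfolding IH
    by (simp add: loc_add_def loc_mul_def S_def[symmetric] IH algebra_simps)
qed

text \<open>The bridge between fractions and saturated ideals of functions: one direction clears the
  denominators of a combination, the other divides a combination of numerators by
  \<open>u * snd y\<close>.\<close>

lemma loc_in_ideal_iff:
  assumes xs: "set xs \<subseteq> loc_carrier Pf z" and y: "y \<in> loc_carrier Pf z"
  shows "loc_in_ideal Pf Z z xs y \<longleftrightarrow> fst y \<in> gen_ideal xs"
proof
  have I: "ideal_in Pf (gen_ideal xs)" using saturatedD(1)[OF saturated_gen_ideal[OF xs]] .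
  have yP: "fst y \<in> Pf" "snd y \<in> Pf" "snd y z \<noteq> 0" using loc_carrierD[OF y] by auto
  {
    assume "loc_in_ideal Pf Z z xs y"
    then obtain cs where cs: "length cs = length xs" "set cs \<subseteq> loc_carrier Pf z"
      and eq: "loc_eq Pf Z z y (loc_sum (map2 loc_mul cs xs))" by (auto simp: loc_in_ideal_def)
    define s where "s = loc_sum (map2 loc_mul cs xs)"
    have "fst ` set xs \<subseteq> gen_ideal xs" using gen_in_gen_ideal[OF xs] by blast
    then have s: "fst s \<in> gen_ideal xs" "snd s \<in> nonzero_at_z"
      using loc_sum_in_ideal[OF I cs xs] unfolding s_def by blast+
    obtain u where u: "u \<in> Pf" "u z \<noteq> 0" "\<forall>q\<in>Z. u q * (fst y q * snd s q - fst s q * snd y q) = 0"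
      using eq by (auto simp: loc_eq_def s_def)
    have "fst y * snd s - fst s * snd y \<in> vanishing"
      by (rule vanishingI[of _ u]) (use u s yP ideal_inD(1)[OF I] in \<open>auto intro!: A_rules(4,6)\<close>)
    then have "fst y * snd s - fst s * snd y \<in> gen_ideal xs" using vanishing_gen_ideal[OF xs] by blast
    from ideal_inD(3)[OF I this ideal_inD(4)[OF I yP(2) s(1)]]
    have "snd s * fst y \<in> gen_ideal xs" by (simp add: mult.commute)
    then show "fst y \<in> gen_ideal xs" using saturatedD(2)[OF saturated_gen_ideal[OF xs] s(2) yP(1)] by blast
  }
  {
    assume "fst y \<in> gen_ideal xs"
    from gen_ideal_combination[OF xs this] obtain u bs where u: "u \<in> Pf" "u z \<noteq> 0" and bs: "length bs = length xs" "set bs \<subseteq> Pf"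
      and eq: "\<And>q. q \<in> Z \<Longrightarrow> u q * fst y q = sum_list (map2 (\<lambda>b x. b q * fst x q) bs xs)" by auto
    define w where "w = u * snd y"
    have w: "w \<in> Pf" "w z \<noteq> 0" using u yP by (auto simp: w_def intro: A_rules)
    define cs where "cs = map2 (\<lambda>b x. (\<lambda>q. b q * snd x q, w)) bs xs"
    have "set cs \<subseteq> loc_carrier Pf z"
    proof
      fix c assume "c \<in> set cs"
      then obtain b x where "b \<in> set bs" "x \<in> set xs" "c = (\<lambda>q. b q * snd x q, w)"
        by (auto simp: cs_def dest: set_zip_leftD set_zip_rightD)
      then show "c \<in> loc_carrier Pf z" using w bs(2) loc_carrierD[of x] xs
        by (auto simp: loc_carrier_def intro!: polyfun.mult)
    qed
    moreover have "loc_eq Pf Z z y (loc_sum (map2 loc_mul cs xs))"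
      unfolding loc_eq_def
    proof (intro bexI[OF _ u(1)] conjI u(2) ballI)
      fix q assume q: "q \<in> Z"
      let ?s = "loc_sum (map2 loc_mul cs xs)"
      have "u q * (fst y q * snd ?s q - fst ?s q * snd y q) = snd ?s q * (u q * fst y q) - fst ?s q * w q"
        by (simp add: w_def algebra_simps)
      also have "\<dots> = 0" using loc_sum_combination[OF bs(1), of w q] eq[OF q] by (simp add: cs_def)
      finally show "u q * (fst y q * snd ?s q - fst ?s q * snd y q) = 0" .
    qed
    ultimately show "loc_in_ideal Pf Z z xs y" unfolding loc_in_ideal_def using bs(1)
      by (intro exI[of _ cs]) (auto simp: cs_def)
  }
qed

text \<open>The prefix \<open>ys\<close> holds the elements already consumed, whose ideal is the
  parameter of the recursive notion at that stage.\<close>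

lemma regular_seq_of_loc_regular_seq:
  assumes "loc_regular_seq Pf Z z (ys @ xs)"
  shows "regular_seq (gen_ideal ys) (map fst xs)"
  using assms
proof (induction xs arbitrary: ys)
  case (Cons x xs)
  have c: "set (ys @ x # xs) \<subseteq> loc_carrier Pf z"
    using Cons.prems by (auto simp: loc_regular_seq_def loc_max_ideal_def)
  have "\<forall>y\<in>Pf. fst x * y \<in> gen_ideal ys \<longrightarrow> y \<in> gen_ideal ys"
  proof (intro ballI impI)
    fix y assume y: "y \<in> Pf" and h: "fst x * y \<in> gen_ideal ys"
    have y1: "(y, \<lambda>_. 1) \<in> loc_carrier Pf z" using y by (auto simp: loc_carrier_def intro: polyfun.const)
    have x: "fst x \<in> Pf" "snd x \<in> nonzero_at_z" using c loc_carrierD[of x] by auto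
    have xy: "loc_mul x (y, \<lambda>_. 1) \<in> loc_carrier Pf z"
      using x y by (auto simp: loc_carrier_def loc_mul_def intro!: polyfun.mult)
    have ys: "set ys \<subseteq> loc_carrier Pf z" using c by auto
    have "fst (loc_mul x (y, \<lambda>_. 1)) = fst x * y" by (simp add: loc_mul_def fun_eq_iff)
    then have "loc_in_ideal Pf Z z ys (loc_mul x (y, \<lambda>_. 1))"
      using loc_in_ideal_iff[OF ys xy] h by simp
    moreover have "\<forall>i<length (ys @ x # xs). \<forall>y\<in>loc_carrier Pf z.
        loc_in_ideal Pf Z z (take i (ys @ x # xs)) (loc_mul ((ys @ x # xs) ! i) y) \<longrightarrow>
        loc_in_ideal Pf Z z (take i (ys @ x # xs)) y"
      using Cons.prems by (simp add: loc_regular_seq_def)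
    from this[rule_format, of "length ys" "(y, \<lambda>_. 1)"]
    have "loc_in_ideal Pf Z z ys (loc_mul x (y, \<lambda>_. 1)) \<Longrightarrow> loc_in_ideal Pf Z z ys (y, \<lambda>_. 1)"
      using y1 by simp
    ultimately show "y \<in> gen_ideal ys" using loc_in_ideal_iff[OF ys y1] by simp
  qed
  moreover have "regular_seq (gen_ideal (ys @ [x])) (map fst xs)" using Cons.IH[of "ys @ [x]"] Cons.prems by simp
  ultimately show ?case by (simp add: gen_ideal_snoc)
qed simp

text \<open>Since \<open>f\<close> is nonzero in the local ring, the multiples by \<open>f\<close> of the monomials in a regular
  sequence are linearly independent over the ground field. As functions on the locus where \<open>f\<close> does
  not vanish, they only depend on the coordinates in \<open>Y\<close>, which bounds their growth.\<close>
lemma loc_depth_le: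
  assumes Y: "finite Y" and f: "f \<in> Pf" "f \<notin> vanishing"
    and rat: "\<And>v. v \<in> X \<Longrightarrow> (\<lambda>p. p v) \<in> rational_on Y {q\<in>Z. f q \<noteq> 0}"
  shows "loc_depth Pf Z z \<le> enat (card Y)"
  unfolding loc_depth_def
proof (rule Sup_least, clarify)
  fix xs assume reg: "loc_regular_seq Pf Z z xs"
  have xs: "fst ` set xs \<subseteq> Pf - nonzero_at_z"
    using reg by (auto simp: loc_regular_seq_def loc_max_ideal_def loc_carrier_def)
  show "enat (length xs) \<le> enat (card Y)"
  proof (rule ccontr)
    assume "\<not> ?thesis"
    then have len: "card Y < length (map fst xs)" by simp
    let ?as = "map fst xs"
    have "set ?as \<subseteq> rational_on Y {q\<in>Z. f q \<noteq> 0}" using xs polyfun_rational_on[OF rat] by auto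
    from monomials_dependent[OF Y this len] obtain E c where
      E: "finite E" "\<forall>es\<in>E. length es = length ?as" "\<exists>es\<in>E. c es \<noteq> 0"
      and dep: "\<And>q. q \<in> Z \<Longrightarrow> f q \<noteq> 0 \<Longrightarrow> (\<Sum>es\<in>E. c es * mon ?as es q) = 0" by auto
    \<comment> \<open>Scalars are read as constant functions, the coefficient field of the locale.
      The relation holds on all of \<open>Z\<close>: by dependence where \<open>f\<close> is
      nonzero, by the factor \<open>f\<close> elsewhere.\<close>
    have "\<forall>es\<in>E. (\<lambda>es p. c es) es = (0 :: ('v \<Rightarrow> 'a) \<Rightarrow> 'a)"
    proof (rule regular_seq_independent[OF saturated_vanishing _ _ f E(1), of ?as])
      show "regular_seq vanishing ?as"
        using regular_seq_of_loc_regular_seq[of "[]" xs] reg by (simp add: gen_ideal_def)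
      show "set ?as \<subseteq> Pf - nonzero_at_z" using xs by simp
      show "length es = length ?as \<and> (\<lambda>p. c es) \<in> range (\<lambda>c p. c)" if "es \<in> E" for es using E that by auto
      show "(\<Sum>es\<in>E. (\<lambda>p. c es) * mon ?as es * f) \<in> vanishing"
      proof (rule vanishingI[of _ 1])
        show "(\<Sum>es\<in>E. (\<lambda>p. c es) * mon ?as es * f) \<in> Pf"
          using xs f by (intro is_subring_sum[OF subring_A] A_rules(4) mon_A polyfun.const) auto
        fix q assume q: "q \<in> Z"
        have "(\<Sum>es\<in>E. (\<lambda>p. c es) * mon ?as es * f) q = (\<Sum>es\<in>E. c es * mon ?as es q) * f q"
          by (simp add: sum_fun_apply sum_distrib_right)
        then show "1 q * (\<Sum>es\<in>E. (\<lambda>p. c es) * mon ?as es * f) q = 0" using dep[OF q] by (cases "f q = 0") auto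
      qed (auto intro: A_rules)
    qed
    then show False using E(3) by (auto simp: fun_eq_iff)
  qed
qed

end

section \<open>Lines, coordinate subspaces and the dimension of the local ring\<close>

lemma alg_closed_infinite:
  assumes "alg_closed_field TYPE('a::field)"
  shows "infinite (UNIV :: 'a set)"
proof
  assume fin: "finite (UNIV :: 'a set)"
  \<comment> \<open>Over a finite field this polynomial would take the value 1 everywhere.\<close>
  define q where "q = (\<Prod>a\<in>(UNIV :: 'a set). [:- a, 1:]) + 1"
  have "degree (\<Prod>a\<in>(UNIV :: 'a set). [:- a, 1:]) = card (UNIV :: 'a set)"
    by (subst degree_prod_eq_sum_degree) auto
  moreover have "card (UNIV :: 'a set) > 0" using fin by (simp add: card_gt_0_iff)
  ultimately have "degree q \<ge> 1" unfolding q_def by (subst degree_add_eq_left) auto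
  then obtain x where "poly q x = 0" using assms unfolding alg_closed_field_def by blast
  moreover have "poly (\<Prod>a\<in>(UNIV :: 'a set). [:- a, 1:]) x = 0"
    using fin by (auto simp: poly_prod intro!: bexI[of _ x])
  ultimately show False by (simp add: q_def)
qed

lemma polyfun_line:
  fixes f :: "('v \<Rightarrow> 'a::field) \<Rightarrow> 'a"
  assumes "f \<in> polyfun X"
  shows "\<exists>P. \<forall>s. f (\<lambda>v. a v + s * b v) = poly P s"
  using assms
proof (induction rule: polyfun.induct)
  case (const c)
  show ?case by (intro exI[of _ "[:c:]"]) simp
next
  case (var v)
  show ?case by (intro exI[of _ "[:a v, b v:]"]) simp
next
  case (add f g)
  then obtain P Q where "\<forall>s. f (\<lambda>v. a v + s * b v) = poly P s" "\<forall>s. g (\<lambda>v. a v + s * b v) = poly Q s" by blast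
  then show ?case by (intro exI[of _ "P + Q"]) simp
next
  case (mult f g)
  then obtain P Q where "\<forall>s. f (\<lambda>v. a v + s * b v) = poly P s" "\<forall>s. g (\<lambda>v. a v + s * b v) = poly Q s" by blast
  then show ?case by (intro exI[of _ "P * Q"]) simp
qed

lemma poly_common_nonroot:
  fixes P Q :: "'a::field poly"
  assumes "infinite (UNIV :: 'a set)" "P \<noteq> 0" "Q \<noteq> 0"
  shows "\<exists>s. poly P s \<noteq> 0 \<and> poly Q s \<noteq> 0"
proof (rule ccontr)
  assume "\<not> ?thesis"
  then have "UNIV \<subseteq> {s. poly (P * Q) s = 0}" by auto
  moreover have "finite {s. poly (P * Q) s = 0}" using assms by (intro poly_roots_finite) simp
  ultimately show False using assms(1) finite_subset by blast
qed

definition supported :: "'v set \<Rightarrow> ('v \<Rightarrow> 'a::zero) set" where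
  "supported S = {y. \<forall>v. v \<notin> S \<longrightarrow> y v = 0}"

lemma supported_mono: "y \<in> supported S \<Longrightarrow> S \<subseteq> T \<Longrightarrow> y \<in> supported T"
  by (auto simp: supported_def)

lemma zero_supported: "(\<lambda>_. 0) \<in> supported S"
  by (simp add: supported_def)

text \<open>Irreducibility of a coordinate subspace: on the line joining the two points both
  functions restrict to nonzero polynomials in one variable, which have a common nonroot.\<close>

lemma polyfun_supported_common:
  fixes f g :: "('v \<Rightarrow> 'a::field) \<Rightarrow> 'a"
  assumes inf: "infinite (UNIV :: 'a set)" and f: "f \<in> polyfun X" and g: "g \<in> polyfun X"
    and y: "y1 \<in> supported S" "f y1 \<noteq> 0" "y2 \<in> supported S" "g y2 \<noteq> 0"
  shows "\<exists>y\<in>supported S. f y \<noteq> 0 \<and> g y \<noteq> 0"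
proof -
  let ?l = "\<lambda>s v. y1 v + s * (y2 v - y1 v)"
  obtain P Q where P: "\<And>s. f (?l s) = poly P s" and Q: "\<And>s. g (?l s) = poly Q s"
    using polyfun_line[OF f, of y1 "\<lambda>v. y2 v - y1 v"] polyfun_line[OF g, of y1 "\<lambda>v. y2 v - y1 v"] by blast
  have "P \<noteq> 0" using P[of 0] y by auto
  moreover have "Q \<noteq> 0" using Q[of 1] y by auto
  ultimately obtain s where "poly P s \<noteq> 0" "poly Q s \<noteq> 0" using poly_common_nonroot[OF inf] by blast
  then show ?thesis using P Q y by (intro bexI[of _ "?l s"]) (auto simp: supported_def)
qed

lemma polyfun_compose:
  assumes "\<And>v. v \<in> X \<Longrightarrow> (\<lambda>y. \<phi> y v) \<in> polyfun Y" "f \<in> polyfun X"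
  shows "(\<lambda>y. f (\<phi> y)) \<in> polyfun Y"
  using assms(2) by (induction rule: polyfun.induct) (auto intro: polyfun.intros assms(1))

context variety_point
begin

text \<open>A function \<open>u\<close> with \<open>u z \<noteq> 0\<close> is nonzero at all but
  finitely many points of a line through \<open>z\<close>, so it cannot annihilate a function
  without zeros on the punctured line.\<close>

lemma not_vanishing_line:
  assumes inf: "infinite (UNIV :: 'a set)" and f: "f \<in> Pf"
    and line: "\<And>s. (\<lambda>v. z v + s * b v) \<in> Z" "\<And>s. s \<noteq> 0 \<Longrightarrow> f (\<lambda>v. z v + s * b v) \<noteq> 0"
  shows "f \<notin> vanishing"
proof
  assume "f \<in> vanishing"
  then obtain u where u: "u \<in> Pf" "u z \<noteq> 0" "\<And>q. q \<in> Z \<Longrightarrow> u q * f q = 0" by (auto simp: vanishing_def)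
  obtain P where P: "\<And>s. u (\<lambda>v. z v + s * b v) = poly P s" using polyfun_line[OF u(1), of z b] by blast
  have "P \<noteq> 0" using P[of 0] u by auto
  moreover have "[:0, 1:] \<noteq> (0 :: 'a poly)" by simp
  ultimately obtain s where "poly P s \<noteq> 0" "poly [:0, 1:] s \<noteq> 0" using poly_common_nonroot[OF inf] by blast
  then show False using u(3)[OF line(1)[of s]] line(2)[of s] P[of s] by auto
qed

lemma not_loc_is_domain:
  assumes f: "f \<in> Pf" "f \<notin> vanishing" and g: "g \<in> Pf" "g \<notin> vanishing"
    and fg: "\<And>q. q \<in> Z \<Longrightarrow> f q * g q = 0"
  shows "\<not> loc_is_domain Pf Z z"
proof
  assume dom: "loc_is_domain Pf Z z"
  have carrier: "(h, \<lambda>_. 1) \<in> loc_carrier Pf z" if "h \<in> Pf" for h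
    using that by (auto simp: loc_carrier_def intro: polyfun.const)
  have zero: "loc_eq Pf Z z (h, \<lambda>_. 1) loc_zero \<longleftrightarrow> h \<in> vanishing" if "h \<in> Pf" for h
    using that by (auto simp: loc_eq_def loc_zero_def vanishing_def)
  have "loc_mul (f, \<lambda>_. 1) (g, \<lambda>_. 1) = (f * g, \<lambda>_. 1)" by (simp add: loc_mul_def fun_eq_iff)
  moreover have "f * g \<in> vanishing" using fg f g by (intro vanishingI[of _ 1]) (auto intro: A_rules)
  ultimately have "loc_eq Pf Z z (loc_mul (f, \<lambda>_. 1) (g, \<lambda>_. 1)) loc_zero"
    using zero[of "f * g"] A_rules(4)[OF f(1) g(1)] by simp
  then show False using dom carrier[OF f(1)] carrier[OF g(1)] zero f g unfolding loc_is_domain_def by blast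
qed

text \<open>The primes consist of the fractions vanishing on the images of shrinking coordinate
  subspaces. Primality is irreducibility of the subspace; strictness is detected by one coordinate
  that is constant on one image but not on the previous one.\<close>

lemma loc_dim_ge_chain:
  fixes \<phi> :: "('v \<Rightarrow> 'a) \<Rightarrow> 'v \<Rightarrow> 'a"
  assumes inf: "infinite (UNIV :: 'a set)"
    and poly: "\<And>v. v \<in> X \<Longrightarrow> (\<lambda>y. \<phi> y v) \<in> polyfun V"
    and Z: "\<And>y. y \<in> supported (set ys) \<Longrightarrow> \<phi> y \<in> Z" and z: "\<phi> (\<lambda>_. 0) = z"
    and visible: "\<And>i. i < length ys \<Longrightarrow> \<exists>v\<in>X. (\<forall>y\<in>supported (set (drop (Suc i) ys)). \<phi> y v = z v) \<and>
        (\<exists>y\<in>supported (set (drop i ys)). \<phi> y v \<noteq> z v)"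
  shows "enat (length ys) \<le> loc_dim Pf Z z"
proof -
  define H where "H i = (supported (set (drop i ys)) :: ('v \<Rightarrow> 'a) set)" for i
  define Q where "Q i = {x \<in> loc_carrier Pf z. \<forall>y\<in>H i. fst x (\<phi> y) = 0}" for i
  have comp: "(\<lambda>y. f (\<phi> y)) \<in> polyfun V" if "f \<in> Pf" for f
    using polyfun_compose[OF poly that] .
  have V0: "(\<lambda>_. 0) \<in> H i" for i by (simp add: H_def zero_supported)
  have VZ: "\<phi> y \<in> Z" if "y \<in> H i" for y i
    using Z[OF supported_mono[OF _ set_drop_subset]] that by (simp add: H_def)
  have int: "(\<forall>y\<in>H i. f (\<phi> y) = 0) \<or> (\<forall>y\<in>H i. g (\<phi> y) = 0)"
    if h: "f \<in> Pf" "g \<in> Pf" "\<And>y. y \<in> H i \<Longrightarrow> f (\<phi> y) * g (\<phi> y) = 0" for f g i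
    using polyfun_supported_common[OF inf comp[OF h(1)] comp[OF h(2)], of _ "set (drop i ys)"] h(3)
    unfolding H_def by (metis mult_eq_0_iff)
  have prime: "loc_prime_ideal Pf Z z (Q i)" for i
    unfolding loc_prime_ideal_def
  proof (intro conjI ballI impI)
    show "Q i \<subseteq> loc_carrier Pf z" by (auto simp: Q_def)
    show "loc_zero \<in> Q i" by (auto simp: Q_def loc_zero_def loc_carrier_def intro: polyfun.const)
    show "loc_one \<notin> Q i" using V0 by (auto simp: Q_def loc_one_def)
  next
    fix x y assume xQ: "x \<in> Q i" and yc: "y \<in> loc_carrier Pf z" and "loc_eq Pf Z z x y"
    then obtain u where u: "u \<in> Pf" "u z \<noteq> 0" "\<And>q. q \<in> Z \<Longrightarrow> u q * (fst x q * snd y q - fst y q * snd x q) = 0"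
      by (auto simp: loc_eq_def)
    have x: "snd x \<in> Pf" "snd x z \<noteq> 0" "\<And>p. p \<in> H i \<Longrightarrow> fst x (\<phi> p) = 0" using xQ by (auto simp: Q_def loc_carrier_def)
    have y: "fst y \<in> Pf" using yc by (auto simp: loc_carrier_def)
    have "u * snd x \<in> Pf" using u x A_rules by blast
    moreover have "(u * snd x) (\<phi> p) * fst y (\<phi> p) = 0" if "p \<in> H i" for p
      using u(3)[OF VZ[OF that]] x(3)[OF that] by auto
    ultimately have "(\<forall>p\<in>H i. (u * snd x) (\<phi> p) = 0) \<or> (\<forall>p\<in>H i. fst y (\<phi> p) = 0)" using int y by blast
    moreover have "(u * snd x) (\<phi> (\<lambda>_. 0)) \<noteq> 0" using u x z by simp
    ultimately show "y \<in> Q i" using V0 yc by (auto simp: Q_def)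
  next
    fix x y assume "x \<in> Q i" "y \<in> Q i"
    then show "loc_add x y \<in> Q i" by (auto simp: Q_def loc_add_def loc_carrier_def intro!: polyfun.intros)
  next
    fix x assume "x \<in> Q i"
    moreover have "(\<lambda>q. - f q) \<in> Pf" if "f \<in> Pf" for f using polyfun.mult[OF polyfun.const[of "- 1"] that] by simp
    ultimately show "loc_neg x \<in> Q i" by (auto simp: Q_def loc_neg_def loc_carrier_def)
  next
    fix x y assume "x \<in> Q i" "y \<in> loc_carrier Pf z"
    then show "loc_mul y x \<in> Q i" by (auto simp: Q_def loc_mul_def loc_carrier_def intro!: polyfun.intros)
  next
    fix x y assume xy: "x \<in> loc_carrier Pf z" "y \<in> loc_carrier Pf z" "loc_mul x y \<in> Q i"
    then have "(\<forall>p\<in>H i. fst x (\<phi> p) = 0) \<or> (\<forall>p\<in>H i. fst y (\<phi> p) = 0)"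
      by (intro int) (auto simp: Q_def loc_mul_def loc_carrier_def)
    then show "x \<in> Q i \<or> y \<in> Q i" using xy by (auto simp: Q_def)
  qed
  have strict: "Q i \<subset> Q (Suc i)" if i: "i < length ys" for i
  proof -
    have sub: "set (drop (Suc i) ys) \<subseteq> set (drop i ys)" by (rule set_drop_subset_set_drop) simp
    then have "H (Suc i) \<subseteq> H i" unfolding H_def using supported_mono by blast
    then have "Q i \<subseteq> Q (Suc i)" by (auto simp: Q_def)
    moreover obtain v y where v: "v \<in> X" "\<And>y. y \<in> H (Suc i) \<Longrightarrow> \<phi> y v = z v" "y \<in> H i" "\<phi> y v \<noteq> z v"
      using visible[OF i] unfolding H_def by blast
    let ?x = "(\<lambda>p. p v + - z v, \<lambda>_. 1)"
    have "?x \<in> loc_carrier Pf z"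
      using polyfun.add[OF polyfun.var[OF v(1)] polyfun.const[of "- z v"]]
      by (simp add: loc_carrier_def polyfun.const)
    then have "?x \<in> Q (Suc i)" "?x \<notin> Q i" using v by (auto simp: Q_def)
    ultimately show ?thesis by blast
  qed
  let ?qs = "map Q [0..<Suc (length ys)]"
  have "enat (length ?qs - 1) \<le> loc_dim Pf Z z"
    unfolding loc_dim_def
  proof (rule Sup_upper, intro CollectI exI[of _ ?qs] conjI)
    show "\<forall>Q\<in>set ?qs. loc_prime_ideal Pf Z z Q" using prime by auto
    show "\<forall>i. Suc i < length ?qs \<longrightarrow> ?qs ! i \<subset> ?qs ! Suc i" using strict by (auto simp del: upt_Suc)
  qed (auto simp del: upt_Suc)
  then show ?thesis by simp
qed

text \<open>The map has to be triangular only with respect to \<open>\<rho>\<close>. Variables are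
  dropped by increasing weight with arbitrary ties; hence \<open>invisible\<close> admits all others
  of equal weight, whereas \<open>visible\<close> relies on strictly heavier ones.\<close>

lemma loc_dim_ge:
  fixes \<rho> :: "'v \<Rightarrow> nat" and \<phi> :: "('v \<Rightarrow> 'a) \<Rightarrow> 'v \<Rightarrow> 'a"
  assumes inf: "infinite (UNIV :: 'a set)" and fin: "finite Y" and YX: "Y \<subseteq> X"
    and poly: "\<And>v. v \<in> X \<Longrightarrow> (\<lambda>y. \<phi> y v) \<in> polyfun V"
    and Z: "\<And>y. y \<in> supported Y \<Longrightarrow> \<phi> y \<in> Z" and z: "\<phi> (\<lambda>_. 0) = z"
    and invisible: "\<And>v y. v \<in> Y \<Longrightarrow> y \<in> supported {w\<in>Y. \<rho> v \<le> \<rho> w \<and> w \<noteq> v} \<Longrightarrow> \<phi> y v = z v"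
    and visible: "\<And>v. v \<in> Y \<Longrightarrow> \<exists>y\<in>supported {w\<in>Y. \<rho> v < \<rho> w \<or> w = v}. \<phi> y v \<noteq> z v"
  shows "enat (card Y) \<le> loc_dim Pf Z z"
proof -
  obtain xs where xs: "set xs = Y" "distinct xs" using finite_distinct_list[OF fin] by blast
  define ys where "ys = sort_key \<rho> xs"
  have ys: "set ys = Y" "distinct ys" "sorted (map \<rho> ys)" using xs by (auto simp: ys_def)
  have "enat (length ys) \<le> loc_dim Pf Z z"
  proof (rule loc_dim_ge_chain[OF inf])
    show "\<And>v. v \<in> X \<Longrightarrow> (\<lambda>y. \<phi> y v) \<in> polyfun V" by (rule poly)
    show "\<And>y. y \<in> supported (set ys) \<Longrightarrow> \<phi> y \<in> Z" using Z ys by simp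
    fix i assume i: "i < length ys"
    let ?v = "ys ! i"
    have v: "?v \<in> Y" using i ys by (metis nth_mem)
    have "set (drop (Suc i) ys) \<subseteq> {w\<in>Y. \<rho> ?v \<le> \<rho> w \<and> w \<noteq> ?v}"
    proof
      fix w assume "w \<in> set (drop (Suc i) ys)"
      then obtain j where j: "w = ys ! j" "i < j" "j < length ys"
        by (metis Suc_le_lessD add.commute in_set_conv_nth le_add2 length_drop less_diff_conv nth_drop less_imp_le_nat Suc_leI i)
      then have "\<rho> ?v \<le> \<rho> w" using sorted_nth_mono[OF ys(3), of i j] by simp
      then show "w \<in> {w\<in>Y. \<rho> ?v \<le> \<rho> w \<and> w \<noteq> ?v}"
        using j ys nth_eq_iff_index_eq[OF ys(2), of i j] i by auto
    qed
    then have "\<forall>y\<in>supported (set (drop (Suc i) ys)). \<phi> y ?v = z ?v"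
      using invisible[OF v] supported_mono by blast
    moreover have "{w\<in>Y. \<rho> ?v < \<rho> w \<or> w = ?v} \<subseteq> set (drop i ys)"
    proof
      fix w assume w: "w \<in> {w\<in>Y. \<rho> ?v < \<rho> w \<or> w = ?v}"
      then obtain j where j: "w = ys ! j" "j < length ys" using ys by (metis (no_types, lifting) in_set_conv_nth mem_Collect_eq)
      have "i \<le> j"
      proof (rule ccontr)
        assume "\<not> i \<le> j"
        then have "\<rho> w \<le> \<rho> ?v" "w \<noteq> ?v"
          using sorted_nth_mono[OF ys(3), of j i] j i nth_eq_iff_index_eq[OF ys(2), of i j] by auto
        then show False using w by auto
      qed
      then have "w = drop i ys ! (j - i)" "j - i < length (drop i ys)" using j by auto
      then show "w \<in> set (drop i ys)" by (metis nth_mem)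
    qed
    then have "\<exists>y\<in>supported (set (drop i ys)). \<phi> y ?v \<noteq> z ?v"
      using visible[OF v] supported_mono by blast
    ultimately show "\<exists>v\<in>X. (\<forall>y\<in>supported (set (drop (Suc i) ys)). \<phi> y v = z v) \<and>
        (\<exists>y\<in>supported (set (drop i ys)). \<phi> y v \<noteq> z v)" using v YX by blast
  qed (rule z)
  then show ?thesis using distinct_card[OF ys(2)] ys(1) by simp
qed

end

section \<open>Determinantal identities and divisibility of minors\<close>

text \<open>The minor with rows \<open>f 0, \<dots>, f (s - 1)\<close> and columns \<open>g 0, \<dots>, g (s - 1)\<close>, in this order and
  possibly with repetitions.\<close>
definition minor :: "(nat \<Rightarrow> nat \<Rightarrow> 'a::comm_ring_1) \<Rightarrow> nat \<Rightarrow> (nat \<Rightarrow> nat) \<Rightarrow> (nat \<Rightarrow> nat) \<Rightarrow> 'a" where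
  "minor X s f g = det (mat s s (\<lambda>(a, b). X (f a) (g b)))"

lemma minor_cong:
  assumes "\<And>a b. a < s \<Longrightarrow> b < s \<Longrightarrow> X (f a) (g b) = Y (f' a) (g' b)"
  shows "minor X s f g = minor Y s f' g'"
  unfolding minor_def by (rule arg_cong[of _ _ det]) (rule eq_matI, use assms in auto)

lemma minor_swap: "minor X s f g = minor (\<lambda>i j. X j i) s g f"
proof -
  have "transpose_mat (mat s s (\<lambda>(a, b). X (f a) (g b))) = mat s s (\<lambda>(a, b). X (f b) (g a))"
    by (rule eq_matI) auto
  then show ?thesis unfolding minor_def
    using det_transpose[of "mat s s (\<lambda>(a, b). X (f a) (g b))" s] by simp
qed

lemma minor_repeated_row:
  assumes "\<not> inj_on f {..<s}"
  shows "minor X s f g = 0"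
proof -
  obtain a b where ab: "a < s" "b < s" "a \<noteq> b" "f a = f b" using assms by (auto simp: inj_on_def)
  show ?thesis unfolding minor_def
    by (rule det_identical_rows[of _ s a b]) (use ab in \<open>auto intro!: eq_vecI\<close>)
qed

text \<open>Reordering multiplies the minor by a sign, which divisibility ignores.\<close>

lemma dvd_minor_row_order:
  fixes X :: "nat \<Rightarrow> nat \<Rightarrow> 'a::comm_ring_1"
  assumes f: "inj_on f {..<s}" "inj_on f' {..<s}" and im: "f ` {..<s} = f' ` {..<s}"
    and D: "D dvd minor X s f' g"
  shows "D dvd minor X s f g"
proof -
  define p where "p a = (if a < s then the_inv_into {..<s} f' (f a) else a)" for a
  have bij: "bij_betw (the_inv_into {..<s} f' \<circ> f) {..<s} {..<s}"
    by (rule bij_betw_trans[of f _ "f' ` {..<s}"])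
      (use f im in \<open>auto intro: bij_betw_the_inv_into simp: bij_betw_def inj_on_the_inv_into the_inv_into_onto\<close>)
  have "bij_betw p {..<s} {..<s}"
    using bij by (rule bij_betw_cong[THEN iffD1, rotated]) (auto simp: p_def)
  then have p: "p permutes {0..<s}"
    by (intro bij_imp_permutes) (auto simp: p_def lessThan_atLeast0)
  have f'p: "f' (p a) = f a" if "a < s" for a
    using that im f(2) by (auto simp: p_def intro!: f_the_inv_into_f)
  have ps: "p a < s" if "a < s" for a using permutes_in_image[OF p, of a] that by simp
  let ?A = "mat s s (\<lambda>(a, b). X (f' a) (g b))"
  have "mat s s (\<lambda>(a, b). X (f a) (g b)) = mat s s (\<lambda>(i, j). ?A $$ (p i, j))"
    by (rule eq_matI) (use f'p ps in auto)
  then have "minor X s f g = signof p * minor X s f' g"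
    unfolding minor_def using det_permute_rows[of ?A s p, OF _ p] by simp
  then show ?thesis using D by simp
qed

lemma dvd_minor_order:
  fixes X :: "nat \<Rightarrow> nat \<Rightarrow> 'a::comm_ring_1"
  assumes "inj_on f {..<s}" "inj_on f' {..<s}" "f ` {..<s} = f' ` {..<s}"
    and "inj_on g {..<s}" "inj_on g' {..<s}" "g ` {..<s} = g' ` {..<s}" and D: "D dvd minor X s f' g'"
  shows "D dvd minor X s f g"
proof -
  have "D dvd minor X s f g'" by (rule dvd_minor_row_order[OF assms(1-3) D])
  then have "D dvd minor (\<lambda>i j. X j i) s g' f" by (simp only: minor_swap[of X s f])
  from dvd_minor_row_order[OF assms(4-6) this] show ?thesis by (simp only: minor_swap[of X s f])
qed

lemma prod_dvd_diff:
  fixes D :: "'a::comm_ring_1"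
  assumes "\<And>i. i \<in> S \<Longrightarrow> D dvd f i - g i"
  shows "D dvd prod f S - prod g S"
  using assms
proof (induction S rule: infinite_finite_induct)
  case (insert x S)
  have "prod f (insert x S) - prod g (insert x S) = (f x - g x) * prod f S + g x * (prod f S - prod g S)"
    using insert by (simp add: algebra_simps)
  then show ?case using insert by simp
qed auto

lemma minor_dvd_diff:
  fixes X Y :: "nat \<Rightarrow> nat \<Rightarrow> 'a::comm_ring_1"
  assumes "\<And>a b. a < s \<Longrightarrow> b < s \<Longrightarrow> D dvd X (f a) (g b) - Y (f a) (g b)"
  shows "D dvd minor X s f g - minor Y s f g"
proof -
  have 1: "minor Z s f g = (\<Sum>p | p permutes {0..<s}. signof p * (\<Prod>i=0..<s. Z (f i) (g (p i))))" for Z :: "nat \<Rightarrow> nat \<Rightarrow> 'a"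
  proof -
    have "(\<Prod>i=0..<s. mat s s (\<lambda>(a, b). Z (f a) (g b)) $$ (i, p i)) = (\<Prod>i=0..<s. Z (f i) (g (p i)))"
      if "p permutes {0..<s}" for p
      by (rule prod.cong) (use permutes_in_image[OF that] in auto)
    then show ?thesis unfolding minor_def by (subst det_def'[of _ s]) auto
  qed
  show ?thesis unfolding 1 sum_subtractf[symmetric] right_diff_distrib[symmetric]
  proof (intro dvd_sum dvd_mult prod_dvd_diff)
    fix p i assume "p \<in> {p. p permutes {0..<s}}" "i \<in> {0..<s}"
    then show "D dvd X (f i) (g (p i)) - Y (f i) (g (p i))"
      using permutes_in_image[of p "{0..<s}" i] by (intro assms) auto
  qed
qed

lemma minor_delete:
  assumes "i < Suc s" "j < Suc s"
  shows "det (mat_delete (mat (Suc s) (Suc s) (\<lambda>(a, b). H a b)) i j)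
       = minor H s (insert_index i) (insert_index j)"
  unfolding minor_def mat_delete_def
  by (rule arg_cong[of _ _ det]) (rule eq_matI, auto simp: insert_index_def)

lemma minor_compose: "minor (\<lambda>a b. X (f a) (g b)) s p q = minor X s (f \<circ> p) (g \<circ> q)"
  by (simp add: minor_def)

lemma minor_laplace_row:
  fixes H :: "nat \<Rightarrow> nat \<Rightarrow> 'a::comm_ring_1"
  assumes "i < Suc s"
  shows "minor H (Suc s) id id =
    (\<Sum>j<Suc s. H i j * minor H s (insert_index i) (insert_index j) * (-1) ^ (i + j))"
proof -
  let ?A = "mat (Suc s) (Suc s) (\<lambda>(a, b). H a b)"
  have "minor H (Suc s) id id = det ?A" by (simp add: minor_def)
  also have "\<dots> = (\<Sum>j<Suc s. ?A $$ (i, j) * cofactor ?A i j)"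
    by (rule laplace_expansion_row) (use assms in auto)
  also have "\<dots> = (\<Sum>j<Suc s. H i j * minor H s (insert_index i) (insert_index j) * (-1) ^ (i + j))"
    using assms by (intro sum.cong) (auto simp: cofactor_def minor_delete mult_ac)
  finally show ?thesis .
qed

lemma dvd_det_laplace_row:
  fixes H :: "nat \<Rightarrow> nat \<Rightarrow> 'a::comm_ring_1"
  assumes "i < Suc s" "\<And>j. j < Suc s \<Longrightarrow> D dvd H i j * minor H s (insert_index i) (insert_index j)"
  shows "D dvd minor H (Suc s) id id"
  unfolding minor_laplace_row[OF assms(1)] using assms by (intro dvd_sum dvd_mult2[of D "_ * _"]) auto

lemma minor_1: "minor X 1 f g = X (f 0) (g 0)"
  unfolding minor_def by (subst det_single) auto

lemma minor_2:
  "minor X 2 f g = X (f 0) (g 0) * X (f 1) (g 1) - X (f 0) (g 1) * X (f 1) (g 0)"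
proof -
  have "minor X 2 f g = minor (\<lambda>a b. X (f a) (g b)) (Suc 1) id id"
    by (simp add: minor_compose numeral_2_eq_2)
  also have "\<dots> = X (f 0) (g 0) * X (f 1) (g 1) - X (f 0) (g 1) * X (f 1) (g 0)"
    by (subst minor_laplace_row[of 0]) (auto simp: minor_1[unfolded One_nat_def] insert_index_def)
  finally show ?thesis .
qed

text \<open>Isolates the corner position, so that divisibility of a minor becomes a linear equation
  for the entry there.\<close>

lemma minor_corner:
  fixes X :: "nat \<Rightarrow> nat \<Rightarrow> 'a::comm_ring_1"
  shows "minor X (Suc s) f g = X (f s) (g s) * minor X s f g +
    minor (\<lambda>a b. if a = s \<and> b = s then 0 else X (f a) (g b)) (Suc s) id id"
proof -
  let ?H = "\<lambda>a b. X (f a) (g b)" and ?H' = "\<lambda>a b. if a = s \<and> b = s then 0 else X (f a) (g b)"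
  have cof: "minor ?H' s (insert_index s) (insert_index j) = minor ?H s (insert_index s) (insert_index j)" for j
    by (rule minor_cong) (auto simp: insert_index_def)
  have last: "minor ?H s (insert_index s) (insert_index s) = minor X s f g"
    by (rule minor_cong) (auto simp: insert_index_def)
  have sgn: "(- 1) ^ (s + s) = (1 :: 'a)" by simp
  have "minor X (Suc s) f g = minor ?H (Suc s) id id" by (simp add: minor_compose)
  also have "\<dots> = X (f s) (g s) * minor X s f g +
      (\<Sum>j<s. ?H s j * minor ?H s (insert_index s) (insert_index j) * (- 1) ^ (s + j))"
    unfolding minor_laplace_row[of s s ?H, OF lessI] sum.lessThan_Suc last sgn by simp
  also have "(\<Sum>j<s. ?H s j * minor ?H s (insert_index s) (insert_index j) * (- 1) ^ (s + j)) = minor ?H' (Suc s) id id"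
    unfolding minor_laplace_row[of s s ?H', OF lessI] sum.lessThan_Suc cof by simp
  finally show ?thesis .
qed

lemma minor_diagonal:
  assumes "\<And>a b. a < s \<Longrightarrow> b < s \<Longrightarrow> a \<noteq> b \<Longrightarrow> X (f a) (g b) = 0"
  shows "minor X s f g = (\<Prod>a<s. X (f a) (g a))"
proof -
  have "minor X s f g = prod_list (diag_mat (mat s s (\<lambda>(a, b). X (f a) (g b))))"
    unfolding minor_def by (rule det_upper_triangular[of _ s]) (use assms in auto)
  also have "diag_mat (mat s s (\<lambda>(a, b). X (f a) (g b))) = map (\<lambda>a. X (f a) (g a)) [0..<s]"
    by (auto simp: diag_mat_def intro!: map_cong)
  also have "prod_list \<dots> = (\<Prod>a<s. X (f a) (g a))"
    by (simp add: prod.distinct_set_conv_list[symmetric] lessThan_atLeast0)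
  finally show ?thesis .
qed

lemma dvd_minor_Suc:
  fixes X :: "nat \<Rightarrow> nat \<Rightarrow> 'a::comm_ring_1"
  assumes "\<And>f g. D dvd minor X s f g"
  shows "D dvd minor X (Suc s) f g"
proof -
  have "D dvd minor (\<lambda>a b. X (f a) (g b)) (Suc s) id id"
    by (rule dvd_det_laplace_row[of 0]) (auto simp: minor_compose assms)
  then show ?thesis by (simp add: minor_compose)
qed

text \<open>Bordering by a row and a column gives \<open>E = (1, -b; a, T)\<close> with the same
  determinant as the updated matrix. Expanding along the top row, and then along the column of
  \<open>a\<close>, leaves only minors of \<open>T\<close> of size \<open>s\<close> or
  \<open>s + 1\<close>.\<close>

lemma dvd_minor_rank_one_update:
  fixes T :: "nat \<Rightarrow> nat \<Rightarrow> 'a::idom"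
  assumes D: "\<And>f g. D dvd minor T s f g"
  shows "D dvd minor (\<lambda>i j. T i j + a i * b j) (Suc s) f g"
proof -
  let ?N = "Suc s"
  define E where "E i j = (case i of 0 \<Rightarrow> (case j of 0 \<Rightarrow> 1 | Suc j \<Rightarrow> - b (g j))
     | Suc i \<Rightarrow> (case j of 0 \<Rightarrow> a (f i) | Suc j \<Rightarrow> T (f i) (g j)))" for i j
  let ?E = "four_block_mat (1\<^sub>m 1) (mat 1 ?N (\<lambda>(i, j). - b (g j))) (mat ?N 1 (\<lambda>(i, j). a (f i)))
    (mat ?N ?N (\<lambda>(i, j). T (f i) (g j)))"
  \<comment> \<open>Column operations that clear the top row of \<open>?E\<close> and turn
    \<open>T\<close> into the updated matrix.\<close>
  let ?F = "four_block_mat (1\<^sub>m 1) (mat 1 ?N (\<lambda>(i, j). b (g j))) (0\<^sub>m ?N 1) (1\<^sub>m ?N)"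
  let ?G = "four_block_mat (1\<^sub>m 1) (0\<^sub>m 1 ?N) (mat ?N 1 (\<lambda>(i, j). a (f i)))
    (mat ?N ?N (\<lambda>(i, j). T (f i) (g j) + a (f i) * b (g j)))"
  have "?E * ?F = ?G"
    by (subst mult_four_block_mat[of _ 1 1 _ ?N _ ?N _ _ 1 _ ?N])
      (auto intro!: arg_cong2[of _ _ _ _ "four_block_mat _"] eq_matI cong_four_block_mat
        simp: scalar_prod_def)
  moreover have "det ?F = 1" by (subst det_four_block_mat_lower_left_zero[of _ 1 _ ?N]) auto
  moreover have "det ?G = minor (\<lambda>i j. T i j + a i * b j) ?N f g"
    by (subst det_four_block_mat_upper_right_zero[of _ 1 _ ?N]) (auto simp: minor_def)
  moreover have "det (?E * ?F) = det ?E * det ?F" by (rule det_mult[of _ "1 + ?N"]) auto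
  moreover have "?E = mat (Suc ?N) (Suc ?N) (\<lambda>(i, j). E i j)"
    by (rule eq_matI) (auto simp: E_def split: nat.split)
  ultimately have eq: "minor (\<lambda>i j. T i j + a i * b j) ?N f g = minor E (Suc ?N) id id"
    by (simp add: minor_def)
  \<comment> \<open>Here the top row is deleted while column 0, the column of \<open>a\<close>, is
    kept; expansion along it leaves \<open>s\<close>-minors of \<open>T\<close>.\<close>
  have E_minor: "D dvd minor E ?N (insert_index 0) q" if q: "q 0 = 0" "\<And>j. 0 < j \<Longrightarrow> 0 < q j" for q
  proof -
    have "D dvd minor (\<lambda>i j. E (Suc i) (q j)) ?N id id"
    proof (subst minor_swap, rule dvd_det_laplace_row[of 0])
      fix j assume "j < Suc s"
      have "minor (\<lambda>i j. E (Suc j) (q i)) s (insert_index 0) (insert_index j) =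
          minor T s (f \<circ> insert_index j) (\<lambda>b. g (q (Suc b) - 1))"
      proof (subst minor_swap, rule minor_cong)
        fix x y
        obtain y' where "q (Suc y) = Suc y'" using q(2)[of "Suc y"] by (cases "q (Suc y)") auto
        then show "E (Suc (insert_index j x)) (q (insert_index 0 y)) =
           T ((f \<circ> insert_index j) x) (g (q (Suc y) - 1))" by (simp add: E_def insert_index_def)
      qed
      then show "D dvd E (Suc j) (q 0) * minor (\<lambda>i j. E (Suc j) (q i)) s (insert_index 0) (insert_index j)"
        using D by simp
    qed simp
    moreover have "minor E ?N (insert_index 0) q = minor (\<lambda>i j. E (Suc i) (q j)) ?N id id"
      by (rule minor_cong) (simp add: insert_index_def)
    ultimately show ?thesis by simp
  qed
  have "D dvd minor E (Suc ?N) id id"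
  proof (rule dvd_det_laplace_row[of 0])
    fix j assume j: "j < Suc ?N"
    have "D dvd minor E ?N (insert_index 0) (insert_index j)"
    proof (cases j)
      case 0
      have "minor E ?N (insert_index 0) (insert_index 0) = minor T ?N f g"
        by (rule minor_cong) (auto simp: insert_index_def E_def)
      then show ?thesis using dvd_minor_Suc[OF D] 0 by simp
    next
      case (Suc j')
      then show ?thesis by (intro E_minor) (auto simp: insert_index_def)
    qed
    then show "D dvd E 0 j * minor E ?N (insert_index 0) (insert_index j)" by simp
  qed simp
  then show ?thesis by (simp add: eq)
qed

text \<open>Used with \<open>s = 2\<close> and \<open>c = r - 2\<close>, this reduces the equations
  for \<open>r\<close>-minors to divisibility of 2-minors of a residual matrix.\<close>

lemma dvd_minor_low_rank_update:
  fixes T :: "nat \<Rightarrow> nat \<Rightarrow> 'a::idom"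
  assumes "\<And>f g. D dvd minor T s f g"
  shows "D dvd minor (\<lambda>i j. T i j + (\<Sum>u<c. a i u * b u j)) (s + c) f g"
proof (induction c arbitrary: f g)
  case (Suc c)
  have "D dvd minor (\<lambda>i j. (T i j + (\<Sum>u<c. a i u * b u j)) + a i c * b c j) (Suc (s + c)) f g"
    by (rule dvd_minor_rank_one_update) (rule Suc)
  then show ?case by (simp add: add.assoc)
qed (simp add: assms)

text \<open>Multiplying the block matrix on the left by \<open>(adj D, 0; - R adj D, \<Delta> I)\<close> clears the lower left
  block.\<close>
lemma schur_complement:
  fixes X :: "nat \<Rightarrow> nat \<Rightarrow> 'a::idom"
  shows "\<exists>e. \<forall>s f g. (\<forall>a<c. f a = a \<and> g a = a) \<longrightarrow>
     minor X c id id ^ c * minor X c id id ^ s * minor X (c + s) f g =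
     minor X c id id * minor X c id id ^ c * det (mat s s (\<lambda>(i, j). e (f (c + i)) (g (c + j))))"
proof -
  define D where "D = mat c c (\<lambda>(i, j). X i j)"
  define \<Delta> where "\<Delta> = det D"
  have D: "D \<in> carrier_mat c c" by (simp add: D_def)
  note adj = adj_mat[OF D]
  \<comment> \<open>The Schur complement entry multiplied by \<open>\<Delta>\<close>. It does not
    depend on the selected rows and columns, so complements of different sizes share their
    entries.\<close>
  define e where "e i j = \<Delta> * X i j - (\<Sum>a=0..<c. (\<Sum>b=0..<c. X i b * adj_mat D $$ (b, a)) * X a j)" for i j
  have "\<Delta> ^ c * \<Delta> ^ s * minor X (c + s) f g = \<Delta> * \<Delta> ^ c * det (mat s s (\<lambda>(i, j). e (f (c + i)) (g (c + j))))"
    if fg: "\<forall>a<c. f a = a \<and> g a = a" for s f g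
  proof -
    define Q where "Q = mat c s (\<lambda>(i, j). X i (g (c + j)))"
    define R where "R = mat s c (\<lambda>(i, j). X (f (c + i)) j)"
    define S where "S = mat s s (\<lambda>(i, j). X (f (c + i)) (g (c + j)))"
    have c: "Q \<in> carrier_mat c s" "R \<in> carrier_mat s c" "S \<in> carrier_mat s s" by (auto simp: Q_def R_def S_def)
    let ?A = "four_block_mat D Q R S"
    let ?L = "four_block_mat (adj_mat D) (0\<^sub>m c s) (- (R * adj_mat D)) (\<Delta> \<cdot>\<^sub>m 1\<^sub>m s)"
    let ?E = "mat s s (\<lambda>(i, j). e (f (c + i)) (g (c + j)))"
    have A: "minor X (c + s) f g = det ?A" unfolding minor_def
      by (rule arg_cong[of _ _ det], rule eq_matI) (use fg in \<open>auto simp: D_def Q_def R_def S_def\<close>)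
    have cL: "- (R * adj_mat D) \<in> carrier_mat s c" using c adj by auto
    have "?L * ?A = four_block_mat (\<Delta> \<cdot>\<^sub>m 1\<^sub>m c) (adj_mat D * Q) (0\<^sub>m s c) ?E"
    proof (subst mult_four_block_mat[OF adj(1) zero_carrier_mat cL _ D c(1) c(2) c(3)])
      show "\<Delta> \<cdot>\<^sub>m 1\<^sub>m s \<in> carrier_mat s s" by simp
      have RD: "R * adj_mat D * D = \<Delta> \<cdot>\<^sub>m R"
      proof -
        have "R * adj_mat D * D = R * (adj_mat D * D)" by (rule assoc_mult_mat[OF c(2) adj(1) D])
        also have "\<dots> = \<Delta> \<cdot>\<^sub>m (R * 1\<^sub>m c)" unfolding adj(3) \<Delta>_def by (rule mult_smult_distrib[OF c(2) one_carrier_mat])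
        finally show ?thesis using c(2) by simp
      qed
      have sR: "\<Delta> \<cdot>\<^sub>m 1\<^sub>m s * R = \<Delta> \<cdot>\<^sub>m R" using c(2) by (simp add: mult_smult_assoc_mat[of "1\<^sub>m s" s s])
      have sS: "\<Delta> \<cdot>\<^sub>m 1\<^sub>m s * S = \<Delta> \<cdot>\<^sub>m S" using c(3) by (simp add: mult_smult_assoc_mat[of "1\<^sub>m s" s s])
      have n: "- (R * adj_mat D) * D = - (\<Delta> \<cdot>\<^sub>m R)"
        using RD uminus_mult_left_mat[of "R * adj_mat D" D] c adj D by auto
      have nQ: "- (R * adj_mat D) * Q = - (R * adj_mat D * Q)"
        using uminus_mult_left_mat[of "R * adj_mat D" Q] c adj by auto
      show "four_block_mat (adj_mat D * D + 0\<^sub>m c s * R) (adj_mat D * Q + 0\<^sub>m c s * S)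
          (- (R * adj_mat D) * D + \<Delta> \<cdot>\<^sub>m 1\<^sub>m s * R) (- (R * adj_mat D) * Q + \<Delta> \<cdot>\<^sub>m 1\<^sub>m s * S) =
        four_block_mat (\<Delta> \<cdot>\<^sub>m 1\<^sub>m c) (adj_mat D * Q) (0\<^sub>m s c) ?E"
      proof (rule cong_four_block_mat)
        show "adj_mat D * D + 0\<^sub>m c s * R = \<Delta> \<cdot>\<^sub>m 1\<^sub>m c" unfolding adj(3) \<Delta>_def using c by simp
        show "adj_mat D * Q + 0\<^sub>m c s * S = adj_mat D * Q" using c adj by simp
        show "- (R * adj_mat D) * D + \<Delta> \<cdot>\<^sub>m 1\<^sub>m s * R = 0\<^sub>m s c" unfolding n sR using c by (intro eq_matI) auto
        show "- (R * adj_mat D) * Q + \<Delta> \<cdot>\<^sub>m 1\<^sub>m s * S = ?E"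
          unfolding nQ sS
          by (rule eq_matI) (use c adj in \<open>auto simp: e_def scalar_prod_def Q_def R_def S_def\<close>)
      qed
    qed
    moreover have "det (four_block_mat (\<Delta> \<cdot>\<^sub>m 1\<^sub>m c) (adj_mat D * Q) (0\<^sub>m s c) ?E)
        = det (\<Delta> \<cdot>\<^sub>m 1\<^sub>m c) * det ?E"
      by (rule det_four_block_mat_lower_left_zero[of _ c _ s]) (use c adj in auto)
    ultimately have "det (?L * ?A) = \<Delta> ^ c * det ?E" by simp
    moreover have "det (?L * ?A) = det ?L * det ?A" by (rule det_mult[of _ "c + s"]) (use c adj D in auto)
    moreover have "det ?L = det (adj_mat D) * \<Delta> ^ s"
      using cL by (simp add: det_four_block_mat_upper_right_zero[OF adj(1) refl cL])
    moreover have "det (adj_mat D) * \<Delta> = \<Delta> ^ c"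
      using det_mult[OF adj(1) D] unfolding adj(3) \<Delta>_def by simp
    ultimately have h: "det (adj_mat D) * \<Delta> ^ s * det ?A = \<Delta> ^ c * det ?E" "\<Delta> ^ c = det (adj_mat D) * \<Delta>"
      by simp_all
    \<comment> \<open>The determinant of the adjugate is traded for \<open>\<Delta> ^ c\<close> by
      one more factor \<open>\<Delta>\<close>, without division.\<close>
    have "\<Delta> ^ c * \<Delta> ^ s * det ?A = \<Delta> * (det (adj_mat D) * \<Delta> ^ s * det ?A)"
      unfolding h(2) by (simp add: mult_ac)
    then show ?thesis unfolding A h(1) by (simp add: mult.assoc)
  qed
  moreover have "\<Delta> = minor X c id id" by (simp add: \<Delta>_def D_def minor_def)
  ultimately show ?thesis by (intro exI[of _ e]) simp
qed

text \<open>A polynomial with nonzero constant coefficient is a unit modulo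
  \<open>t^k\<close>.\<close>

lemma monom_dvd_cancel_unit:
  fixes d :: "'a::field poly"
  assumes d: "coeff d 0 \<noteq> 0" and dvd: "monom 1 k dvd d * y"
  shows "monom 1 k dvd y"
proof -
  have *: "\<forall>l<k. coeff (d * y) l = 0" using dvd by (simp add: monom_1_dvd_iff')
  have "l < k \<Longrightarrow> coeff y l = 0" for l
  proof (induction l rule: less_induct)
    case (less l)
    have "coeff (d * y) l = (\<Sum>i\<le>l. coeff d i * coeff y (l - i))" by (rule coeff_mult)
    also have "\<dots> = coeff d 0 * coeff y l + (\<Sum>i\<in>{1..l}. coeff d i * coeff y (l - i))"
      by (subst atMost_atLeast0, subst sum.atLeast_Suc_atMost) auto
    also have "(\<Sum>i\<in>{1..l}. coeff d i * coeff y (l - i)) = 0" using less by (intro sum.neutral) auto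
    finally show ?case using * less.prems d by simp
  qed
  then show ?thesis by (simp add: monom_1_dvd_iff')
qed

lemma monom_dvd_cancel_unit_power:
  fixes d :: "'a::field poly"
  assumes "coeff d 0 \<noteq> 0" "monom 1 k dvd d ^ n * y"
  shows "monom 1 k dvd y"
  using assms(2) by (induction n) (auto intro: monom_dvd_cancel_unit[OF assms(1)] simp: mult.assoc)

text \<open>Up to units, the entries of the Schur complement are the \<open>(c+1)\<close>-minors
  bordering the unit block, hence multiples of \<open>t^k\<close>. The full minor is, up to units,
  their 2 by 2 determinant.\<close>

lemma det_dvd_square_of_unit_minor_leading:
  fixes X :: "nat \<Rightarrow> nat \<Rightarrow> 'a::field poly"
  assumes unit: "coeff (minor X c id id) 0 \<noteq> 0"
    and dvd: "\<And>f g. f ` {..<Suc c} \<subseteq> {..<c + 2} \<Longrightarrow> g ` {..<Suc c} \<subseteq> {..<c + 2} \<Longrightarrow> monom 1 k dvd minor X (Suc c) f g"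
  shows "monom 1 (2 * k) dvd minor X (c + 2) id id"
proof -
  let ?d = "minor X c id id"
  obtain e where e: "\<And>s f g. (\<forall>a<c. f a = a \<and> g a = a) \<Longrightarrow>
     ?d ^ c * ?d ^ s * minor X (c + s) f g = ?d * ?d ^ c * det (mat s s (\<lambda>(i, j). e (f (c + i)) (g (c + j))))"
    using schur_complement[of c X] by blast
  have e1: "monom 1 k dvd e i j" if "i < c + 2" "j < c + 2" for i j
  proof -
    \<comment> \<open>The border index may repeat one of the first \<open>c\<close>; the assumption
      \<open>dvd\<close> covers such selections as well.\<close>
    let ?f = "\<lambda>i a. if a < c then a else i"
    have "?d ^ c * ?d ^ 1 * minor X (c + 1) (?f i) (?f j) =
        ?d * ?d ^ c * det (mat 1 1 (\<lambda>(i', j'). e (?f i (c + i')) (?f j (c + j'))))"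
      by (rule e) auto
    also have "det (mat 1 1 (\<lambda>(i', j'). e (?f i (c + i')) (?f j (c + j')))) = e i j"
      by (subst det_single) auto
    finally have eq: "?d ^ c * ?d ^ 1 * minor X (c + 1) (?f i) (?f j) = ?d ^ Suc c * e i j"
      by (simp only: power_Suc)
    have "monom 1 k dvd minor X (Suc c) (?f i) (?f j)" by (rule dvd) (use that in auto)
    then have "monom 1 k dvd ?d ^ c * ?d ^ 1 * minor X (c + 1) (?f i) (?f j)" by (intro dvd_mult) simp
    then have "monom 1 k dvd ?d ^ Suc c * e i j" unfolding eq .
    then show ?thesis by (rule monom_dvd_cancel_unit_power[OF unit])
  qed
  let ?E = "mat 2 2 (\<lambda>(i, j). e (c + i) (c + j))"
  have "?E = monom 1 k \<cdot>\<^sub>m mat 2 2 (\<lambda>(i, j). e (c + i) (c + j) div monom 1 k)"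
    by (rule eq_matI) (auto intro!: dvd_mult_div_cancel[symmetric] e1)
  then have "det ?E = monom 1 k ^ 2 * det (mat 2 2 (\<lambda>(i, j). e (c + i) (c + j) div monom 1 k))"
    by simp
  then have "monom 1 (2 * k) dvd det ?E" by (simp add: power2_eq_square mult_monom mult_2)
  moreover have "?d ^ (c + 2) * minor X (c + 2) id id = ?d * ?d ^ c * det ?E"
    using e[of id id 2] by (simp only: power_add id_apply simp_thms)
  ultimately have "monom 1 (2 * k) dvd ?d ^ (c + 2) * minor X (c + 2) id id" by (simp only: dvd_mult)
  then show ?thesis by (rule monom_dvd_cancel_unit_power[OF unit])
qed

lemma extend_to_bijection:
  fixes f :: "nat \<Rightarrow> nat"
  assumes "inj_on f {..<c}" "f ` {..<c} \<subseteq> S" "finite S" "card S = N"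
  shows "\<exists>F. bij_betw F {..<N} S \<and> (\<forall>a<c. F a = f a)"
proof -
  have "c \<le> N" using card_mono[OF assms(3,2)] card_image[OF assms(1)] assms(4) by simp
  have "card (S - f ` {..<c}) = N - c" using assms by (simp add: card_Diff_subset card_image)
  then obtain h where h: "bij_betw h {c..<N} (S - f ` {..<c})"
    using finite_same_card_bij[of "{c..<N}" "S - f ` {..<c}"] assms(3) by auto
  let ?F = "\<lambda>a. if a < c then f a else h a"
  have "bij_betw ?F {..<c} (f ` {..<c})" using assms(1) by (auto simp: bij_betw_def inj_on_def)
  moreover have "bij_betw ?F {c..<N} (S - f ` {..<c})" using h by (rule bij_betw_cong[THEN iffD1, rotated]) auto
  ultimately have "bij_betw ?F ({..<c} \<union> {c..<N}) (f ` {..<c} \<union> (S - f ` {..<c}))"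
    by (rule bij_betw_combine) auto
  moreover have "{..<c} \<union> {c..<N} = {..<N}" "f ` {..<c} \<union> (S - f ` {..<c}) = S"
    using \<open>c \<le> N\<close> assms(2) by auto
  ultimately show ?thesis by (intro exI[of _ ?F]) auto
qed

text \<open>Permuting rows and columns of the block moves the unit minor to the leading position and
  changes the full determinant only by a sign.\<close>

lemma det_dvd_square_of_unit_minor:
  fixes X :: "nat \<Rightarrow> nat \<Rightarrow> 'a::field poly"
  assumes unit: "coeff (minor X c f g) 0 \<noteq> 0"
    and f: "inj_on f {..<c}" "f ` {..<c} \<subseteq> {1..c + 2}" and g: "inj_on g {..<c}" "g ` {..<c} \<subseteq> {1..c + 2}"
    and dvd: "\<And>f g. f ` {..<Suc c} \<subseteq> {1..c + 2} \<Longrightarrow> g ` {..<Suc c} \<subseteq> {1..c + 2} \<Longrightarrow> monom 1 k dvd minor X (Suc c) f g"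
  shows "monom 1 (2 * k) dvd minor X (c + 2) Suc Suc"
proof -
  obtain F G where F: "bij_betw F {..<c + 2} {1..c + 2}" "\<And>a. a < c \<Longrightarrow> F a = f a"
    and G: "bij_betw G {..<c + 2} {1..c + 2}" "\<And>a. a < c \<Longrightarrow> G a = g a"
    using extend_to_bijection[OF f, of "c + 2"] extend_to_bijection[OF g, of "c + 2"] by auto
  let ?X = "\<lambda>i j. X (F i) (G j)"
  have "monom 1 (2 * k) dvd minor ?X (c + 2) id id"
  proof (rule det_dvd_square_of_unit_minor_leading)
    have "minor ?X c id id = minor X c f g" by (rule minor_cong) (simp add: F G)
    then show "coeff (minor ?X c id id) 0 \<noteq> 0" using unit by simp
    fix p q :: "nat \<Rightarrow> nat" assume pq: "p ` {..<Suc c} \<subseteq> {..<c + 2}" "q ` {..<Suc c} \<subseteq> {..<c + 2}"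
    then show "monom 1 k dvd minor ?X (Suc c) p q" unfolding minor_compose
      using F(1) G(1) by (intro dvd) (auto simp: bij_betw_def image_subset_iff)
  qed
  then have "monom 1 (2 * k) dvd minor X (c + 2) F G" by (simp add: minor_compose)
  moreover have "Suc ` {..<c + 2} = {1..c + 2}"
    by (simp only: lessThan_atLeast0 image_Suc_atLeastLessThan) auto
  ultimately show ?thesis using F(1) G(1) by (intro dvd_minor_order[of Suc _ F Suc G]) (auto simp: bij_betw_def)
qed

section \<open>Coefficients of minors as functions, and the equations of the variety\<close>

text \<open>Common ground of polynomial functions and of functions rational on a set: coefficients
  of minors are treated once for both.\<close>

definition function_algebra :: "(('v \<Rightarrow> 'a::comm_ring_1) \<Rightarrow> 'a) set \<Rightarrow> bool" where
  "function_algebra R \<longleftrightarrow> (\<forall>c. (\<lambda>p. c) \<in> R) \<and> (\<forall>f\<in>R. \<forall>g\<in>R. (\<lambda>p. f p + g p) \<in> R \<and> (\<lambda>p. f p * g p) \<in> R)"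

definition coeffs_in :: "(('v \<Rightarrow> 'a::comm_ring_1) \<Rightarrow> 'a) set \<Rightarrow> (('v \<Rightarrow> 'a) \<Rightarrow> 'a poly) set" where
  "coeffs_in R = {g. \<forall>l. (\<lambda>p. coeff (g p) l) \<in> R}"

lemma function_algebraD:
  assumes "function_algebra R"
  shows "(\<lambda>p. c) \<in> R" "f \<in> R \<Longrightarrow> g \<in> R \<Longrightarrow> (\<lambda>p. f p + g p) \<in> R" "f \<in> R \<Longrightarrow> g \<in> R \<Longrightarrow> (\<lambda>p. f p * g p) \<in> R"
  using assms by (auto simp: function_algebra_def)

lemma function_algebra_sum:
  assumes "function_algebra R" "\<And>i. i \<in> S \<Longrightarrow> f i \<in> R"
  shows "(\<lambda>p. \<Sum>i\<in>S. f i p) \<in> R"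
  using assms(2) by (induction S rule: infinite_finite_induct) (auto intro: function_algebraD[OF assms(1)])

lemma function_algebra_polyfun: "function_algebra (polyfun Y)"
  by (auto simp: function_algebra_def intro: polyfun.intros)

lemma function_algebra_rational_on: "function_algebra (rational_on Y W)"
  by (auto simp: function_algebra_def intro: rational_on_const rational_on_add rational_on_mult)

lemma coeffs_in_const: "function_algebra R \<Longrightarrow> (\<lambda>p. c) \<in> coeffs_in R"
  by (simp add: coeffs_in_def function_algebraD)

lemma coeffs_in_mult:
  assumes "function_algebra R" "g \<in> coeffs_in R" "h \<in> coeffs_in R"
  shows "(\<lambda>p. g p * h p) \<in> coeffs_in R"
  using assms by (auto simp: coeffs_in_def coeff_mult intro!: function_algebra_sum function_algebraD(3))

lemma coeffs_in_add:
  assumes "function_algebra R" "g \<in> coeffs_in R" "h \<in> coeffs_in R"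
  shows "(\<lambda>p. g p + h p) \<in> coeffs_in R"
  using assms by (auto simp: coeffs_in_def intro!: function_algebraD(2))

lemma coeffs_in_sum:
  assumes "function_algebra R" "\<And>i. i \<in> S \<Longrightarrow> g i \<in> coeffs_in R"
  shows "(\<lambda>p. \<Sum>i\<in>S. g i p) \<in> coeffs_in R"
  using assms(2)
  by (induction S rule: infinite_finite_induct) (auto intro: coeffs_in_add coeffs_in_const assms(1))

lemma coeffs_in_prod:
  assumes "function_algebra R" "\<And>i. i \<in> S \<Longrightarrow> g i \<in> coeffs_in R"
  shows "(\<lambda>p. \<Prod>i\<in>S. g i p) \<in> coeffs_in R"
  using assms(2)
  by (induction S rule: infinite_finite_induct) (auto intro: coeffs_in_mult coeffs_in_const assms(1))

lemma coeffs_in_minor: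
  assumes R: "function_algebra R" and H: "\<And>a b. a < s \<Longrightarrow> b < s \<Longrightarrow> (\<lambda>p. H p (f a) (g b)) \<in> coeffs_in R"
  shows "(\<lambda>p. minor (H p) s f g) \<in> coeffs_in R"
proof -
  have eq: "minor (H p) s f g = (\<Sum>\<pi> | \<pi> permutes {0..<s}. signof \<pi> * (\<Prod>i=0..<s. H p (f i) (g (\<pi> i))))" for p
  proof -
    have "(\<Prod>i=0..<s. mat s s (\<lambda>(a, b). H p (f a) (g b)) $$ (i, \<pi> i)) = (\<Prod>i=0..<s. H p (f i) (g (\<pi> i)))"
      if "\<pi> permutes {0..<s}" for \<pi>
      by (rule prod.cong) (use permutes_in_image[OF that] in auto)
    then show ?thesis unfolding minor_def by (subst det_def'[of _ s]) auto
  qed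
  show ?thesis unfolding eq
  proof (intro coeffs_in_sum[OF R] coeffs_in_mult[OF R] coeffs_in_const[OF R] coeffs_in_prod[OF R] H)
    fix \<pi> i assume "\<pi> \<in> {\<pi>. \<pi> permutes {0..<s}}" "i \<in> {0..<s}"
    then show "i < s" "\<pi> i < s" using permutes_in_image[of \<pi> "{0..<s}" i] by auto
  qed
qed

lemma coeff_jet_entry: "coeff (jet_entry k p i j) l = (if l < k then p (i, j, l) else 0)"
  by (simp add: jet_entry_def coeff_Poly_eq nth_default_def)

lemma jet_entry_coeffs_in:
  assumes "function_algebra R" "\<And>l. l < k \<Longrightarrow> (\<lambda>p. p (i, j, l)) \<in> R"
  shows "(\<lambda>p. jet_entry k p i j) \<in> coeffs_in R"
  unfolding coeffs_in_def
proof (intro CollectI allI)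
  fix l
  show "(\<lambda>p. coeff (jet_entry k p i j) l) \<in> R"
    using assms(2)[of l] function_algebraD(1)[OF assms(1), of 0] by (cases "l < k") (simp_all add: coeff_jet_entry)
qed

text \<open>The equations concern sorted index sets; other index functions give the same minor up to
  sign, or zero when an index repeats.\<close>

lemma jet_det_zero_set_minor:
  fixes p :: "nat \<times> nat \<times> nat \<Rightarrow> 'a::field"
  assumes p: "p \<in> jet_det_zero_set m n r k" and f: "f ` {..<r} \<subseteq> {1..m}" and g: "g ` {..<r} \<subseteq> {1..n}"
  shows "monom 1 k dvd minor (jet_entry k p) r f g"
proof (cases "inj_on f {..<r} \<and> inj_on g {..<r}")
  case False
  then have "minor (jet_entry k p) r f g = 0"
    using minor_repeated_row[of f r] minor_repeated_row[of g r] minor_swap[of _ r f g] by metis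
  then show ?thesis by simp
next
  case True
  define I J where "I = f ` {..<r}" and "J = g ` {..<r}"
  have c: "card I = r" "card J = r" using True by (simp_all add: I_def J_def card_image)
  have fin: "finite I" "finite J" by (simp_all add: I_def J_def)
  have nth: "inj_on (\<lambda>a. sorted_list_of_set S ! a) {..<r} \<and> (\<lambda>a. sorted_list_of_set S ! a) ` {..<r} = S"
    if "finite S" "card S = r" for S :: "nat set"
  proof
    have len: "length (sorted_list_of_set S) = r" using that by simp
    show "inj_on (\<lambda>a. sorted_list_of_set S ! a) {..<r}"
      using len distinct_sorted_list_of_set[of S] by (auto simp: inj_on_def nth_eq_iff_index_eq)
    have "(\<lambda>a. sorted_list_of_set S ! a) ` {..<r} = set (sorted_list_of_set S)"
      using len by (auto simp: set_conv_nth)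
    then show "(\<lambda>a. sorted_list_of_set S ! a) ` {..<r} = S" using that by simp
  qed
  have "\<forall>l<k. coeff (jet_minor k p I J) l = 0"
    using p f g c unfolding jet_det_zero_set_def I_def J_def by blast
  then have "monom 1 k dvd jet_minor k p I J" by (simp add: monom_1_dvd_iff')
  then have "monom 1 k dvd minor (jet_entry k p) r ((!) (sorted_list_of_set I)) ((!) (sorted_list_of_set J))"
    by (simp add: jet_minor_def c minor_def)
  then show ?thesis
    using True nth[OF fin(1) c(1)] nth[OF fin(2) c(2)]
    by (intro dvd_minor_order[of f r "(!) (sorted_list_of_set I)" g "(!) (sorted_list_of_set J)"])
      (auto simp: I_def J_def)
qed

lemma jet_det_zero_setI:
  fixes p :: "nat \<times> nat \<times> nat \<Rightarrow> 'a::field"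
  assumes "p \<in> affine_space m n k"
    and "\<And>f g. f ` {..<r} \<subseteq> {1..m} \<Longrightarrow> g ` {..<r} \<subseteq> {1..n} \<Longrightarrow> monom 1 k dvd minor (jet_entry k p) r f g"
  shows "p \<in> jet_det_zero_set m n r k"
  unfolding jet_det_zero_set_def
proof (intro CollectI conjI assms(1) allI impI)
  fix I J l assume IJ: "I \<subseteq> {1..m} \<and> J \<subseteq> {1..n} \<and> card I = r \<and> card J = r" and l: "l < k"
  have sub: "(\<lambda>a. sorted_list_of_set S ! a) ` {..<r} \<subseteq> {1..N}" if "S \<subseteq> {1..N}" "card S = r" for S :: "nat set" and N
  proof -
    have "finite S" using that finite_subset by blast
    then show ?thesis using that by (metis (no_types, lifting) image_subsetI lessThan_iff length_sorted_list_of_set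
      nth_mem set_sorted_list_of_set subsetD)
  qed
  have "monom 1 k dvd minor (jet_entry k p) r ((!) (sorted_list_of_set I)) ((!) (sorted_list_of_set J))"
    using assms(2) sub IJ by blast
  then show "coeff (jet_minor k p I J) l = 0" using l IJ by (simp add: jet_minor_def minor_def monom_1_dvd_iff')
qed

section \<open>The point, coordinates on the two families and the depth bounds\<close>

locale jet_determinantal =
  fixes m n r k :: nat and field_type :: "'a::field itself"
  assumes r2: "2 \<le> r" and rm: "r < m" and mn: "m \<le> n" and k2: "2 \<le> k"
    and infinite_field: "infinite (UNIV :: 'a set)"
begin

definition z :: "nat \<times> nat \<times> nat \<Rightarrow> 'a" where
  "z = (\<lambda>(i, j, l). if i = j \<and> (1 \<le> i \<and> i \<le> r - 2 \<and> l = 0 \<or> i = r - 1 \<and> l = 1) then 1 else 0)"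

abbreviation X :: "(nat \<times> nat \<times> nat \<Rightarrow> 'a) \<Rightarrow> nat \<Rightarrow> nat \<Rightarrow> 'a poly" where "X \<equiv> jet_entry k"

abbreviation Zs :: "(nat \<times> nat \<times> nat \<Rightarrow> 'a) set" where "Zs \<equiv> jet_det_zero_set m n r k"

lemma finite_jet_vars: "finite (jet_vars m n k)"
  by (rule finite_subset[of _ "{1..m} \<times> {1..n} \<times> {..<k}"]) (auto simp: jet_vars_def)

sublocale variety_point "jet_vars m n k" Zs z
  by unfold_locales (rule finite_jet_vars)

text \<open>\<open>Y 0\<close> and \<open>Y 1\<close> index coordinates on the component of generic rank \<open>r - 1\<close> and on the component
  where all \<open>(r - 1)\<close>-minors vanish at \<open>t = 0\<close>, respectively.\<close>
definition Y :: "nat \<Rightarrow> (nat \<times> nat \<times> nat) set" where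
  "Y e = {(i, j, l) \<in> jet_vars m n k. if e = 0 then \<not> (r \<le> i \<and> r \<le> j)
     else \<not> (r \<le> i \<and> r \<le> j \<and> 1 \<le> l \<and> l \<le> k - 2) \<and> \<not> (r - 1 \<le> i \<and> r - 1 \<le> j \<and> l = 0)}"

text \<open>The minor is taken of the polynomial lifts of degree below \<open>k\<close>, so
  \<open>l\<close> may exceed \<open>k - 1\<close>, as it does for
  \<open>l = 2 * k - 1\<close>.\<close>

definition lead :: "nat \<Rightarrow> nat \<Rightarrow> (nat \<times> nat \<times> nat \<Rightarrow> 'a) \<Rightarrow> 'a" where
  "lead s l p = coeff (minor (X p) s Suc Suc) l"

lemma finite_Y: "finite (Y e)"
  by (rule finite_subset[OF _ finite_jet_vars]) (auto simp: Y_def)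

lemma lead_polyfun: "s \<le> m \<Longrightarrow> lead s l \<in> Pf"
proof -
  assume s: "s \<le> m"
  have "(\<lambda>p. minor (X p) s Suc Suc) \<in> coeffs_in Pf"
    by (rule coeffs_in_minor[OF function_algebra_polyfun], rule jet_entry_coeffs_in[OF function_algebra_polyfun])
      (use s mn in \<open>auto intro!: polyfun.var simp: jet_vars_def\<close>)
  then show ?thesis by (simp add: lead_def[abs_def] coeffs_in_def)
qed

text \<open>A unit \<open>(r-1)\<close>-minor inside the leading block of size \<open>r + 1\<close>
  would force \<open>t^(2k)\<close> to divide the determinant of that block.\<close>

lemma minor_0_eq_0_of_det:
  assumes p: "p \<in> Zs" and d: "lead (r + 1) (2 * k - 1) p \<noteq> 0"
    and f: "inj_on f {..<r - 1}" "f ` {..<r - 1} \<subseteq> {1..r + 1}" and g: "inj_on g {..<r - 1}" "g ` {..<r - 1} \<subseteq> {1..r + 1}"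
  shows "coeff (minor (X p) (r - 1) f g) 0 = 0"
proof (rule ccontr)
  assume nz: "coeff (minor (X p) (r - 1) f g) 0 \<noteq> 0"
  have r: "r - 1 + 2 = r + 1" "Suc (r - 1) = r" using r2 by auto
  have "monom 1 (2 * k) dvd minor (X p) (r - 1 + 2) Suc Suc"
  proof (rule det_dvd_square_of_unit_minor[OF nz f(1) _ g(1)], unfold r)
    show "f ` {..<r - 1} \<subseteq> {1..r + 1}" "g ` {..<r - 1} \<subseteq> {1..r + 1}" by fact+
    fix f g :: "nat \<Rightarrow> nat" assume "f ` {..<r} \<subseteq> {1..r + 1}" "g ` {..<r} \<subseteq> {1..r + 1}"
    then show "monom 1 k dvd minor (X p) r f g"
      by (intro jet_det_zero_set_minor[OF p]) (use rm mn in force)+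
  qed
  then have "lead (r + 1) (2 * k - 1) p = 0" unfolding r lead_def using k2 by (simp add: monom_1_dvd_iff')
  then show False using d by simp
qed

lemma lead_product_zero:
  assumes "p \<in> Zs"
  shows "lead (r - 1) 0 p * lead (r + 1) (2 * k - 1) p = 0"
proof (cases "lead (r + 1) (2 * k - 1) p = 0")
  case False
  have "lead (r - 1) 0 p = 0" unfolding lead_def
    by (rule minor_0_eq_0_of_det[OF assms False]) auto
  then show ?thesis by simp
qed simp

text \<open>Bordering the leading \<open>(r-1)\<close>-minor \<open>D\<close> by row
  \<open>i\<close> and column \<open>j\<close> gives \<open>X_ij * D + N = 0\<close> modulo
  \<open>t^k\<close>, where \<open>N\<close> involves only entries with \<open>a < r\<close> or
  \<open>b < r\<close>. If \<open>D\<close> has order \<open>e\<close> on \<open>W\<close>, the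
  coefficient of \<open>t^(l+e)\<close> is a linear equation for level \<open>l\<close> in terms of
  lower levels. This reaches the levels below \<open>k - e\<close>.\<close>

lemma rational_entry:
  assumes WZ: "W \<subseteq> Zs" and ij: "r \<le> i" "i \<le> m" "r \<le> j" "j \<le> n"
    and border: "\<And>a b l. 1 \<le> a \<Longrightarrow> a \<le> m \<Longrightarrow> 1 \<le> b \<Longrightarrow> b \<le> n \<Longrightarrow> a < r \<or> b < r \<Longrightarrow> l < k \<Longrightarrow>
        (\<lambda>p. p (a, b, l)) \<in> rational_on V W"
    and lead0: "\<And>p l. p \<in> W \<Longrightarrow> l < e \<Longrightarrow> lead (r - 1) l p = 0" and lead_e: "\<And>p. p \<in> W \<Longrightarrow> lead (r - 1) e p \<noteq> 0"
    and l: "l + e < k"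
  shows "(\<lambda>p. p (i, j, l)) \<in> rational_on V W"
proof -
  let ?R = "rational_on V W"
  note R = function_algebra_rational_on[of V W]
  define f where "f a = (if a < r - 1 then Suc a else i)" for a
  define g where "g a = (if a < r - 1 then Suc a else j)" for a
  define N where "N p = minor (\<lambda>a b. if a = r - 1 \<and> b = r - 1 then 0 else X p (f a) (g b)) (Suc (r - 1)) id id" for p
  have entry: "(\<lambda>p. X p a b) \<in> coeffs_in ?R" if "1 \<le> a" "a \<le> m" "1 \<le> b" "b \<le> n" "a < r \<or> b < r" for a b
    by (rule jet_entry_coeffs_in[OF R]) (rule border, use that in auto)
  have Nc: "N \<in> coeffs_in ?R" unfolding N_def[abs_def]
  proof (rule coeffs_in_minor[OF R])
    fix a b assume ab: "a < Suc (r - 1)" "b < Suc (r - 1)"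
    show "(\<lambda>p. if id a = r - 1 \<and> id b = r - 1 then 0 else X p (f (id a)) (g (id b))) \<in> coeffs_in ?R"
    proof (cases "a = r - 1 \<and> b = r - 1")
      case True
      then show ?thesis by (simp only: id_apply True simp_thms if_True coeffs_in_const[OF R])
    next
      case False
      have "(\<lambda>p. X p (f a) (g b)) \<in> coeffs_in ?R"
        by (rule entry) (use False ab ij rm mn in \<open>auto simp: f_def g_def\<close>)
      then show ?thesis by (simp only: id_apply if_not_P[OF False])
    qed
  qed
  have Dc: "(\<lambda>p. minor (X p) (r - 1) Suc Suc) \<in> coeffs_in ?R"
    by (rule coeffs_in_minor[OF R], rule entry) (use rm mn in auto)
  then have Dl: "lead (r - 1) l \<in> ?R" for l by (simp add: lead_def[abs_def] coeffs_in_def)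
  have eq: "lead (r - 1) e p * p (i, j, l) =
      - (coeff (N p) (l + e) + (\<Sum>a<l. p (i, j, a) * lead (r - 1) (l + e - a) p))"
    if p: "p \<in> W" and l: "l + e < k" for p l
  proof -
    have "monom 1 k dvd minor (X p) (Suc (r - 1)) f g"
    proof -
      have "Suc (r - 1) = r" using r2 by simp
      then show ?thesis
        using p WZ ij rm mn by (auto intro!: jet_det_zero_set_minor simp: f_def g_def)
    qed
    also have "minor (X p) (Suc (r - 1)) f g = X p i j * minor (X p) (r - 1) f g + N p"
      using minor_corner[of "X p" "r - 1" f g] unfolding N_def by (simp only: f_def g_def less_irrefl if_False)
    also have "minor (X p) (r - 1) f g = minor (X p) (r - 1) Suc Suc"
      by (rule minor_cong) (simp add: f_def g_def)
    finally have "coeff (X p i j * minor (X p) (r - 1) Suc Suc + N p) (l + e) = 0"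
      using l by (simp add: monom_1_dvd_iff')
    then have "(\<Sum>a\<le>l + e. coeff (X p i j) a * lead (r - 1) (l + e - a) p) + coeff (N p) (l + e) = 0"
      by (simp add: coeff_mult lead_def)
    \<comment> \<open>Beyond level \<open>l\<close> the second factor has index below
      \<open>e\<close> and vanishes on \<open>W\<close>.\<close>
    also have "(\<Sum>a\<le>l + e. coeff (X p i j) a * lead (r - 1) (l + e - a) p) =
        (\<Sum>a<Suc l. coeff (X p i j) a * lead (r - 1) (l + e - a) p)"
      by (rule sum.mono_neutral_right) (use lead0[OF p] in auto)
    also have "\<dots> = (\<Sum>a<l. p (i, j, a) * lead (r - 1) (l + e - a) p) + p (i, j, l) * lead (r - 1) e p"
      using l by (simp add: coeff_jet_entry)
    finally show ?thesis by (simp add: algebra_simps eq_neg_iff_add_eq_0)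
  qed
  show ?thesis using l
  proof (induction l rule: less_induct)
    case (less l)
    show ?case
    proof (rule rational_on_divide[OF Dl _ lead_e])
      show "(\<lambda>p. - (coeff (N p) (l + e) + (\<Sum>a<l. p (i, j, a) * lead (r - 1) (l + e - a) p))) \<in> ?R"
        by (intro rational_on_minus rational_on_add rational_on_sum rational_on_mult Dl less.IH)
          (use Nc less.prems in \<open>auto simp: coeffs_in_def\<close>)
    qed (use eq less.prems in auto)
  qed
qed

text \<open>Where the leading \<open>(r-1)\<close>-minor is a unit, the elimination with
  \<open>e = 0\<close> determines every level of the block from \<open>r\<close> on.\<close>

lemma depth_le_Y0:
  assumes "lead (r - 1) 0 \<notin> vanishing"
  shows "loc_depth Pf Zs z \<le> enat (card (Y 0))"
proof (rule loc_depth_le[OF finite_Y lead_polyfun assms])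
  let ?W = "{q \<in> Zs. lead (r - 1) 0 q \<noteq> 0}"
  show "r - 1 \<le> m" using rm by simp
  fix v assume v: "v \<in> jet_vars m n k"
  obtain i j l where ijl: "v = (i, j, l)" "1 \<le> i" "i \<le> m" "1 \<le> j" "j \<le> n" "l < k"
    using v by (auto simp: jet_vars_def)
  have border: "(\<lambda>p. p (a, b, l)) \<in> rational_on (Y 0) ?W"
    if "1 \<le> a" "a \<le> m" "1 \<le> b" "b \<le> n" "a < r \<or> b < r" "l < k" for a b l
    by (intro rational_on_polyfun polyfun.var) (use that in \<open>auto simp: Y_def jet_vars_def\<close>)
  show "(\<lambda>p. p v) \<in> rational_on (Y 0) ?W"
  proof (cases "i < r \<or> j < r")
    case True
    then show ?thesis using border ijl by blast
  next
    case False
    show ?thesis unfolding ijl(1)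
      by (rule rational_entry[of ?W i j "Y 0" 0 l, OF _ _ _ _ _ border]) (use False ijl in auto)
  qed
qed

text \<open>Each factor has its task: the third makes the \<open>(r-1)\<close>-minors vanish at
  \<open>t = 0\<close>, the first then determines the constant coefficients of the block from
  \<open>r - 1\<close> on, and the second gives the leading \<open>(r-1)\<close>-minor order exactly
  1, so that all levels below \<open>k - 1\<close> of the block from \<open>r\<close> on
  follow.\<close>

lemma depth_le_Y1:
  assumes mr: "m = r + 1" and nr: "n = r + 1"
    and nv: "(\<lambda>p. lead (r - 2) 0 p * lead (r - 1) 1 p * lead (r + 1) (2 * k - 1) p) \<notin> vanishing"
  shows "loc_depth Pf Zs z \<le> enat (card (Y 1))"
proof (rule loc_depth_le[OF finite_Y _ nv])
  let ?W = "{q \<in> Zs. lead (r - 2) 0 q * lead (r - 1) 1 q * lead (r + 1) (2 * k - 1) q \<noteq> 0}"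
  let ?R = "rational_on (Y 1) ?W"
  note R = function_algebra_rational_on[of "Y 1" ?W]
  show "(\<lambda>p. lead (r - 2) 0 p * lead (r - 1) 1 p * lead (r + 1) (2 * k - 1) p) \<in> Pf"
    by (intro polyfun.mult lead_polyfun) (use rm in auto)
  have Y: "(\<lambda>p. p (a, b, l)) \<in> ?R" if "(a, b, l) \<in> Y 1" for a b l
    using that by (intro rational_on_polyfun polyfun.var)
  have corner: "(\<lambda>p. X p a b) \<in> coeffs_in ?R" if "1 \<le> a" "a \<le> m" "1 \<le> b" "b \<le> n" "a < r - 1 \<or> b < r - 1" for a b
    by (intro jet_entry_coeffs_in[OF R] Y) (use that in \<open>auto simp: Y_def jet_vars_def\<close>)
  \<comment> \<open>The bordering argument one size lower, around the leading
    \<open>(r-2)\<close>-minor and in constant coefficients only.\<close>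
  have level0: "(\<lambda>p. p (i, j, 0)) \<in> ?R" if ij: "r - 1 \<le> i" "i \<le> m" "r - 1 \<le> j" "j \<le> n" for i j
  proof -
    define f where "f a = (if a < r - 2 then Suc a else i)" for a
    define g where "g a = (if a < r - 2 then Suc a else j)" for a
    define N where "N p = minor (\<lambda>a b. if a = r - 2 \<and> b = r - 2 then 0 else X p (f a) (g b)) (Suc (r - 2)) id id" for p
    have Nc: "N \<in> coeffs_in ?R" unfolding N_def[abs_def]
    proof (rule coeffs_in_minor[OF R])
      fix a b assume ab: "a < Suc (r - 2)" "b < Suc (r - 2)"
      show "(\<lambda>p. if id a = r - 2 \<and> id b = r - 2 then 0 else X p (f (id a)) (g (id b))) \<in> coeffs_in ?R"
      proof (cases "a = r - 2 \<and> b = r - 2")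
        case True
        then show ?thesis by (simp only: id_apply True simp_thms if_True coeffs_in_const[OF R])
      next
        case False
        have "(\<lambda>p. X p (f a) (g b)) \<in> coeffs_in ?R"
          by (rule corner) (use False ab ij rm mn r2 in \<open>auto simp: f_def g_def\<close>)
        then show ?thesis by (simp only: id_apply if_not_P[OF False])
      qed
    qed
    have "(\<lambda>p. minor (X p) (r - 2) Suc Suc) \<in> coeffs_in ?R"
      by (rule coeffs_in_minor[OF R], rule corner) (use rm mn in auto)
    then have D: "lead (r - 2) 0 \<in> ?R" by (simp add: lead_def[abs_def] coeffs_in_def)
    show ?thesis
    proof (rule rational_on_divide[OF D])
      show "(\<lambda>p. - coeff (N p) 0) \<in> ?R" using Nc by (intro rational_on_minus) (simp add: coeffs_in_def)
      fix p assume p: "p \<in> ?W"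
      then show "lead (r - 2) 0 p \<noteq> 0" by auto
      have r: "Suc (r - 2) = r - 1" using r2 by simp
      have "coeff (minor (X p) (Suc (r - 2)) f g) 0 = 0"
        unfolding r using p ij mr nr r2
        by (intro minor_0_eq_0_of_det) (auto simp: f_def g_def inj_on_def)
      moreover have "minor (X p) (Suc (r - 2)) f g = X p i j * minor (X p) (r - 2) f g + N p"
        using minor_corner[of "X p" "r - 2" f g] unfolding N_def by (simp only: f_def g_def less_irrefl if_False)
      moreover have "minor (X p) (r - 2) f g = minor (X p) (r - 2) Suc Suc"
        by (rule minor_cong) (simp add: f_def g_def)
      ultimately show "lead (r - 2) 0 p * p (i, j, 0) = - coeff (N p) 0"
        using k2 by (simp add: lead_def coeff_mult coeff_jet_entry eq_neg_iff_add_eq_0 mult.commute)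
    qed
  qed
  have border: "(\<lambda>p. p (a, b, l)) \<in> ?R"
    if "1 \<le> a" "a \<le> m" "1 \<le> b" "b \<le> n" "a < r \<or> b < r" "l < k" for a b l
  proof (cases "r - 1 \<le> a \<and> r - 1 \<le> b \<and> l = 0")
    case True
    then show ?thesis using level0[of a b] that by simp
  next
    case False
    then show ?thesis using that by (intro Y) (auto simp: Y_def jet_vars_def)
  qed
  fix v assume v: "v \<in> jet_vars m n k"
  obtain i j l where ijl: "v = (i, j, l)" "1 \<le> i" "i \<le> m" "1 \<le> j" "j \<le> n" "l < k"
    using v by (auto simp: jet_vars_def)
  show "(\<lambda>p. p v) \<in> ?R"
  proof (cases "i < r \<or> j < r")
    case True
    then show ?thesis using border ijl by blast
  next
    case False
    show ?thesis
    proof (cases "l + 1 < k")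
      case True
      have "lead (r - 1) 0 p = 0" if "p \<in> ?W" for p
        using that lead_product_zero[of p] by auto
      then show ?thesis unfolding ijl(1)
        by (intro rational_entry[of ?W i j "Y 1" 1 l, OF _ _ _ _ _ border]) (use False ijl True in auto)
    next
      case l: False
      then show ?thesis unfolding ijl(1) using False ijl k2 by (intro Y) (auto simp: Y_def jet_vars_def)
    qed
  qed
qed

end

section \<open>Parametrisations of the two families and lower bounds for the dimension\<close>

lemma supportedD: "y \<in> supported S \<Longrightarrow> v \<notin> S \<Longrightarrow> y v = 0"
  by (simp add: supported_def)

context jet_determinantal
begin

definition shifted :: "(nat \<times> nat \<times> nat \<Rightarrow> 'a) \<Rightarrow> nat \<Rightarrow> nat \<Rightarrow> 'a poly" where
  "shifted y = X (\<lambda>v. z v + y v)"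

definition left_factor :: "(nat \<times> nat \<times> nat \<Rightarrow> 'a) \<Rightarrow> nat \<Rightarrow> nat \<Rightarrow> 'a poly" where
  "left_factor y i u = (if i \<le> r - 2 then (if i = Suc u then 1 else 0) else X y i (Suc u))"

text \<open>Column \<open>r - 1\<close> normalised to have entry 1 in row \<open>r - 1\<close>. The
  list starts at level \<open>e\<close> because \<open>Y 1\<close> omits level 0 there; for
  \<open>e = 1\<close> the pivot in \<open>row_factor\<close> is divisible by \<open>t\<close> on
  \<open>supported (Y 1)\<close>, and multiplication by it restores the shift.\<close>

definition col_factor :: "nat \<Rightarrow> (nat \<times> nat \<times> nat \<Rightarrow> 'a) \<Rightarrow> nat \<Rightarrow> 'a poly" where
  "col_factor e y i = (if i \<le> r - 2 then 0 else if i = r - 1 then 1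
     else Poly (map (\<lambda>l. y (i, r - 1, l)) [e..<k]))"

definition row_factor :: "(nat \<times> nat \<times> nat \<Rightarrow> 'a) \<Rightarrow> nat \<Rightarrow> 'a poly" where
  "row_factor y j = (if j \<le> r - 2 then 0 else shifted y (r - 1) j)"

text \<open>Level \<open>k - 1\<close> of the block from \<open>r\<close> on is free in the second
  family; on \<open>supported (Y 0)\<close> this matrix is zero.\<close>

definition top_part :: "(nat \<times> nat \<times> nat \<Rightarrow> 'a) \<Rightarrow> nat \<Rightarrow> nat \<Rightarrow> 'a poly" where
  "top_part y i j = (if r \<le> i \<and> r \<le> j then monom (y (i, j, k - 1)) (k - 1) else 0)"

definition rank_one_part :: "nat \<Rightarrow> (nat \<times> nat \<times> nat \<Rightarrow> 'a) \<Rightarrow> nat \<Rightarrow> nat \<Rightarrow> 'a poly" where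
  "rank_one_part e y i j = top_part y i j + col_factor e y i * row_factor y j"

text \<open>The matrix is \<open>A B + T\<close> with \<open>A\<close> and \<open>B\<close> of inner dimension \<open>r - 2\<close>. For \<open>y\<close> supported on
  \<open>Y e\<close> the \<open>2\<close>-minors of \<open>T\<close> vanish modulo \<open>t^k\<close>: for \<open>e = 0\<close> because \<open>T\<close> has rank one, for \<open>e = 1\<close> because \<open>T\<close> is \<open>t\<close> times
  a matrix of rank one modulo \<open>t^(k-2)\<close>.\<close>
definition param_matrix :: "nat \<Rightarrow> (nat \<times> nat \<times> nat \<Rightarrow> 'a) \<Rightarrow> nat \<Rightarrow> nat \<Rightarrow> 'a poly" where
  "param_matrix e y i j = rank_one_part e y i j + (\<Sum>u<r - 2. left_factor y i u * shifted y (Suc u) j)"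

definition param :: "nat \<Rightarrow> (nat \<times> nat \<times> nat \<Rightarrow> 'a) \<Rightarrow> (nat \<times> nat \<times> nat) \<Rightarrow> 'a" where
  "param e y = (\<lambda>(i, j, l). if (i, j, l) \<in> jet_vars m n k then coeff (param_matrix e y i j) l else 0)"

lemma coeff_shifted: "coeff (shifted y i j) l = (if l < k then z (i, j, l) + y (i, j, l) else 0)"
  by (simp add: shifted_def coeff_jet_entry)

lemma coeff_col_factor:
  "r \<le> i \<Longrightarrow> coeff (col_factor e y i) l = (if l + e < k then y (i, r - 1, l + e) else 0)"
  using r2 by (auto simp: col_factor_def coeff_Poly_eq nth_default_def add.commute)

lemma param_polyfun:
  assumes v: "v \<in> jet_vars m n k"
  shows "(\<lambda>y. param e y v) \<in> polyfun UNIV"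
proof -
  have R: "function_algebra (polyfun UNIV :: ((nat \<times> nat \<times> nat \<Rightarrow> 'a) \<Rightarrow> 'a) set)"
    by (rule function_algebra_polyfun)
  obtain i j l where ijl: "v = (i, j, l)" by (cases v) auto
  have sh: "(\<lambda>y. shifted y a b) \<in> coeffs_in (polyfun UNIV)" for a b
    unfolding coeffs_in_def
  proof (intro CollectI allI)
    fix l
    show "(\<lambda>y. coeff (shifted y a b) l) \<in> polyfun UNIV"
      by (cases "l < k") (auto simp: coeff_shifted intro!: polyfun.add polyfun.const polyfun.var)
  qed
  have lf: "(\<lambda>y. left_factor y a b) \<in> coeffs_in (polyfun UNIV)" for a b
    by (cases "a \<le> r - 2"; cases "a = Suc b")
      (simp_all add: left_factor_def coeffs_in_const[OF R] jet_entry_coeffs_in[OF R] polyfun.var)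
  have cf: "(\<lambda>y. col_factor e y a) \<in> coeffs_in (polyfun UNIV)" for a
    unfolding coeffs_in_def
  proof (intro CollectI allI)
    fix l show "(\<lambda>y. coeff (col_factor e y a) l) \<in> polyfun UNIV"
    proof (cases "r \<le> a")
      case True
      show ?thesis
        by (cases "l + e < k") (auto simp: coeff_col_factor[OF True] intro!: polyfun.const polyfun.var)
    next
      case False
      then have "a \<le> r - 2 \<or> \<not> a \<le> r - 2 \<and> a = r - 1" by auto
      then show ?thesis by (elim disjE conjE) (simp_all add: col_factor_def polyfun.const)
    qed
  qed
  have rf: "(\<lambda>y. row_factor y b) \<in> coeffs_in (polyfun UNIV)" for b
    by (cases "b \<le> r - 2") (simp_all add: row_factor_def sh coeffs_in_const[OF R])
  have tp: "(\<lambda>y. top_part y a b) \<in> coeffs_in (polyfun UNIV)" for a b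
    unfolding coeffs_in_def
  proof (intro CollectI allI)
    fix l
    show "(\<lambda>y. coeff (top_part y a b) l) \<in> polyfun UNIV"
      by (cases "r \<le> a"; cases "r \<le> b"; cases "l = k - 1") (simp_all add: top_part_def polyfun.const polyfun.var)
  qed
  have "(\<lambda>y. param_matrix e y i j) \<in> coeffs_in (polyfun UNIV)"
    unfolding param_matrix_def rank_one_part_def
    by (intro coeffs_in_add coeffs_in_mult coeffs_in_sum R sh lf cf rf tp)
  then show ?thesis using v by (simp add: param_def ijl coeffs_in_def)
qed

text \<open>The pure rank one term cancels in a 2-minor. Products of two top parts carry
  \<open>t^(2k-2)\<close>, with \<open>2k - 2 \<ge> k\<close>. Mixed products are zero for
  \<open>e = 0\<close>; for \<open>e = 1\<close> the row factor supplies the missing power of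
  \<open>t\<close>.\<close>

lemma rank_one_part_minors:
  assumes e: "e = 0 \<or> e = 1" and y: "y \<in> supported (Y e)"
  shows "monom 1 k dvd minor (rank_one_part e y) 2 f g"
proof -
  have w: "monom 1 k dvd top_part y i j * row_factor y j'" for i j j'
  proof (cases "r \<le> i \<and> r \<le> j \<and> r - 1 \<le> j'")
    case True
    show ?thesis
    proof (cases "e = 0")
      case True
      have "y (i, j, k - 1) = 0" if "r \<le> i" "r \<le> j"
        using True that by (intro supportedD[OF y]) (simp add: Y_def)
      then show ?thesis by (simp add: top_part_def)
    next
      case False
      have "coeff (row_factor y j') 0 = 0"
      proof -
        have "(r - 1, j', 0) \<notin> Y e" using False \<open>r \<le> i \<and> r \<le> j \<and> r - 1 \<le> j'\<close> by (auto simp: Y_def)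
        then show ?thesis using supportedD[OF y] r2 by (auto simp: row_factor_def coeff_shifted z_def)
      qed
      then have "monom 1 1 dvd row_factor y j'" by (simp add: monom_1_dvd_iff')
      then obtain b where b: "row_factor y j' = monom 1 1 * b" by blast
      have "top_part y i j * row_factor y j' = monom 1 k * (smult (y (i, j, k - 1)) b)"
      proof -
        have "monom (y (i, j, k - 1)) (k - 1) * monom 1 1 = smult (y (i, j, k - 1)) (monom 1 k)"
          using k2 by (simp add: mult_monom smult_monom)
        then show ?thesis using True unfolding b top_part_def
          by (simp add: mult.assoc[symmetric])
      qed
      then show ?thesis by (simp only: dvd_triv_left)
    qed
  qed (use r2 in \<open>auto simp: top_part_def row_factor_def\<close>)
  have ww: "monom 1 k dvd top_part y i j * top_part y i' j'" for i j i' j'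
    using k2 by (auto simp: top_part_def mult_monom monom_1_dvd_iff')
  have "minor (rank_one_part e y) 2 f g = top_part y (f 0) (g 0) * top_part y (f 1) (g 1)
     - top_part y (f 0) (g 1) * top_part y (f 1) (g 0)
     + (top_part y (f 0) (g 0) * row_factor y (g 1) - top_part y (f 0) (g 1) * row_factor y (g 0)) * col_factor e y (f 1)
     + (top_part y (f 1) (g 1) * row_factor y (g 0) - top_part y (f 1) (g 0) * row_factor y (g 1)) * col_factor e y (f 0)"
    unfolding minor_2 rank_one_part_def by (simp add: algebra_simps)
  also have "monom 1 k dvd \<dots>" by (intro dvd_add dvd_diff dvd_mult2 w ww)
  finally show ?thesis .
qed

lemma param_in_Zs:
  assumes e: "e = 0 \<or> e = 1" and y: "y \<in> supported (Y e)"
  shows "param e y \<in> Zs"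
proof (rule jet_det_zero_setI)
  show "param e y \<in> affine_space m n k" by (auto simp: affine_space_def param_def)
  fix f g :: "nat \<Rightarrow> nat" assume fg: "f ` {..<r} \<subseteq> {1..m}" "g ` {..<r} \<subseteq> {1..n}"
  have r: "2 + (r - 2) = r" using r2 by simp
  have "monom 1 k dvd minor (\<lambda>i j. rank_one_part e y i j + (\<Sum>u<r - 2. left_factor y i u * shifted y (Suc u) j)) (2 + (r - 2)) f g"
    by (rule dvd_minor_low_rank_update) (rule rank_one_part_minors[OF e y])
  then have "monom 1 k dvd minor (param_matrix e y) r f g"
    unfolding param_matrix_def[abs_def] r .
  \<comment> \<open>Truncation changes the entries only by multiples of \<open>t^k\<close>.\<close>
  moreover have "monom 1 k dvd minor (X (param e y)) r f g - minor (param_matrix e y) r f g"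
  proof (rule minor_dvd_diff)
    fix a b assume "a < r" "b < r"
    then have "f a \<in> {1..m}" "g b \<in> {1..n}" using fg by auto
    then show "monom 1 k dvd X (param e y) (f a) (g b) - param_matrix e y (f a) (g b)"
      by (auto simp: monom_1_dvd_iff' coeff_jet_entry param_def jet_vars_def)
  qed
  ultimately show "monom 1 k dvd minor (X (param e y)) r f g"
    by (metis dvd_diffD dvd_add diff_add_cancel)
qed

text \<open>In these rows the left factor is part of an identity matrix and the residual part is
  zero.\<close>

lemma param_top:
  assumes "(i, j, l) \<in> jet_vars m n k" "i \<le> r - 2"
  shows "param e y (i, j, l) = z (i, j, l) + y (i, j, l)"
proof -
  have i: "1 \<le> i" "l < k" using assms by (auto simp: jet_vars_def)
  have "(\<Sum>u<r - 2. left_factor y i u * shifted y (Suc u) j) = (\<Sum>u<r - 2. if u = i - 1 then shifted y i j else 0)"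
    by (rule sum.cong) (use assms i in \<open>auto simp: left_factor_def\<close>)
  also have "\<dots> = shifted y i j" using assms i by (subst sum.delta) auto
  finally have "param_matrix e y i j = shifted y i j"
    using assms r2 by (auto simp: param_matrix_def rank_one_part_def top_part_def col_factor_def)
  then show ?thesis using assms i by (simp add: param_def coeff_shifted)
qed

lemma shifted_top:
  assumes "\<And>l. y (Suc u, j, l) = 0" "u < r - 2"
  shows "shifted y (Suc u) j = (if Suc u = j then 1 else 0)"
  by (rule poly_eqI) (use assms k2 in \<open>auto simp: coeff_shifted z_def\<close>)

lemma param_left:
  assumes v: "(i, j, l) \<in> jet_vars m n k" "r - 1 \<le> i" "j \<le> r - 2" and y: "\<And>u l. u \<le> r - 2 \<Longrightarrow> y (u, j, l) = 0"
  shows "param e y (i, j, l) = y (i, j, l)"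
proof -
  have j: "1 \<le> j" "l < k" using v by (auto simp: jet_vars_def)
  have "(\<Sum>u<r - 2. left_factor y i u * shifted y (Suc u) j) = (\<Sum>u<r - 2. if u = j - 1 then X y i j else 0)"
    by (rule sum.cong) (use v j y r2 in \<open>auto simp: left_factor_def shifted_top\<close>)
  also have "\<dots> = X y i j" using v j by (subst sum.delta) auto
  finally have "param_matrix e y i j = X y i j"
    using v r2 by (auto simp: param_matrix_def rank_one_part_def top_part_def row_factor_def)
  then show ?thesis using v j by (simp add: param_def coeff_jet_entry)
qed

lemma param_right:
  assumes v: "(i, j, l) \<in> jet_vars m n k" "r - 1 \<le> j" and y: "\<And>u l. u \<le> r - 2 \<Longrightarrow> y (u, j, l) = 0"
  shows "param e y (i, j, l) = coeff (rank_one_part e y i j) l"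
proof -
  have "(\<Sum>u<r - 2. left_factor y i u * shifted y (Suc u) j) = 0"
    by (rule sum.neutral) (use v y in \<open>auto simp: shifted_top\<close>)
  then show ?thesis using v by (simp add: param_def param_matrix_def)
qed

lemma z_eq_0: "(i, j, l) \<in> jet_vars m n k \<Longrightarrow> r \<le> i \<or> (r - 1 \<le> i \<and> j \<le> r - 2) \<Longrightarrow> z (i, j, l) = 0"
  using r2 by (auto simp: z_def jet_vars_def)

lemma param_corner_row:
  assumes v: "(r - 1, j, l) \<in> jet_vars m n k" "r - 1 \<le> j" and y: "\<And>u l. u \<le> r - 2 \<Longrightarrow> y (u, j, l) = 0"
  shows "param e y (r - 1, j, l) = z (r - 1, j, l) + y (r - 1, j, l)"
proof -
  have "rank_one_part e y (r - 1) j = shifted y (r - 1) j"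
    using v r2 by (auto simp: rank_one_part_def top_part_def col_factor_def row_factor_def)
  moreover have "l < k" using v by (simp add: jet_vars_def)
  ultimately show ?thesis using param_right[of "r - 1" j l y e] v y by (simp add: coeff_shifted)
qed

lemma param_corner_block:
  assumes v: "(i, j, l) \<in> jet_vars m n k" "r \<le> i" "r - 1 \<le> j"
    and y: "\<And>u l. u \<le> r - 2 \<Longrightarrow> y (u, j, l) = 0" and c: "\<And>l. y (i, r - 1, l) = 0"
  shows "param e y (i, j, l) = (if r \<le> j \<and> l = k - 1 then y (i, j, l) else 0)"
proof -
  have "col_factor e y i = 0" by (rule poly_eqI) (use v c in \<open>simp add: coeff_col_factor\<close>)
  then show ?thesis using param_right[of i j l y e] v y by (auto simp: rank_one_part_def top_part_def)
qed

text \<open>Such perturbations touch only the pivot and the top level of the block from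
  \<open>r\<close> on, which no product in the parametrisation mixes. This provides explicit lines
  through \<open>z\<close> inside the variety.\<close>

lemma param_line:
  assumes y: "\<And>i j l. y (i, j, l) \<noteq> 0 \<Longrightarrow> (i = r - 1 \<and> j = r - 1) \<or> (r \<le> i \<and> i \<le> m \<and> r \<le> j \<and> j \<le> n \<and> l = k - 1)"
    and y': "\<And>l. k \<le> l \<Longrightarrow> y (r - 1, r - 1, l) = 0"
  shows "param e y = (\<lambda>v. z v + y v)"
proof
  fix v :: "nat \<times> nat \<times> nat"
  obtain i j l where v: "v = (i, j, l)" by (metis prod_cases3)
  have u: "y (u, j, l) = 0" if "u \<le> r - 2" for u j l
  proof (rule ccontr)
    assume "\<not> ?thesis"
    from y[OF this] show False using that r2 by arith
  qed
  have c: "y (a, b, l) = 0" if "r \<le> a" "b < r" for a b l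
  proof (rule ccontr)
    assume "\<not> ?thesis"
    from y[OF this] show False using that r2 by arith
  qed
  show "param e y v = z v + y v"
  proof (cases "v \<in> jet_vars m n k")
    case False
    have "y (i, j, l) = 0"
    proof (rule ccontr)
      assume h: "\<not> ?thesis"
      from y[OF h] show False
      proof
        assume a: "i = r - 1 \<and> j = r - 1"
        then have "\<not> k \<le> l" using y'[of l] h by blast
        then show False using False a rm mn r2 by (auto simp: v jet_vars_def)
      next
        assume "r \<le> i \<and> i \<le> m \<and> r \<le> j \<and> j \<le> n \<and> l = k - 1"
        then show False using False r2 k2 by (auto simp: v jet_vars_def)
      qed
    qed
    moreover have "z (i, j, l) = 0" using False rm mn r2 k2 by (auto simp: v jet_vars_def z_def)
    ultimately show ?thesis using False by (simp add: v param_def)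
  next
    case True
    note V = True[unfolded v]
    consider "i \<le> r - 2" | "r - 1 \<le> i" "j \<le> r - 2" | "i = r - 1" "r - 1 \<le> j" | "r \<le> i" "r - 1 \<le> j" by linarith
    then show ?thesis
    proof cases
      case 1
      then show ?thesis using param_top[OF V] by (simp add: v)
    next
      case 2
      then show ?thesis using param_left[of i j l y e] V 2 u z_eq_0[OF V] by (simp add: v)
    next
      case 3
      then show ?thesis using param_corner_row[of j l y e] V u by (simp add: v)
    next
      case 4
      have "y (i, j, l) = 0" if "\<not> (r \<le> j \<and> l = k - 1)"
      proof (rule ccontr)
        assume "\<not> ?thesis"
        from y[OF this] show False using that 4 r2 by arith
      qed
      then show ?thesis using param_corner_block[of i j l y e] V u c z_eq_0[OF V] 4 r2 by (auto simp: v)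
    qed
  qed
qed

lemma param_0: "param e (\<lambda>_. 0) = z"
  by (subst param_line) auto

text \<open>The order of elimination that makes \<open>param\<close> triangular: rows up to
  \<open>r - 2\<close>, columns up to \<open>r - 2\<close>, column \<open>r - 1\<close> below the
  pivot level by level, then the rest. The pivot must be heavier than its column, since that column
  is visible only through its product with the pivot.\<close>

definition weight :: "nat \<times> nat \<times> nat \<Rightarrow> nat" where
  "weight = (\<lambda>(i, j, l). if i \<le> r - 2 then 0 else if j \<le> r - 2 then 1
     else if r \<le> i \<and> j = r - 1 then 2 + l else 2 + k)"

lemma weight_col: "r \<le> i \<Longrightarrow> weight (i, r - 1, l) = 2 + l"
proof -
  assume "r \<le> i"
  then have "\<not> i \<le> r - 2" "\<not> r - 1 \<le> r - 2" using r2 by auto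
  then show ?thesis using \<open>r \<le> i\<close> by (simp add: weight_def)
qed

lemma param_invisible:
  assumes e: "e = 0 \<or> e = 1" and v: "v \<in> Y e" and y: "y \<in> supported {w \<in> Y e. weight v \<le> weight w \<and> w \<noteq> v}"
  shows "param e y v = z v"
proof -
  obtain i j l where ijl: "v = (i, j, l)" by (cases v) auto
  have V: "(i, j, l) \<in> jet_vars m n k" using v by (auto simp: Y_def ijl)
  have l: "l < k" using V by (simp add: jet_vars_def)
  have y0: "y w = 0" if "weight w < weight v \<or> w = v \<or> w \<notin> Y e" for w
    by (rule supportedD[OF y]) (use that in auto)
  have yv: "y (i, j, l) = 0" using y0[of v] by (simp add: ijl)
  have u: "y (u, b, l') = 0" if "u \<le> r - 2" "r - 1 \<le> i" for u b l'
    by (rule y0) (use that r2 in \<open>auto simp: weight_def ijl\<close>)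
  consider "i \<le> r - 2" | "r - 1 \<le> i" "j \<le> r - 2" | "i = r - 1" "r - 1 \<le> j" | "r \<le> i" "j = r - 1" | "r \<le> i" "r \<le> j"
    by linarith
  then show ?thesis
  proof cases
    case 1
    then show ?thesis using param_top[OF V] yv by (simp add: ijl)
  next
    case 2
    then show ?thesis using param_left[of i j l y e] V 2 u z_eq_0[OF V] yv by (simp add: ijl)
  next
    case 3
    then show ?thesis using param_corner_row[of j l y e] V u yv by (simp add: ijl)
  next
    case 4
    have c: "y (i, r - 1, l') = 0" if "l' \<le> l" for l'
      by (rule y0, cases "l' = l") (use that 4 in \<open>simp_all only: ijl weight_col\<close>, auto)
    \<comment> \<open>Coefficient \<open>a\<close> of the column factor carries level
      \<open>a + e\<close>, and levels up to \<open>l\<close> are switched off. Only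
      \<open>a = l\<close> with \<open>e = 1\<close> remains, where the pivot has zero constant
      coefficient.\<close>
    have prod: "coeff (col_factor e y i) a * coeff (shifted y (r - 1) (r - 1)) (l - a) = 0" if "a \<le> l" for a
    proof (cases "a + e \<le> l")
      case True
      then show ?thesis using c 4 by (simp add: coeff_col_factor)
    next
      case False
      then have "a = l" "e = 1" using e that by auto
      moreover have "y (r - 1, r - 1, 0) = 0" if "e = 1" by (rule y0) (use that in \<open>auto simp: Y_def\<close>)
      ultimately show ?thesis using r2 by (auto simp: coeff_shifted z_def)
    qed
    have "rank_one_part e y i j = col_factor e y i * shifted y (r - 1) (r - 1)"
      using 4 r2 by (auto simp: rank_one_part_def top_part_def row_factor_def)
    then have "coeff (rank_one_part e y i j) l = 0"
      unfolding coeff_mult by (simp only: coeff_mult) (rule sum.neutral, use prod in auto)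
    then show ?thesis using param_right[of i j l y e] V u 4 z_eq_0[OF V] by (simp add: ijl)
  next
    case 5
    have c: "y (i, r - 1, l') = 0" for l'
    proof (cases "l' < k")
      case True
      then show ?thesis using 5 r2 by (intro y0) (auto simp: weight_def ijl)
    next
      case False
      then show ?thesis by (intro y0) (auto simp: Y_def jet_vars_def)
    qed
    show ?thesis using param_corner_block[of i j l y e] V u c 5 yv z_eq_0[OF V] by (auto simp: ijl)
  qed
qed

lemma param_visible:
  assumes e: "e = 0 \<or> e = 1" and v: "v \<in> Y e"
  shows "\<exists>y\<in>supported {w \<in> Y e. weight v < weight w \<or> w = v}. param e y v \<noteq> z v"
proof -
  obtain i j l where ijl: "v = (i, j, l)" by (cases v) auto
  have V: "(i, j, l) \<in> jet_vars m n k" using v by (auto simp: Y_def ijl)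
  have l: "l < k" using V by (simp add: jet_vars_def)
  \<comment> \<open>The unit vector at \<open>v\<close> suffices except in column
    \<open>r - 1\<close> for \<open>e = 0\<close>: the pivot of \<open>z\<close> is
    \<open>t\<close>, which would shift the level by one, so its constant coefficient is set to 1 as
    well.\<close>
  define y :: "nat \<times> nat \<times> nat \<Rightarrow> 'a" where
    "y w = (if w = v \<or> (e = 0 \<and> r \<le> i \<and> j = r - 1 \<and> w = (r - 1, r - 1, 0)) then 1 else 0)" for w
  have aux: "(r - 1, r - 1, 0) \<in> Y 0" using r2 rm mn k2 by (auto simp: Y_def jet_vars_def)
  have "weight v < weight (r - 1, r - 1, 0)" if "r \<le> i" "j = r - 1"
  proof -
    have "\<not> r \<le> r - 1" "\<not> r - 1 \<le> r - 2" "\<not> i \<le> r - 2" using that r2 by auto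
    then show ?thesis using that l by (simp add: weight_def ijl)
  qed
  with aux have "y \<in> supported {w \<in> Y e. weight v < weight w \<or> w = v}"
    using v by (simp add: supported_def y_def)
  moreover have "param e y v \<noteq> z v"
  proof -
    have u: "y (u, b, l') = 0" if "u \<le> r - 2" "r - 1 \<le> i" for u b l' using that r2 by (auto simp: y_def ijl)
    have yv: "y (i, j, l) = 1" by (simp add: y_def ijl)
    consider "i \<le> r - 2" | "r - 1 \<le> i" "j \<le> r - 2" | "i = r - 1" "r - 1 \<le> j" | "r \<le> i" "j = r - 1" | "r \<le> i" "r \<le> j"
      by linarith
    then show ?thesis
    proof cases
      case 1
      then show ?thesis using param_top[OF V] yv by (simp add: ijl)
    next
      case 2
      then show ?thesis using param_left[of i j l y e] V 2 u z_eq_0[OF V] yv by (simp add: ijl)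
    next
      case 3
      then show ?thesis using param_corner_row[of j l y e] V u yv by (simp add: ijl)
    next
      case 4
      \<comment> \<open>Level 0 of this column is absent from \<open>Y 1\<close>, so
        \<open>l - e\<close> is a genuine subtraction.\<close>
      have el: "e \<le> l" using e v 4 by (auto simp: ijl Y_def)
      have cf: "coeff (col_factor e y i) a = (if a = l - e then 1 else 0)" for a
        using 4 r2 el l by (auto simp: coeff_col_factor y_def ijl)
      have "coeff (col_factor e y i) a * coeff (shifted y (r - 1) (r - 1)) (l - a) = (if a = l - e then 1 else 0)"
        if "a \<le> l" for a
        using e el 4 r2 k2 that by (auto simp: cf coeff_shifted z_def y_def ijl)
      then have "(\<Sum>a\<le>l. coeff (col_factor e y i) a * coeff (shifted y (r - 1) (r - 1)) (l - a)) = 1"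
        by (simp add: sum.delta)
      moreover have "rank_one_part e y i j = col_factor e y i * shifted y (r - 1) (r - 1)"
        using 4 r2 by (auto simp: rank_one_part_def top_part_def row_factor_def)
      ultimately have "coeff (rank_one_part e y i j) l = 1" by (simp add: coeff_mult)
      then show ?thesis using param_right[of i j l y e] V u 4 z_eq_0[OF V] by (simp add: ijl)
    next
      case 5
      have c: "y (i, r - 1, l') = 0" for l' using 5 r2 by (auto simp: y_def ijl)
      have "l = k - 1" using v 5 e l k2 V by (auto simp: ijl Y_def)
      then show ?thesis using param_corner_block[of i j l y e] V u c 5 yv z_eq_0[OF V] by (auto simp: ijl)
    qed
  qed
  ultimately show ?thesis by blast
qed

lemma dim_ge_Y:
  assumes e: "e = 0 \<or> e = 1"
  shows "enat (card (Y e)) \<le> loc_dim Pf Zs z"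
proof (rule loc_dim_ge[OF infinite_field finite_Y, where \<rho> = weight and \<phi> = "param e" and V = UNIV])
  show "Y e \<subseteq> jet_vars m n k" by (auto simp: Y_def)
qed (use param_polyfun param_in_Zs[OF e] param_0 param_invisible[OF e] param_visible[OF e] in auto)

lemma z_in_Zs: "z \<in> Zs"
  using param_in_Zs[of 0 "\<lambda>_. 0"] by (simp add: param_0 zero_supported)

end

section \<open>Test lines, codimensions and the conclusion\<close>

context jet_determinantal
begin

lemma lead_generic_not_vanishing: "lead (r - 1) 0 \<notin> vanishing"
proof (rule not_vanishing_line[OF infinite_field])
  show "lead (r - 1) 0 \<in> Pf" using rm by (intro lead_polyfun) simp
  \<comment> \<open>This direction changes the pivot from \<open>t\<close> to \<open>s + t\<close>,
    so the leading \<open>(r-1)\<close>-minor gains the constant coefficient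
    \<open>s\<close>.\<close>
  define b :: "nat \<times> nat \<times> nat \<Rightarrow> 'a" where "b = (\<lambda>v. if v = (r - 1, r - 1, 0) then 1 else 0)"
  fix s :: 'a
  let ?p = "\<lambda>v. z v + s * b v"
  have p: "param 0 (\<lambda>v. s * b v) = ?p"
    by (rule param_line) (use k2 in \<open>auto simp: b_def split: if_splits\<close>)
  have "(\<lambda>v. s * b v) \<in> supported (Y 0)"
    using r2 rm mn k2 by (auto simp: supported_def b_def Y_def jet_vars_def)
  then show "?p \<in> Zs" using param_in_Zs[of 0 "\<lambda>v. s * b v"] by (simp add: p)
  assume s: "s \<noteq> 0"
  have diag: "minor (X ?p) (r - 1) Suc Suc = (\<Prod>a<r - 1. X ?p (Suc a) (Suc a))"
    by (rule minor_diagonal, rule poly_eqI) (auto simp: coeff_jet_entry z_def b_def)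
  have one: "X ?p (Suc a) (Suc a) = 1" if "a < r - 2" for a
    by (rule poly_eqI) (use that k2 in \<open>auto simp: coeff_jet_entry z_def b_def\<close>)
  have P0: "(\<Prod>a<r - 2. X ?p (Suc a) (Suc a)) = 1" using one by (intro prod.neutral) simp
  have r: "r - 1 = Suc (r - 2)" using r2 by simp
  have "(\<Prod>a<r - 1. X ?p (Suc a) (Suc a)) = X ?p (r - 1) (r - 1)"
    unfolding r prod.lessThan_Suc P0 by simp
  then have "lead (r - 1) 0 ?p = ?p (r - 1, r - 1, 0)"
    unfolding lead_def diag using k2 by (simp only: coeff_jet_entry) simp
  also have "?p (r - 1, r - 1, 0) = s" using r2 by (auto simp: z_def b_def)
  finally show "lead (r - 1) 0 ?p \<noteq> 0" using s by simp
qed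

lemma lead_product_not_vanishing:
  "(\<lambda>p. lead (r - 2) 0 p * lead (r - 1) 1 p * lead (r + 1) (2 * k - 1) p) \<notin> vanishing"
proof (rule not_vanishing_line[OF infinite_field])
  show "(\<lambda>p. lead (r - 2) 0 p * lead (r - 1) 1 p * lead (r + 1) (2 * k - 1) p) \<in> Pf"
    by (intro polyfun.mult lead_polyfun) (use rm in auto)
  \<comment> \<open>Along this line the leading minors of sizes \<open>r - 2\<close>,
    \<open>r - 1\<close>, \<open>r\<close> and \<open>r + 1\<close> are \<open>1\<close>,
    \<open>t\<close>, \<open>s * t^k\<close> and \<open>s^2 * t^(2k-1)\<close>.\<close>
  define b :: "nat \<times> nat \<times> nat \<Rightarrow> 'a"
    where "b = (\<lambda>v. if v = (r, r, k - 1) \<or> v = (r + 1, r + 1, k - 1) then 1 else 0)"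
  fix s :: 'a
  let ?p = "\<lambda>v. z v + s * b v"
  have p: "param 1 (\<lambda>v. s * b v) = ?p"
    by (rule param_line) (use k2 r2 rm mn in \<open>auto simp: b_def split: if_splits\<close>)
  have "(\<lambda>v. s * b v) \<in> supported (Y 1)"
    using r2 rm mn k2 by (auto simp: supported_def b_def Y_def jet_vars_def)
  then show "?p \<in> Zs" using param_in_Zs[of 1 "\<lambda>v. s * b v"] unfolding p by blast
  assume s: "s \<noteq> 0"
  have diag: "minor (X ?p) N Suc Suc = (\<Prod>a<N. X ?p (Suc a) (Suc a))" for N
    by (rule minor_diagonal, rule poly_eqI) (auto simp: coeff_jet_entry z_def b_def)
  have one: "X ?p (Suc a) (Suc a) = 1" if "a < r - 2" for a
    by (rule poly_eqI) (use that k2 in \<open>auto simp: coeff_jet_entry z_def b_def\<close>)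
  have t: "X ?p (r - 1) (r - 1) = monom 1 1"
    by (rule poly_eqI) (use r2 k2 in \<open>auto simp: coeff_jet_entry z_def b_def\<close>)
  have top: "X ?p i i = monom s (k - 1)" if "i = r \<or> i = r + 1" for i
    by (rule poly_eqI) (use that r2 k2 in \<open>auto simp: coeff_jet_entry z_def b_def\<close>)
  have P0: "(\<Prod>a<r - 2. X ?p (Suc a) (Suc a)) = 1" using one by (intro prod.neutral) simp
  have r: "r - 1 = Suc (r - 2)" "r = Suc (r - 1)" using r2 by auto
  have P1: "(\<Prod>a<r - 1. X ?p (Suc a) (Suc a)) = monom 1 1"
    unfolding r(1) using P0 t r(1) by simp
  have "(\<Prod>a<r. X ?p (Suc a) (Suc a)) = (\<Prod>a<Suc (r - 1). X ?p (Suc a) (Suc a))"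
    using r(2) by simp
  also have "\<dots> = monom 1 1 * monom s (k - 1)"
    unfolding prod.lessThan_Suc P1 using top[of r] r(2) by simp
  finally have P2: "(\<Prod>a<r. X ?p (Suc a) (Suc a)) = monom s k" using k2 by (simp add: mult_monom)
  have "(\<Prod>a<r + 1. X ?p (Suc a) (Suc a)) = monom s k * monom s (k - 1)"
    using P2 top[of "r + 1"] by simp
  also have "\<dots> = monom (s * s) (2 * k - 1)" using k2 by (simp add: mult_monom mult_2)
  finally have P3: "(\<Prod>a<r + 1. X ?p (Suc a) (Suc a)) = monom (s * s) (2 * k - 1)" .
  show "lead (r - 2) 0 ?p * lead (r - 1) 1 ?p * lead (r + 1) (2 * k - 1) ?p \<noteq> 0"
    unfolding lead_def diag P0 P1 P3 using s by simp
qed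

text \<open>Normality fails already because the local ring at \<open>z\<close> has zero divisors.
  The second of them is nonzero there since a multiple of it is.\<close>

lemma not_normal: "\<not> normal_variety Pf Zs"
proof -
  have "lead (r + 1) (2 * k - 1) \<notin> vanishing"
  proof
    assume "lead (r + 1) (2 * k - 1) \<in> vanishing"
    then have "(lead (r - 2) 0 * lead (r - 1) 1) * lead (r + 1) (2 * k - 1) \<in> vanishing"
      by (intro ideal_inD(4)[OF saturatedD(1)[OF saturated_vanishing]] A_rules(4) lead_polyfun) (use rm in auto)
    then show False using lead_product_not_vanishing by (simp add: times_fun_def)
  qed
  then have "\<not> loc_is_domain Pf Zs z"
    using lead_product_zero rm
    by (intro not_loc_is_domain[OF lead_polyfun lead_generic_not_vanishing lead_polyfun]) auto
  then show ?thesis using z_in_Zs by (auto simp: normal_variety_def)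
qed

text \<open>\<open>Y 0\<close> omits the block from \<open>r\<close> on at every level;
  \<open>Y 1\<close> omits it at levels 1 to \<open>k - 2\<close>, and the block from
  \<open>r - 1\<close> on at level 0. The last two sets are disjoint by their levels.\<close>

lemma card_Y_complement:
  defines "a \<equiv> (m + 1 - r) * (n + 1 - r)" and "b \<equiv> (m + 2 - r) * (n + 2 - r)"
  shows "card (Y 0) + a * k = card (jet_vars m n k)" "card (Y 1) + (a * (k - 2) + b) = card (jet_vars m n k)"
proof -
  define C where "C = {r..m} \<times> {r..n} \<times> {..<k}"
  define C' where "C' = {r..m} \<times> {r..n} \<times> {1..k - 2}"
  define C'' where "C'' = {r - 1..m} \<times> {r - 1..n} \<times> {0 :: nat}"
  have sub: "C \<subseteq> jet_vars m n k" "C' \<union> C'' \<subseteq> jet_vars m n k"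
    using r2 k2 by (auto simp: C_def C'_def C''_def jet_vars_def)
  have "Y 0 = jet_vars m n k - C" by (auto simp: Y_def C_def jet_vars_def)
  then have "card (Y 0) + card C = card (jet_vars m n k)"
    using card_mono[OF finite_jet_vars sub(1)] by (simp add: card_Diff_subset[OF _ sub(1)] finite_subset[OF sub(1) finite_jet_vars])
  moreover have "card C = a * k" by (simp add: C_def a_def card_cartesian_product)
  ultimately show "card (Y 0) + a * k = card (jet_vars m n k)" by simp
  have "Y 1 = jet_vars m n k - (C' \<union> C'')" by (auto simp: Y_def C'_def C''_def jet_vars_def)
  then have "card (Y 1) + card (C' \<union> C'') = card (jet_vars m n k)"
    using card_mono[OF finite_jet_vars sub(2)] by (simp add: card_Diff_subset[OF finite_subset[OF sub(2) finite_jet_vars] sub(2)])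
  moreover have "card (C' \<union> C'') = card C' + card C''"
    by (rule card_Un_disjoint) (auto simp: C'_def C''_def)
  moreover have "card C' = a * (k - 2)" by (simp add: C'_def a_def card_cartesian_product)
  moreover have "card C'' = b"
  proof -
    have "Suc m - (r - 1) = m + 2 - r" "Suc n - (r - 1) = n + 2 - r" using r2 by auto
    then show ?thesis by (simp add: C''_def b_def card_cartesian_product)
  qed
  ultimately show "card (Y 1) + (a * (k - 2) + b) = card (jet_vars m n k)" by simp
qed

lemma not_CM:
  assumes "(m, n) \<noteq> (r + 1, r + 2)"
  shows "\<not> CM_variety Pf Zs"
proof -
  define p q where "p = m + 1 - r" and "q = n + 1 - r"
  have pq: "2 \<le> p" "p \<le> q" using rm mn by (auto simp: p_def q_def)
  have pq1: "m + 2 - r = p + 1" "n + 2 - r = q + 1" using rm mn by (auto simp: p_def q_def)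
  have k: "p * q * k = p * q * (k - 2) + 2 * (p * q)"
    using k2 by (metis add_mult_distrib2 le_add_diff_inverse2 mult.commute)
  note card = card_Y_complement[folded p_def q_def, unfolded pq1]
  have "loc_depth Pf Zs z < loc_dim Pf Zs z"
  proof (cases "p = 2 \<and> q = 2")
    case True
    then have mr: "m = r + 1" "n = r + 1" using rm mn by (auto simp: p_def q_def)
    \<comment> \<open>The two codimensions are \<open>4k + 1\<close> and \<open>4k\<close>.\<close>
    have "card (Y 1) < card (Y 0)" using card k True by simp
    then show ?thesis
      using depth_le_Y1[OF mr lead_product_not_vanishing] dim_ge_Y[of 0]
      by (meson enat_ord_simps(2) le_less_trans less_le_trans)
  next
    case False
    have "\<not> (p = 2 \<and> q = 3)" using assms rm mn by (auto simp: p_def q_def)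
    then have "p = 2 \<and> 4 \<le> q \<or> 3 \<le> p" using False pq by auto
    \<comment> \<open>Equivalent to \<open>(p - 1) * (q - 1) > 2\<close>; it compares the
      codimensions after the common part \<open>p * q * (k - 2)\<close> is removed.\<close>
    then have "(p + 1) * (q + 1) < 2 * (p * q)"
    proof
      assume "3 \<le> p"
      then have "3 * q \<le> p * q" by simp
      moreover have "(p + 1) * (q + 1) = p * q + p + q + 1" by (simp add: algebra_simps)
      ultimately show ?thesis using pq \<open>3 \<le> p\<close> by linarith
    qed auto
    then have "card (Y 0) < card (Y 1)" using card k by simp
    then show ?thesis
      using depth_le_Y0[OF lead_generic_not_vanishing] dim_ge_Y[of 1]
      by (meson enat_ord_simps(2) le_less_trans less_le_trans)
  qed
  then show ?thesis using z_in_Zs unfolding CM_variety_def by (metis less_irrefl)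
qed

end

theorem theorem6p2:
  fixes m n r k :: nat
  assumes "alg_closed_field TYPE('a::field)"
    and "2 \<le> r" and "r < m" and "m \<le> n" and "2 \<le> k"
  shows "\<not> normal_variety (polyfun (jet_vars m n k))
              (jet_det_zero_set m n r k :: ((nat \<times> nat \<times> nat) \<Rightarrow> 'a) set)
       \<and> ((m, n) \<noteq> (r + 1, r + 2) \<longrightarrow>
           \<not> CM_variety (polyfun (jet_vars m n k))
              (jet_det_zero_set m n r k :: ((nat \<times> nat \<times> nat) \<Rightarrow> 'a) set))"
proof -
  interpret jet_determinantal m n r k "TYPE('a)"
    by unfold_locales (use assms alg_closed_infinite in auto)
  show ?thesis using not_normal not_CM by blast
qed

end
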